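(* Let $\Lambda\subset\mathbb{R}^d$ be a nonempty discrete set such that the measure $\mu=\sum_{\lambda\in\Lambda}\delta_\lambda$ is a Fourier quasicrystal. Then there is a number $D>0$ (the density of $\Lambda$) such that, uniformly in $x\in\mathbb{R}^d$, $$\#(\Lambda\cap B(x,R))=D\,m_d(B(x,R))+O(R^{d-1})\qquad(R\to\infty).$$ Moreover, there is a bijection $\sigma:D^{-1/d}\mathbb{Z}^d\to\Lambda$ such that for every $\lambda=\sigma(h)\in\Lambda$ one has $\lambda=h+O(1)$ uniformly in $h\in D^{-1/d}\mathbb{Z}^d$, i.e. $\sup_{h\in D^{-1/d}\mathbb{Z}^d}|\sigma(h)-h|<\infty$.
   Context: A set in $\mathbb{R}^d$ is called discrete if its intersection with any ball (equivalently, any compact set) is finite. A complex measure $\mu$ on $\mathbb{R}^d$ with discrete support is called a Fourier quasicrystal if $\mu$ is a tempered distribution, its Fourier transform $\hat\mu$ in the sense of distributions is also a measure with discrete support, and both variation measures $|\mu|$ and $|\hat\mu|$ are tempered distributions. Here $\delta_\lambda$ is the unit mass at the point $\lambda$, $\#E$ is the number of points of a finite set $E$, $m_d$ is $d$-dimensional Lebesgue measure, and $B(x,R)$ is the open ball of radius $R$ centered at $x$. Uniformity in $x$ of the $O$-term means that the implied constant and the range of large $R$ do not depend on $x$. *)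

theory Defs
  imports "HOL-Analysis.Analysis"
begin

section \<open>Schwartz functions\<close>

definition partial_deriv ::
  "'n \<Rightarrow> (real^'n \<Rightarrow> complex) \<Rightarrow> real^'n \<Rightarrow> complex" where
  "partial_deriv j f x = frechet_derivative f (at x) (axis j 1)"

fun iter_partial_deriv ::
  "'n list \<Rightarrow> (real^'n \<Rightarrow> complex) \<Rightarrow> real^'n \<Rightarrow> complex" where
  "iter_partial_deriv [] f = f"
| "iter_partial_deriv (j # js) f = partial_deriv j (iter_partial_deriv js f)"

definition smooth_function :: "(real^'n \<Rightarrow> complex) \<Rightarrow> bool" where
  "smooth_function f \<longleftrightarrow> (\<forall>js x. iter_partial_deriv js f differentiable (at x))"

definition test_function :: "(real^'n \<Rightarrow> complex) \<Rightarrow> bool" where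
  "test_function f \<longleftrightarrow> smooth_function f \<and> compact (closure {x. f x \<noteq> 0})"

definition schwartz :: "(real^'n \<Rightarrow> complex) \<Rightarrow> bool" where
  "schwartz f \<longleftrightarrow> smooth_function f \<and>
     (\<forall>k js. bounded (range (\<lambda>x. (1 + norm x) ^ k *\<^sub>R iter_partial_deriv js f x)))"

text \<open>
  The increasing sequence of norms defining the topology of the Schwartz space.  The supremum
  is that of a nonempty bounded set of reals whenever \<open>f\<close> is a Schwartz function, because
  there are only finitely many index lists of length at most \<open>N\<close>.
\<close>

definition schwartz_norm :: "nat \<Rightarrow> (real^'n \<Rightarrow> complex) \<Rightarrow> real" where
  "schwartz_norm N f =
     (SUP (js, x) \<in> {js. length js \<le> N} \<times> UNIV.
        (1 + norm x) ^ N * norm (iter_partial_deriv js f x))"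


section \<open>Tempered distributions and the Fourier transform\<close>

text \<open>
  A tempered distribution is a continuous linear functional on the Schwartz space.  It is
  represented by a function that is total on the HOL type; its values outside the Schwartz
  space are irrelevant.
\<close>

definition tempered_distribution :: "((real^'n \<Rightarrow> complex) \<Rightarrow> complex) \<Rightarrow> bool" where
  "tempered_distribution T \<longleftrightarrow>
     (\<forall>f g. schwartz f \<longrightarrow> schwartz g \<longrightarrow> T (\<lambda>x. f x + g x) = T f + T g) \<and>
     (\<forall>c f. schwartz f \<longrightarrow> T (\<lambda>x. c * f x) = c * T f) \<and>
     (\<exists>C N. \<forall>f. schwartz f \<longrightarrow> norm (T f) \<le> C * schwartz_norm N f)"

definition fourier :: "(real^'n \<Rightarrow> complex) \<Rightarrow> real^'n \<Rightarrow> complex" where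
  "fourier f y = (\<integral>x. f x * cis (- 2 * pi * (x \<bullet> y)) \<partial>lborel)"

definition distr_fourier ::
  "((real^'n \<Rightarrow> complex) \<Rightarrow> complex) \<Rightarrow> (real^'n \<Rightarrow> complex) \<Rightarrow> complex" where
  "distr_fourier T f = T (fourier f)"


section \<open>Measures with discrete support and Fourier quasicrystals\<close>

text \<open>
  This is stronger than the library's \<^const>\<open>discrete\<close>, which allows
  accumulation points outside the set.
\<close>

definition locally_finite_set :: "(real^'n) set \<Rightarrow> bool" where
  "locally_finite_set S \<longleftrightarrow> (\<forall>x r. finite (S \<inter> ball x r))"

text \<open>
  A complex measure with discrete support is a sum of point masses
  \<open>\<mu> = (\<Sum>x. a x \<cdot> \<delta>\<^sub>x)\<close>; it is given by its mass function \<open>a\<close>, whose set of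
  nonzeros is the support of \<open>\<mu>\<close>.  The measure need not have finite total variation.  Its
  variation measure has mass function \<open>x \<mapsto> \<bar>a x\<bar>\<close>.
\<close>

definition discrete_measure :: "(real^'n \<Rightarrow> complex) \<Rightarrow> bool" where
  "discrete_measure a \<longleftrightarrow> locally_finite_set {x. a x \<noteq> 0}"

definition variation_mass :: "(real^'n \<Rightarrow> complex) \<Rightarrow> real^'n \<Rightarrow> complex" where
  "variation_mass a x = of_real (norm (a x))"

text \<open>
  The integral of a compactly supported \<open>f\<close>; for a discrete measure the sum is finite.
\<close>

definition measure_pairing :: "(real^'n \<Rightarrow> complex) \<Rightarrow> (real^'n \<Rightarrow> complex) \<Rightarrow> complex" where
  "measure_pairing a f = (\<Sum>x \<in> {x. a x \<noteq> 0 \<and> f x \<noteq> 0}. a x * f x)"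

text \<open>
  A distribution is a measure if both agree on all test functions.  As test functions are
  dense in the Schwartz space, a measure determines at most one tempered distribution.
\<close>

definition is_measure ::
  "((real^'n \<Rightarrow> complex) \<Rightarrow> complex) \<Rightarrow> (real^'n \<Rightarrow> complex) \<Rightarrow> bool" where
  "is_measure T a \<longleftrightarrow> (\<forall>f. test_function f \<longrightarrow> T f = measure_pairing a f)"

definition tempered_measure :: "(real^'n \<Rightarrow> complex) \<Rightarrow> bool" where
  "tempered_measure a \<longleftrightarrow> (\<exists>T. tempered_distribution T \<and> is_measure T a)"

definition fourier_quasicrystal :: "(real^'n \<Rightarrow> complex) \<Rightarrow> bool" where
  "fourier_quasicrystal a \<longleftrightarrow>
     discrete_measure a \<and>
     (\<exists>T b. tempered_distribution T \<and> is_measure T a \<and>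
            discrete_measure b \<and> is_measure (distr_fourier T) b \<and>
            tempered_measure (variation_mass a) \<and> tempered_measure (variation_mass b))"


section \<open>The integer lattice\<close>

definition integer_lattice :: "(real^'n) set" where
  "integer_lattice = {z. \<forall>j. z $ j \<in> \<int>}"

end

theory Submission
  imports Defs "HOL-Probability.Sinc_Integral"
begin

text \<open>
  Everything rests on the fact that the support of the transform of \<open>\<mu>\<close> has no point near \<open>0\<close>
  besides \<open>0\<close> itself.  If a test function \<open>f\<close> is supported so close to \<open>0\<close> that it meets that
  support at most in \<open>0\<close>, then so are all its modulations
  \<open>y \<mapsto> f y * cis (2 * pi * (x \<bullet> y))\<close>; these have the same value at \<open>0\<close>, and their Fourier transforms
  are the translates of \<open>g = fourier f\<close>.  Hence \<open>(\<Sum>p\<in>\<Lambda>. g (p - x))\<close> is the same number \<open>c\<close> for every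
  \<open>x\<close>.  Taking for \<open>f\<close> a product of autocorrelations of bump functions of one variable makes \<open>g\<close>
  nonnegative, positive near \<open>0\<close> and rapidly decreasing.  All the Schwartz function calculus is
  thereby reduced to functions of one variable.  This is \<open>quasicrystal_constant_convolution\<close>; its
  analytic part is the approximation of \<open>g\<close> by compactly supported functions in the Schwartz
  topology, needed because \<open>\<mu>\<close> is known only through its values on test functions.

  The constant convolution controls point counts.  Integrating the identity over a bounded set \<open>H\<close>
  gives, with \<open>D = c / \<integral>g\<close>,
  \<open>(\<integral>g) * (#(\<Lambda> \<inter> H) - D * m(H)) = \<integral> g t * (#(\<Lambda> \<inter> H) - #(\<Lambda> \<inter> (H + t))) dt\<close>.
  Positivity of \<open>g\<close> near \<open>0\<close> bounds the number of points in a set by the volume of a neighbourhood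
  of it.  A translation by \<open>t\<close> is a composition of at most \<open>1 + norm t\<close> translations by vectors of
  length at most \<open>1\<close>, and each of these changes the count by at most a constant times the volume of
  a neighbourhood of the boundary of \<open>H\<close>.  As \<open>g\<close> has a finite first moment, the discrepancy of \<open>H\<close>
  is at most a constant times that volume (\<open>discrepancy\<close>).  For balls this is the first assertion.

  For the bijection the same bound is applied to finite unions of cubes of side \<open>L\<close>.  The
  discrepancy is then \<open>O(L^(d-1))\<close> for each cube at the boundary, so for large \<open>L\<close> it is at most
  what is gained by adding the layer of adjacent cubes, of volume \<open>L^d\<close> each.  If \<open>L\<close> is a
  multiple of the lattice spacing, the cubes contain exactly the expected number of lattice points,
  and the inequalities become the conditions of Hall's marriage theorem, in both directions, for
  the relation of lying in adjacent cubes.  The two injections combine to a bijection within that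
  relation, as in the theorem of Schroeder and Bernstein, and adjacency bounds the displacement.
\<close>

section \<open>Smooth functions on the line\<close>

text \<open>
  Carrying all derivatives along makes smoothness of explicit functions a matter of
  exhibiting one formula for every order, and gives the partial derivatives of tensor
  products without further differentiation.
\<close>

definition derivative_sequence :: "(nat \<Rightarrow> real \<Rightarrow> complex) \<Rightarrow> bool" where
  "derivative_sequence F \<longleftrightarrow>
     (\<forall>n t. (F n has_vector_derivative F (Suc n) t) (at t))"

definition leibniz_product ::
  "(nat \<Rightarrow> real \<Rightarrow> complex) \<Rightarrow> (nat \<Rightarrow> real \<Rightarrow> complex) \<Rightarrow> nat \<Rightarrow> real \<Rightarrow> complex" where
  "leibniz_product F G n t = (\<Sum>i\<le>n. of_nat (n choose i) * (F (n - i) t * G i t))"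

lemma leibniz_product_0: "leibniz_product F G 0 = (\<lambda>t. F 0 t * G 0 t)"
  by (simp add: leibniz_product_def fun_eq_iff)

lemma derivative_sequenceD:
  "derivative_sequence F \<Longrightarrow> (F n has_vector_derivative F (Suc n) t) (at t)"
  by (simp add: derivative_sequence_def)

text \<open>
  Pascal's rule.
\<close>

lemma derivative_sequence_leibniz_product:
  assumes F: "derivative_sequence F" and G: "derivative_sequence G"
  shows "derivative_sequence (leibniz_product F G)"
  unfolding derivative_sequence_def
proof (intro allI)
  fix n t
  let ?D = "\<Sum>i\<le>n. of_nat (n choose i) * (F (n - i) t * G (Suc i) t + F (Suc (n - i)) t * G i t)"
  have *: "((\<lambda>t. \<Sum>i\<le>n. of_nat (n choose i) * (F (n - i) t * G i t)) has_vector_derivative ?D) (at t)"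
    by (intro has_vector_derivative_sum has_vector_derivative_mult_right
        has_vector_derivative_mult derivative_sequenceD F G)
  have 1: "(\<Sum>i\<le>n. of_nat (n choose i) * (F (Suc (n - i)) t * G i t)) =
      F (Suc n) t * G 0 t + (\<Sum>i\<le>n. of_nat (n choose Suc i) * (F (n - i) t * G (Suc i) t))"
  proof -
    have "(\<Sum>i\<le>n. of_nat (n choose i) * (F (Suc (n - i)) t * G i t))
        = (\<Sum>i\<le>n. of_nat (n choose i) * (F (Suc n - i) t * G i t))"
      by (intro sum.cong refl) (simp add: Suc_diff_le)
    also have "\<dots> = (\<Sum>i\<le>Suc n. of_nat (n choose i) * (F (Suc n - i) t * G i t))"
      by simp
    also have "\<dots> = F (Suc n) t * G 0 t + (\<Sum>i\<le>n. of_nat (n choose Suc i) * (F (n - i) t * G (Suc i) t))"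
      by (subst sum.atMost_Suc_shift) simp
    finally show ?thesis .
  qed
  have "leibniz_product F G (Suc n) t = ?D"
    unfolding leibniz_product_def
    by (subst sum.atMost_Suc_shift)
       (simp add: distrib_left distrib_right sum.distrib 1)
  with * show "(leibniz_product F G n has_vector_derivative leibniz_product F G (Suc n) t) (at t)"
    by (simp add: leibniz_product_def[abs_def])
qed

lemma derivative_sequence_continuous:
  "derivative_sequence F \<Longrightarrow> continuous_on S (F n)"
  by (meson continuous_at_imp_continuous_on derivative_sequenceD has_vector_derivative_continuous)

lemma derivative_sequence_affine:
  assumes F: "derivative_sequence F"
  shows "derivative_sequence (\<lambda>n t. of_real (a ^ n) * F n (a * t + b))"
  unfolding derivative_sequence_def
proof (intro allI)
  fix n t
  have "((\<lambda>t. a * t + b) has_real_derivative a) (at t)"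
    by (auto intro!: derivative_eq_intros)
  moreover have "(F n has_vector_derivative F (Suc n) (a * t + b)) (at (a * t + b))"
    by (rule derivative_sequenceD[OF F])
  ultimately have "((F n \<circ> (\<lambda>t. a * t + b)) has_vector_derivative a *\<^sub>R F (Suc n) (a * t + b)) (at t)"
    by (intro vector_diff_chain_at) (simp_all add: has_real_derivative_iff_has_vector_derivative)
  then have "((\<lambda>t. of_real (a ^ n) * (F n \<circ> (\<lambda>t. a * t + b)) t) has_vector_derivative
     of_real (a ^ n) * (a *\<^sub>R F (Suc n) (a * t + b))) (at t)"
    by (rule has_vector_derivative_mult_right)
  then show "((\<lambda>t. of_real (a ^ n) * F n (a * t + b)) has_vector_derivative
     of_real (a ^ Suc n) * F (Suc n) (a * t + b)) (at t)"
    by (simp add: o_def scaleR_conv_of_real mult_ac)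
qed

lemma derivative_sequence_cis:
  "derivative_sequence (\<lambda>n t. (\<i> * of_real a) ^ n * cis (a * t))"
  unfolding derivative_sequence_def
proof (intro allI)
  fix n t
  have "((\<lambda>t. cis (a * t)) has_vector_derivative (\<i> * of_real a) * cis (a * t)) (at t)"
  proof -
    have "(cis has_vector_derivative \<i> * cis (a * t)) (at (a * t))"
      by (auto intro!: derivative_eq_intros simp: has_vector_derivative_def cis_conv_exp scaleR_conv_of_real algebra_simps)
    from vector_diff_chain_at[of "\<lambda>t. a * t" a t cis, OF _ this]
    have "((cis \<circ> (\<lambda>t. a * t)) has_vector_derivative a *\<^sub>R (\<i> * cis (a * t))) (at t)"
      by (simp add: has_real_derivative_iff_has_vector_derivative [symmetric] DERIV_cmult_Id)
    then show ?thesis by (simp add: o_def scaleR_conv_of_real mult_ac)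
  qed
  from has_vector_derivative_mult_right[OF this, of "(\<i> * of_real a) ^ n"]
  show "((\<lambda>t. (\<i> * of_real a) ^ n * cis (a * t)) has_vector_derivative
     (\<i> * of_real a) ^ Suc n * cis (a * t)) (at t)"
    by (simp add: mult_ac)
qed

text \<open>
  The polynomials \<open>p\<^sub>n\<close> for which the \<open>n\<close>-th derivative of
  \<open>exp (- 1 / t)\<close> is \<open>p\<^sub>n (1 / t) * exp (- 1 / t)\<close>.
\<close>

primrec bump_poly :: "nat \<Rightarrow> real poly" where
  "bump_poly 0 = 1"
| "bump_poly (Suc n) = [:0, 0, 1:] * (bump_poly n - pderiv (bump_poly n))"

definition half_bump :: "nat \<Rightarrow> real \<Rightarrow> real" where
  "half_bump n t = (if t > 0 then poly (bump_poly n) (1 / t) * exp (- 1 / t) else 0)"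

lemma poly_times_exp_minus_tendsto_0:
  "((\<lambda>s. poly p s * exp (- s)) \<longlongrightarrow> (0::real)) at_top"
proof -
  have "((\<lambda>s. \<Sum>i\<le>degree p. coeff p i * (s ^ i / exp s)) \<longlongrightarrow> (\<Sum>i\<le>degree p. coeff p i * 0)) at_top"
    by (intro tendsto_sum tendsto_mult tendsto_const tendsto_power_div_exp_0)
  then show ?thesis
    by (simp add: poly_altdef exp_minus sum_distrib_left divide_inverse mult_ac)
qed

text \<open>
  Only \<open>t = 0\<close> needs an argument: there the right-hand difference quotient is
  again a polynomial in \<open>1 / t\<close> times \<open>exp (- 1 / t)\<close>, hence tends
  to \<open>0\<close>.
\<close>

lemma half_bump_has_derivative:
  "(half_bump n has_real_derivative half_bump (Suc n) t) (at t)"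
proof -
  consider "t > 0" | "t < 0" | "t = 0" by linarith
  then show ?thesis
  proof cases
    case 1
    have "((\<lambda>t. poly (bump_poly n) (1 / t) * exp (- 1 / t)) has_real_derivative
        half_bump (Suc n) t) (at t)"
      using 1
      by (auto intro!: derivative_eq_intros poly_DERIV[THEN DERIV_chain2]
          simp: half_bump_def field_simps power2_eq_square)
    then show ?thesis
      by (rule DERIV_cong_ev[THEN iffD1, rotated -1])
         (use 1 in \<open>auto simp: half_bump_def eventually_nhds intro!: exI[of _ "{0<..}"]\<close>)
  next
    case 2
    have "((\<lambda>t. 0) has_real_derivative half_bump (Suc n) t) (at t)"
      using 2 by (simp add: half_bump_def)
    then show ?thesis
      by (rule DERIV_cong_ev[THEN iffD1, rotated -1])
         (use 2 in \<open>auto simp: half_bump_def eventually_nhds intro!: exI[of _ "{..<0}"]\<close>)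
  next
    case 3
    have "((\<lambda>h. (half_bump n (0 + h) - half_bump n 0) / h) \<longlongrightarrow> 0) (at 0)"
    proof (rule filterlim_split_at)
      show "((\<lambda>h. (half_bump n (0 + h) - half_bump n 0) / h) \<longlongrightarrow> 0) (at_left 0)"
        by (rule tendsto_eventually) (auto simp: eventually_at_filter half_bump_def)
      have "((\<lambda>h. poly ([:0, 1:] * bump_poly n) (inverse h) * exp (- inverse h)) \<longlongrightarrow> 0) (at_right 0)"
        by (rule filterlim_compose[OF poly_times_exp_minus_tendsto_0 filterlim_inverse_at_top_right])
      then show "((\<lambda>h. (half_bump n (0 + h) - half_bump n 0) / h) \<longlongrightarrow> 0) (at_right 0)"
        by (rule tendsto_cong[THEN iffD1, rotated])
           (auto simp: eventually_at_filter half_bump_def divide_simps)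
    qed
    then show ?thesis
      using 3 by (simp add: DERIV_def half_bump_def)
  qed
qed

lemma derivative_sequence_half_bump:
  "derivative_sequence (\<lambda>n t. of_real (half_bump n t))"
  unfolding derivative_sequence_def
  using bounded_linear.has_vector_derivative[OF bounded_linear_of_real]
    half_bump_has_derivative[unfolded has_real_derivative_iff_has_vector_derivative]
  by blast

definition smooth_supported :: "real \<Rightarrow> (real \<Rightarrow> complex) \<Rightarrow> bool" where
  "smooth_supported r f \<longleftrightarrow>
     (\<exists>F. derivative_sequence F \<and> F 0 = f) \<and> (\<forall>t. \<bar>t\<bar> > r \<longrightarrow> f t = 0)"

text \<open>
  The product of \<open>exp (- 1 / (r + t))\<close> and \<open>exp (- 1 / (r - t))\<close>
  on \<open>\<bar>t\<bar> < r\<close>, normalised by its value at \<open>0\<close>, which is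
  its maximum because \<open>(r + t) * (r - t) \<le> r * r\<close>.
\<close>

lemma smooth_bump_exists:
  assumes "r > 0"
  obtains \<beta> :: "real \<Rightarrow> real"
  where "smooth_supported r (\<lambda>t. of_real (\<beta> t))" "\<forall>t. 0 \<le> \<beta> t \<and> \<beta> t \<le> 1" "\<beta> 0 = 1"
proof
  let ?b = "\<lambda>t. half_bump 0 (t + r) * half_bump 0 (r - t)"
  let ?\<beta> = "\<lambda>t. ?b t / exp (- 2 / r)"
  let ?F = "leibniz_product (\<lambda>n t. of_real (1 ^ n) * of_real (half_bump n (1 * t + r)))
      (\<lambda>n t. of_real ((- 1) ^ n) * of_real (half_bump n ((- 1) * t + r)))"
  \<comment> \<open>Normalisation is multiplication by a constant, whose derivatives are \<open>0\<close>.\<close>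
  let ?G = "leibniz_product ?F (\<lambda>n t. (if n = 0 then of_real (1 / exp (- 2 / r)) else 0))"
  have "derivative_sequence ?G"
    by (intro derivative_sequence_leibniz_product derivative_sequence_affine
        derivative_sequence_half_bump) (auto simp: derivative_sequence_def)
  moreover have "?G 0 = (\<lambda>t. of_real (?\<beta> t))"
    by (simp add: leibniz_product_0)
  ultimately show "smooth_supported r (\<lambda>t. of_real (?\<beta> t))"
    unfolding smooth_supported_def by (auto simp: half_bump_def abs_if split: if_splits)
  show "?\<beta> 0 = 1" using assms by (simp add: half_bump_def exp_add [symmetric])
  show "\<forall>t. 0 \<le> ?\<beta> t \<and> ?\<beta> t \<le> 1"
  proof
    fix t
    have "?b t \<le> exp (- 2 / r)"
    proof (cases "\<bar>t\<bar> < r")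
      case True
      then have pos: "t + r > 0" "r - t > 0" by auto
      have "2 / r \<le> 1 / (t + r) + 1 / (r - t)"
      proof -
        have "1 / (t + r) + 1 / (r - t) = 2 * r / ((t + r) * (r - t))"
          using pos by (simp add: field_simps)
        also have "\<dots> \<ge> 2 * r / (r * r)"
        proof (rule divide_left_mono)
          show "(t + r) * (r - t) \<le> r * r" by (simp add: algebra_simps)
          show "0 < r * r * ((t + r) * (r - t))"
            using pos assms by (intro mult_pos_pos)
        qed (use assms in simp)
        finally show ?thesis using assms by simp
      qed
      moreover have "?b t = exp (- (1 / (t + r) + 1 / (r - t)))"
        using pos by (simp add: half_bump_def exp_add [symmetric])
      ultimately show ?thesis by simp
    qed (auto simp: half_bump_def abs_if split: if_splits)
    then show "0 \<le> ?\<beta> t \<and> ?\<beta> t \<le> 1" by (simp add: half_bump_def)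
  qed
qed

lemma derivative_sequence_support:
  assumes F: "derivative_sequence F" and "\<And>t. \<bar>t\<bar> > r \<Longrightarrow> F 0 t = 0" "\<bar>t\<bar> > r"
  shows "F n t = 0"
  using assms(3)
proof (induction n arbitrary: t)
  case (Suc n)
  have o: "open {t::real. \<bar>t\<bar> > r}"
    by (intro open_Collect_less continuous_intros)
  have "((\<lambda>t. 0) has_vector_derivative F (Suc n) t) (at t)"
    by (rule has_vector_derivative_transform_within_open[OF derivative_sequenceD[OF F, of n t] o])
       (use Suc in auto)
  then show ?case
    using vector_derivative_unique_at has_vector_derivative_const by blast
qed (use assms in auto)

text \<open>
  Reduces Lebesgue integrals over the line to gauge integrals over an interval, where
  differentiation under the integral sign and the exchange of two integrals require only
  continuity.
\<close>

lemma supported_integral: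
  fixes f :: "real \<Rightarrow> complex"
  assumes "continuous_on UNIV f" "\<And>t. \<bar>t\<bar> > r \<Longrightarrow> f t = 0"
  shows "integrable lborel f" "integral\<^sup>L lborel f = integral {-r..r} f"
proof -
  have eq: "(\<lambda>t. indicator {-r..r} t *\<^sub>R f t) = f"
    using assms(2) by (auto simp: indicator_def fun_eq_iff)
  have i: "set_integrable lborel {-r..r} f"
    unfolding set_integrable_def
    by (rule borel_integrable_compact) (use assms(1) continuous_on_subset in auto)
  show "integrable lborel f"
    using i by (simp add: set_integrable_def eq)
  show "integral\<^sup>L lborel f = integral {-r..r} f"
    using set_borel_integral_eq_integral(2)[OF i] by (simp add: set_lebesgue_integral_def eq)
qed

lemma derivative_sequence_integral:
  fixes f :: "nat \<Rightarrow> real \<Rightarrow> real \<Rightarrow> complex"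
  assumes "\<And>n x t. ((\<lambda>x. f n x t) has_vector_derivative f (Suc n) x t) (at x)"
    and cont: "\<And>n. continuous_on UNIV (\<lambda>(x, t). f n x t)"
  shows "derivative_sequence (\<lambda>n x. integral {a..b} (f n x))"
  unfolding derivative_sequence_def
proof (intro allI)
  fix n x
  have c: "continuous_on (UNIV \<times> cbox a b) (\<lambda>(x, t). f n x t)" for n
    using cont continuous_on_subset by blast
  have "continuous_on {a..b} (f n x)" for n x
    using continuous_on_compose2[OF cont[of n], of "{a..b}" "\<lambda>t. (x, t)"]
    by (simp add: continuous_on_Pair continuous_on_const continuous_on_id)
  then have "f n x integrable_on cbox a b" for n x
    by (simp add: integrable_continuous_interval)
  then show "((\<lambda>x. integral {a..b} (f n x)) has_vector_derivative integral {a..b} (f (Suc n) x)) (at x)"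
    using leibniz_rule_vector_derivative[of UNIV a b "f n" "f (Suc n)" x] c assms(1)
    by simp
qed

section \<open>Fourier transforms on the line\<close>

text \<open>
  The case of one variable of \<^const>\<open>fourier\<close>, with the same normalisation.
\<close>

definition fourier1 :: "(real \<Rightarrow> complex) \<Rightarrow> real \<Rightarrow> complex" where
  "fourier1 f x = (\<integral>t. f t * cis (- 2 * pi * (t * x)) \<partial>lborel)"

lemma smooth_supportedE:
  assumes "smooth_supported r f"
  obtains F where "derivative_sequence F" "F 0 = f" "\<forall>n t. \<bar>t\<bar> > r \<longrightarrow> F n t = 0"
  using assms derivative_sequence_support unfolding smooth_supported_def by metis

lemma smooth_supported_continuous:
  "smooth_supported r f \<Longrightarrow> continuous_on S f"
  by (metis derivative_sequence_continuous smooth_supportedE)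

lemma smooth_supported_mult:
  assumes "smooth_supported r f" "derivative_sequence G"
  shows "smooth_supported r (\<lambda>t. f t * G 0 t)"
  using assms derivative_sequence_leibniz_product leibniz_product_0
  unfolding smooth_supported_def by (metis mult_zero_left)

lemma smooth_supported_mult_power:
  assumes "smooth_supported r f"
  shows "smooth_supported r (\<lambda>t. (c * of_real t) ^ n * f t)"
proof (induction n)
  case (Suc n)
  have "derivative_sequence (\<lambda>n t. if n = 0 then c * of_real t else if n = 1 then c else 0)"
    unfolding derivative_sequence_def
    using has_vector_derivative_mult_right[OF bounded_linear.has_vector_derivative[OF bounded_linear_of_real
      has_vector_derivative_id], of c]
    by auto
  from smooth_supported_mult[OF Suc this] show ?case
    by (simp add: mult_ac)
qed (use assms in simp)

lemma fourier1_supported: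
  assumes "continuous_on UNIV f" "\<And>t. \<bar>t\<bar> > r \<Longrightarrow> f t = 0"
  shows "fourier1 f x = integral {-r..r} (\<lambda>t. f t * cis (- 2 * pi * (t * x)))"
  unfolding fourier1_def
  by (rule supported_integral) (use assms in \<open>auto intro!: continuous_intros\<close>)

lemma derivative_sequence_fourier1:
  assumes "continuous_on UNIV f" "\<And>t. \<bar>t\<bar> > r \<Longrightarrow> f t = 0"
  shows "derivative_sequence (\<lambda>n. fourier1 (\<lambda>t. (- 2 * pi * \<i> * of_real t) ^ n * f t))"
proof -
  let ?g = "\<lambda>n x t. (- 2 * pi * \<i> * of_real t) ^ n * f t * cis (- 2 * pi * (t * x))"
  have "derivative_sequence (\<lambda>n x. integral {-r..r} (?g n x))"
  proof (rule derivative_sequence_integral)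
    fix n x t
    have "((\<lambda>x. f t * ((\<i> * of_real (- 2 * pi * t)) ^ n * cis ((- 2 * pi * t) * x))) has_vector_derivative
      f t * ((\<i> * of_real (- 2 * pi * t)) ^ Suc n * cis ((- 2 * pi * t) * x))) (at x)"
      by (intro has_vector_derivative_mult_right derivative_sequenceD[OF derivative_sequence_cis])
    then show "((\<lambda>x. ?g n x t) has_vector_derivative ?g (Suc n) x t) (at x)"
      by (simp add: mult_ac)
  next
    fix n
    have "continuous_on UNIV (\<lambda>p::real \<times> real. f (snd p))"
      by (rule continuous_on_compose2[OF assms(1)]) (auto intro!: continuous_intros)
    then show "continuous_on UNIV (\<lambda>(x, t). ?g n x t)"
      unfolding case_prod_beta by (intro continuous_intros) 
  qed
  moreover have "(\<lambda>n. fourier1 (\<lambda>t. (- 2 * pi * \<i> * of_real t) ^ n * f t)) = (\<lambda>n x. integral {-r..r} (?g n x))"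
    by (intro ext fourier1_supported) (use assms in \<open>auto intro!: continuous_intros\<close>)
  ultimately show ?thesis
    by (simp only:)
qed

text \<open>
  Integration by parts; the boundary terms vanish on an interval that is slightly longer
  than the support.
\<close>

lemma fourier1_derivative:
  assumes F: "derivative_sequence F" and supp: "\<And>n t. \<bar>t\<bar> > r \<Longrightarrow> F n t = 0"
  shows "fourier1 (F (Suc n)) x = 2 * pi * \<i> * of_real x * fourier1 (F n) x"
proof -
  \<comment> \<open>A radius at which \<open>F n\<close> vanishes, including at the end points of the interval.\<close>
  define s where "s = \<bar>r\<bar> + 1"
  have s: "F n t = 0" if "\<bar>t\<bar> \<ge> s" for n t using supp that by (auto simp: s_def)
  let ?e = "\<lambda>t. cis (- 2 * pi * (t * x))"
  note cont = derivative_sequence_continuous[OF F]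
  have "((\<lambda>t. F n t * (of_real (- 2 * pi * x) * \<i> * ?e t) + F (Suc n) t * ?e t) has_integral
     (F n s * ?e s - F n (- s) * ?e (- s))) {-s..s}"
  proof (rule fundamental_theorem_of_calculus)
    fix t
    have "((\<lambda>t. F n t * ?e t) has_vector_derivative
       (F n t * (of_real (- 2 * pi * x) * \<i> * ?e t) + F (Suc n) t * ?e t)) (at t)"
      using has_vector_derivative_mult[OF derivative_sequenceD[OF F, of n t]
          derivative_sequenceD[OF derivative_sequence_cis[of "- 2 * pi * x"], of 0 t]]
      by (simp add: mult_ac)
    then show "((\<lambda>t. F n t * ?e t) has_vector_derivative
       (F n t * (of_real (- 2 * pi * x) * \<i> * ?e t) + F (Suc n) t * ?e t)) (at t within {-s..s})"
      by (rule has_vector_derivative_at_within)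
  qed (simp add: s_def)
  then have 0: "integral {-s..s} (\<lambda>t. F n t * (of_real (- 2 * pi * x) * \<i> * ?e t) + F (Suc n) t * ?e t) = 0"
    using s by (simp add: integral_unique s_def)
  have "integral {-s..s} (\<lambda>t. (of_real (- 2 * pi * x) * \<i>) * (F n t * ?e t) + F (Suc n) t * ?e t)
      = (of_real (- 2 * pi * x) * \<i>) * integral {-s..s} (\<lambda>t. F n t * ?e t) + integral {-s..s} (\<lambda>t. F (Suc n) t * ?e t)"
    by (subst integral_add)
       (auto intro!: integrable_continuous_interval continuous_intros cont)
  moreover have "fourier1 (F n) x = integral {-s..s} (\<lambda>t. F n t * ?e t)" for n
    by (rule fourier1_supported) (use s in \<open>auto intro!: cont\<close>)
  ultimately show ?thesis using 0
    by (simp add: mult_ac add_eq_0_iff)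
qed

definition rapidly_decreasing :: "(real \<Rightarrow> complex) \<Rightarrow> bool" where
  "rapidly_decreasing f \<longleftrightarrow> (\<forall>k. \<exists>C. \<forall>t. (1 + \<bar>t\<bar>) ^ k * norm (f t) \<le> C)"

lemma power_one_plus_le:
  fixes a :: real assumes "a \<ge> 0" shows "(1 + a) ^ k \<le> 2 ^ k * (1 + a ^ k)"
proof (cases "a \<le> 1")
  case True
  then have "(1 + a) ^ k \<le> 2 ^ k" using assms by (intro power_mono) auto
  also have "\<dots> \<le> 2 ^ k * (1 + a ^ k)" using assms by simp
  finally show ?thesis .
next
  case False
  then have "(1 + a) ^ k \<le> (2 * a) ^ k" using assms by (intro power_mono) auto
  also have "\<dots> \<le> 2 ^ k * (1 + a ^ k)" using assms by (simp add: power_mult_distrib)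
  finally show ?thesis .
qed

text \<open>
  The \<open>k\<close>-th derivative of \<open>f\<close> has the transform \<open>(2 * pi *
  \<i> * x) ^ k * fourier1 f x\<close>, which is bounded by the \<open>L\<^sup>1\<close>
  norm of that derivative.
\<close>

lemma rapidly_decreasing_fourier1:
  assumes "smooth_supported r f"
  shows "rapidly_decreasing (fourier1 f)"
  unfolding rapidly_decreasing_def
proof
  fix k
  obtain F where F: "derivative_sequence F" "F 0 = f" and "\<forall>n t. \<bar>t\<bar> > r \<longrightarrow> F n t = 0"
    by (rule smooth_supportedE[OF assms])
  note F = F this(3)[rule_format]
  have iter: "fourier1 (F n) x = (2 * pi * \<i> * of_real x) ^ n * fourier1 f x" for n x
    by (induction n) (simp_all add: F(2) fourier1_derivative[OF F(1,3)] mult_ac)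
  have b: "norm (fourier1 (F n) x) \<le> (\<integral>t. norm (F n t) \<partial>lborel)" for n x
  proof -
    have "norm (fourier1 (F n) x) \<le> (\<integral>t. norm (F n t * cis (- 2 * pi * (t * x))) \<partial>lborel)"
      unfolding fourier1_def by (rule integral_norm_bound)
    then show ?thesis by (simp add: norm_mult)
  qed
  define I where "I n = (\<integral>t. norm (F n t) \<partial>lborel)" for n
  show "\<exists>C. \<forall>t. (1 + \<bar>t\<bar>) ^ k * norm (fourier1 f t) \<le> C"
  proof (intro exI allI)
    fix x :: real
    have "\<bar>x\<bar> ^ k * norm (fourier1 f x) \<le> (2 * pi * \<bar>x\<bar>) ^ k * norm (fourier1 f x)"
      using pi_ge_two by (intro mult_right_mono power_mono) (auto simp: mult_le_cancel_right1)
    also have "\<dots> = norm (fourier1 (F k) x)"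
      by (simp add: iter norm_mult norm_power)
    also have "\<dots> \<le> I k" using b by (simp add: I_def)
    finally have 1: "\<bar>x\<bar> ^ k * norm (fourier1 f x) \<le> I k" .
    have 2: "norm (fourier1 f x) \<le> I 0"
      using b[of 0 x] by (simp add: I_def F(2))
    have "(1 + \<bar>x\<bar>) ^ k * norm (fourier1 f x) \<le> (2 ^ k * (1 + \<bar>x\<bar> ^ k)) * norm (fourier1 f x)"
      by (intro mult_right_mono power_one_plus_le) auto
    also have "\<dots> = 2 ^ k * (norm (fourier1 f x) + \<bar>x\<bar> ^ k * norm (fourier1 f x))"
      by (simp add: algebra_simps)
    also have "\<dots> \<le> 2 ^ k * (I 0 + I k)"
      using 1 2 by (intro mult_left_mono) auto
    finally show "(1 + \<bar>x\<bar>) ^ k * norm (fourier1 f x) \<le> 2 ^ k * (I 0 + I k)" .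
  qed
qed

text \<open>
  Differentiating the transform multiplies \<open>f\<close> by \<open>- 2 * pi * \<i> *
  t\<close>, which preserves smoothness and support.
\<close>

theorem fourier1_smooth_rapidly_decreasing:
  assumes "smooth_supported r f"
  obtains G where "derivative_sequence G" "G 0 = fourier1 f" "\<forall>n. rapidly_decreasing (G n)"
proof
  show "derivative_sequence (\<lambda>n. fourier1 (\<lambda>t. (- 2 * pi * \<i> * of_real t) ^ n * f t))"
    by (rule derivative_sequence_fourier1[where r = r])
       (use assms smooth_supported_continuous in \<open>auto simp: smooth_supported_def\<close>)
  show "\<forall>n. rapidly_decreasing (fourier1 (\<lambda>t. (- 2 * pi * \<i> * of_real t) ^ n * f t))"
    by (intro allI rapidly_decreasing_fourier1[where r = r] smooth_supported_mult_power assms)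
qed simp

text \<open>
  The autocorrelation \<open>\<phi> t = \<integral> \<beta> (t + s) * \<beta> s ds\<close>,
  whose transform is nonnegative by Fubini's theorem.  This is how a compactly supported
  smooth function acquires a nonnegative Fourier transform.
\<close>

lemma fourier1_autocorrelation:
  fixes \<beta> :: "real \<Rightarrow> real"
  assumes "smooth_supported r (\<lambda>t. of_real (\<beta> t))" and r: "r > 0"
  obtains \<phi> where "smooth_supported (2 * r) \<phi>"
    "\<forall>x. fourier1 \<phi> x = of_real ((norm (fourier1 (\<lambda>t. of_real (\<beta> t)) x))\<^sup>2)"
proof -
  obtain H where H: "derivative_sequence H" "H 0 = (\<lambda>t. of_real (\<beta> t))"
    and "\<forall>n t. \<bar>t\<bar> > r \<longrightarrow> H n t = 0"
    by (rule smooth_supportedE[OF assms(1)])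
  note H = H this(3)[rule_format]
  note cont = derivative_sequence_continuous[OF H(1)]
  have cont': "continuous_on S (\<lambda>p. H n (f p))" if "continuous_on S f"
    for n and f :: "'a::topological_space \<Rightarrow> real" and S
    by (rule continuous_on_compose2[OF cont[of UNIV n] that]) auto
  define \<Phi> where "\<Phi> n t = integral {-r..r} (\<lambda>s. H n (t + s) * H 0 s)" for n t
  have "derivative_sequence \<Phi>"
    unfolding \<Phi>_def
  proof (rule derivative_sequence_integral)
    fix n t s
    have "derivative_sequence (\<lambda>n t. of_real (1 ^ n) * H n (1 * t + s))"
      by (rule derivative_sequence_affine[OF H(1)])
    from derivative_sequenceD[OF this, of n t]
    have "((\<lambda>t. H n (t + s)) has_vector_derivative H (Suc n) (t + s)) (at t)" by simp
    then show "((\<lambda>t. H n (t + s) * H 0 s) has_vector_derivative H (Suc n) (t + s) * H 0 s) (at t)"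
      by (rule has_vector_derivative_mult_left)
    show "continuous_on UNIV (\<lambda>(x, t). H n (x + t) * H 0 t)"
      unfolding case_prod_beta by (intro continuous_intros cont')
  qed
  moreover have zero: "\<Phi> 0 t = 0" if "\<bar>t\<bar> > 2 * r" for t
  proof -
    have "integral {-r..r} (\<lambda>s. H 0 (t + s) * H 0 s) = integral {-r..r} (\<lambda>s. 0)"
      by (rule Henstock_Kurzweil_Integration.integral_cong) (use that in \<open>auto intro!: H(3)\<close>)
    then show ?thesis by (simp add: \<Phi>_def)
  qed
  ultimately have "smooth_supported (2 * r) (\<Phi> 0)"
    by (auto simp: smooth_supported_def)
  moreover have "fourier1 (\<Phi> 0) x = of_real ((norm (fourier1 (\<lambda>t. of_real (\<beta> t)) x))\<^sup>2)" for x
  proof -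
    let ?e = "\<lambda>t. cis (- 2 * pi * (t * x))"
    have shift: "integral {- (2 * r)..2 * r} (\<lambda>t. H 0 (t + s) * H 0 s * ?e t) = fourier1 (H 0) x * (H 0 s * cis (2 * pi * (s * x)))"
      if "s \<in> {-r..r}" for s
    proof -
      have "integral {- (2 * r)..2 * r} (\<lambda>t. H 0 (t + s) * H 0 s * ?e t)
          = (\<integral>t. H 0 (t + s) * H 0 s * ?e t \<partial>lborel)"
        by (rule supported_integral(2)[symmetric])
           (use that in \<open>auto intro!: continuous_intros cont' H(3)\<close>)
      also have "\<dots> = (\<integral>t. H 0 (t + s) * ?e (t + s) * (H 0 s * cis (2 * pi * (s * x))) \<partial>lborel)"
      proof (intro Bochner_Integration.integral_cong refl)
        fix t
        have "?e t = ?e (t + s) * cis (2 * pi * (s * x))"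
          by (simp add: cis_mult algebra_simps)
        then show "H 0 (t + s) * H 0 s * ?e t
            = H 0 (t + s) * ?e (t + s) * (H 0 s * cis (2 * pi * (s * x)))"
          by (simp only: mult_ac)
      qed
      also have "\<dots> = (\<integral>t. H 0 (t + s) * ?e (t + s) \<partial>lborel) * (H 0 s * cis (2 * pi * (s * x)))"
        by (rule integral_mult_left_zero)
      also have "(\<integral>t. H 0 (t + s) * ?e (t + s) \<partial>lborel) = fourier1 (H 0) x"
        using lborel_integral_real_affine[of 1 "\<lambda>t. H 0 t * ?e t" s]
        by (simp add: fourier1_def add_ac)
      finally show ?thesis by simp
    qed
    have "fourier1 (\<Phi> 0) x = integral {-(2 * r)..2 * r} (\<lambda>t. \<Phi> 0 t * ?e t)"
      by (rule fourier1_supported) (use zero in \<open>auto intro!: derivative_sequence_continuous \<open>derivative_sequence \<Phi>\<close>\<close>)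
    also have "\<dots> = integral (cbox (-(2 * r)) (2 * r)) (\<lambda>t. integral (cbox (-r) r) (\<lambda>s. H 0 (t + s) * H 0 s * ?e t))"
      by (simp add: \<Phi>_def)
    also have "\<dots> = integral (cbox (-r) r) (\<lambda>s. integral (cbox (-(2 * r)) (2 * r)) (\<lambda>t. H 0 (t + s) * H 0 s * ?e t))"
      by (rule integral_swap_continuous)
         (auto simp: case_prod_beta intro!: continuous_intros cont')
    also have "\<dots> = integral {-r..r} (\<lambda>s. fourier1 (H 0) x * (H 0 s * cis (2 * pi * (s * x))))"
      unfolding cbox_interval by (intro Henstock_Kurzweil_Integration.integral_cong shift)
    also have "\<dots> = fourier1 (H 0) x * integral {-r..r} (\<lambda>s. H 0 s * cis (2 * pi * (s * x)))"
      by simp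
    also have "integral {-r..r} (\<lambda>s. H 0 s * cis (2 * pi * (s * x))) = cnj (fourier1 (H 0) x)"
    proof -
      have "fourier1 (H 0) x = integral {-r..r} (\<lambda>s. H 0 s * ?e s)"
        by (rule fourier1_supported[OF cont H(3)])
      then show ?thesis by (simp add: integral_cnj H(2) cis_cnj)
    qed
    finally show ?thesis
      by (simp only: H(2) complex_norm_square)
  qed
  ultimately show ?thesis using that[of "\<Phi> 0"] by blast
qed

lemma fourier1_at_0_nonzero:
  fixes \<beta> :: "real \<Rightarrow> real"
  assumes "smooth_supported r (\<lambda>t. of_real (\<beta> t))" "\<And>t. \<beta> t \<ge> 0" "\<beta> 0 = 1" "r > 0"
  shows "fourier1 (\<lambda>t. of_real (\<beta> t)) 0 \<noteq> 0"
proof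
  assume 0: "fourier1 (\<lambda>t. of_real (\<beta> t)) 0 = 0"
  have cont: "continuous_on UNIV (\<lambda>t. complex_of_real (\<beta> t))"
    by (rule smooth_supported_continuous[OF assms(1)])
  have supp: "\<bar>t\<bar> > r \<Longrightarrow> complex_of_real (\<beta> t) = 0" for t
    using assms(1) by (simp add: smooth_supported_def)
  have i: "integrable lborel (\<lambda>t. complex_of_real (\<beta> t))"
    by (rule supported_integral[OF cont supp])
  have c: "continuous_on UNIV \<beta>"
    using continuous_on_Re[OF cont] by simp
  have "(\<integral>t. \<beta> t \<partial>lborel) = 0"
    using 0 by (simp add: fourier1_def)
  moreover have "(\<integral>t. complex_of_real (\<beta> t) \<partial>lborel) = integral {-r..r} (\<lambda>t. complex_of_real (\<beta> t))"
    by (rule supported_integral[OF cont supp])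
  ultimately have "integral {-r..r} (\<lambda>t. complex_of_real (\<beta> t)) = 0"
    by simp
  moreover have "((\<lambda>t. complex_of_real (\<beta> t)) has_integral integral {-r..r} (\<lambda>t. complex_of_real (\<beta> t))) {-r..r}"
    by (intro integrable_integral integrable_continuous_interval continuous_on_subset[OF cont]) auto
  ultimately have "((\<lambda>t. complex_of_real (\<beta> t)) has_integral 0) {-r..r}" by simp
  from has_integral_linear[OF this bounded_linear_Re]
  have "(\<beta> has_integral 0) (cbox (-r) r)" by (simp add: o_def)
  from has_integral_0_cbox_imp_0[OF _ _ this, of 0]
  have "\<beta> 0 = 0"
    using assms c by (auto intro: continuous_on_subset simp: box_real)
  with assms show False by simp
qed

section \<open>Tensor products\<close>

definition tensor :: "('d::finite \<Rightarrow> real \<Rightarrow> 'a::comm_monoid_mult) \<Rightarrow> real^'d \<Rightarrow> 'a" where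
  "tensor f x = (\<Prod>j\<in>UNIV. f j (x $ j))"

lemma bij_betw_axis: "bij_betw (\<lambda>j. axis j (1::real)) UNIV (Basis :: (real^'d) set)"
  by (auto simp: bij_betw_def inj_on_def Basis_vec_def axis_eq_axis)

text \<open>
  Fubini's theorem, by writing Lebesgue measure on \<open>real^'d\<close> as the image of
  the product measure over the basis vectors.
\<close>

lemma tensor_integrable_lborel:
  fixes f :: "'d::finite \<Rightarrow> real \<Rightarrow> 'b::{real_normed_field, banach, second_countable_topology}"
  assumes "\<And>j. integrable lborel (f j)"
  shows "integrable lborel (tensor f)"
    and "(\<integral>x. tensor f x \<partial>lborel) = (\<Prod>j\<in>UNIV. \<integral>t. f j t \<partial>lborel)"
proof -
  interpret product_sigma_finite "\<lambda>b :: real^'d. lborel :: real measure"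
    by standard
  let ?P = "\<Pi>\<^sub>M b\<in>(Basis :: (real^'d) set). (lborel :: real measure)"
  let ?s = "\<lambda>y. \<Sum>b\<in>(Basis :: (real^'d) set). y b *\<^sub>R b"
  let ?f = "\<lambda>b :: real^'d. f (axis_index b)"
  have [measurable]: "f j \<in> borel_measurable borel" for j
    using borel_measurable_integrable[OF assms[of j]] by simp
  have m: "tensor f \<in> borel_measurable borel"
    unfolding tensor_def[abs_def] by measurable
  have s: "?s \<in> measurable ?P borel"
    by measurable
  have eq: "tensor f (?s y) = (\<Prod>b\<in>Basis. ?f b (y b))" for y
  proof -
    have "?s y $ j = y (axis j 1)" for j
    proof -
      have "?s y $ j = ?s y \<bullet> axis j 1" by (simp add: inner_axis)
      also have "\<dots> = y (axis j 1)"
        by (subst inner_sum_left_Basis) (auto simp: axis_in_Basis_iff)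
      finally show ?thesis .
    qed
    then show ?thesis
      unfolding tensor_def
      by (simp add: prod.reindex_bij_betw[OF bij_betw_axis, symmetric] axis_index_axis)
  qed
  have i: "integrable ?P (\<lambda>y. tensor f (?s y))"
    unfolding eq by (rule product_integrable_prod) (use assms in auto)
  have L: "lborel = distr ?P borel ?s" by (rule lborel_eq)
  show "integrable lborel (tensor f)"
    unfolding L using i by (subst integrable_distr_eq[OF s m])
  have "(\<integral>x. tensor f x \<partial>lborel) = (\<integral>y. tensor f (?s y) \<partial>?P)"
    by (subst L) (rule integral_distr[OF s m])
  also have "\<dots> = (\<Prod>b\<in>Basis. \<integral>t. ?f b t \<partial>lborel)"
    unfolding eq by (rule product_integral_prod) (use assms in auto)
  also have "\<dots> = (\<Prod>j\<in>UNIV. \<integral>t. f j t \<partial>lborel)"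
    by (simp add: prod.reindex_bij_betw[OF bij_betw_axis, symmetric] axis_index_axis)
  finally show "(\<integral>x. tensor f x \<partial>lborel) = (\<Prod>j\<in>UNIV. \<integral>t. f j t \<partial>lborel)" .
qed

lemma cis_sum: "finite A \<Longrightarrow> cis (\<Sum>j\<in>A. a j) = (\<Prod>j\<in>A. cis (a j))"
  by (induction rule: finite_induct) (auto simp flip: cis_mult)

lemma fourier_tensor:
  fixes f :: "'d::finite \<Rightarrow> real \<Rightarrow> complex"
  assumes "\<And>j. integrable lborel (f j)"
  shows "fourier (tensor f) = tensor (\<lambda>j. fourier1 (f j))"
proof
  fix x :: "real^'d"
  have "tensor f y * cis (- 2 * pi * (y \<bullet> x)) = tensor (\<lambda>j t. f j t * cis (- 2 * pi * (t * x $ j))) y"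
    for y :: "real^'d"
  proof -
    have "- 2 * pi * (y \<bullet> x) = (\<Sum>j\<in>UNIV. - 2 * pi * (y $ j * x $ j))"
      by (simp add: inner_vec_def sum_distrib_left)
    then show ?thesis
      by (simp only: cis_sum[OF finite] tensor_def prod.distrib)
  qed
  then have "fourier (tensor f) x = (\<integral>y. tensor (\<lambda>j t. f j t * cis (- 2 * pi * (t * x $ j))) y \<partial>lborel)"
    by (simp only: fourier_def)
  also have "\<dots> = (\<Prod>j\<in>UNIV. \<integral>t. f j t * cis (- 2 * pi * (t * x $ j)) \<partial>lborel)"
  proof (rule tensor_integrable_lborel(2))
    fix j
    have "integrable lborel (\<lambda>t. norm (f j t))" using assms by simp
    then show "integrable lborel (\<lambda>t. f j t * cis (- 2 * pi * (t * x $ j)))"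
    proof (rule Bochner_Integration.integrable_bound)
      have [measurable]: "(\<lambda>t. cis (- 2 * pi * (t * x $ j))) \<in> borel_measurable borel"
        by (intro borel_measurable_continuous_onI continuous_intros)
      have [measurable]: "f j \<in> borel_measurable lborel"
        using assms by (rule borel_measurable_integrable)
      show "(\<lambda>t. f j t * cis (- 2 * pi * (t * x $ j))) \<in> borel_measurable lborel"
        by measurable
    qed (simp add: norm_mult)
  qed
  finally show "fourier (tensor f) x = tensor (\<lambda>j. fourier1 (f j)) x"
    by (simp add: tensor_def fourier1_def)
qed

lemma tensor_has_derivative:
  fixes F :: "'d::finite \<Rightarrow> nat \<Rightarrow> real \<Rightarrow> complex"
  assumes "\<And>j. derivative_sequence (F j)"
  shows "(tensor (\<lambda>j. F j (\<nu> j)) has_derivative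
     (\<lambda>v. \<Sum>i\<in>UNIV. (v $ i) *\<^sub>R F i (Suc (\<nu> i)) (x $ i) * (\<Prod>j\<in>UNIV - {i}. F j (\<nu> j) (x $ j)))) (at x)"
  unfolding tensor_def[abs_def]
proof (rule has_derivative_prod)
  fix j :: 'd
  have "(F j (\<nu> j) has_derivative (\<lambda>t. t *\<^sub>R F j (Suc (\<nu> j)) (x $ j))) (at (x $ j))"
    using derivative_sequenceD[OF assms] by (simp add: has_vector_derivative_def)
  then show "((\<lambda>x. F j (\<nu> j) (x $ j)) has_derivative (\<lambda>v. (v $ j) *\<^sub>R F j (Suc (\<nu> j)) (x $ j))) (at x)"
    by (rule has_derivative_compose[rotated])
       (intro bounded_linear_imp_has_derivative bounded_linear_vec_nth)
qed

lemma partial_deriv_tensor: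
  fixes F :: "'d::finite \<Rightarrow> nat \<Rightarrow> real \<Rightarrow> complex"
  assumes "\<And>j. derivative_sequence (F j)"
  shows "partial_deriv i (tensor (\<lambda>j. F j (\<nu> j))) = tensor (\<lambda>j. F j ((\<nu>(i := Suc (\<nu> i))) j))"
proof
  fix x :: "real^'d"
  have "partial_deriv i (tensor (\<lambda>j. F j (\<nu> j))) x =
     (\<Sum>k\<in>UNIV. (axis i 1 $ k) *\<^sub>R F k (Suc (\<nu> k)) (x $ k) * (\<Prod>j\<in>UNIV - {k}. F j (\<nu> j) (x $ j)))"
    unfolding partial_deriv_def frechet_derivative_at[OF tensor_has_derivative[OF assms], symmetric] ..
  also have "\<dots> = (\<Sum>k\<in>UNIV. if k = i then F i (Suc (\<nu> i)) (x $ i) * (\<Prod>j\<in>UNIV - {i}. F j (\<nu> j) (x $ j)) else 0)"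
    by (intro sum.cong) (auto simp: axis_def)
  also have "\<dots> = F i (Suc (\<nu> i)) (x $ i) * (\<Prod>j\<in>UNIV - {i}. F j (\<nu> j) (x $ j))"
    by simp
  also have "\<dots> = tensor (\<lambda>j. F j ((\<nu>(i := Suc (\<nu> i))) j)) x"
    unfolding tensor_def by (subst prod.remove[of UNIV i]) (auto intro!: prod.cong)
  finally show "partial_deriv i (tensor (\<lambda>j. F j (\<nu> j))) x = tensor (\<lambda>j. F j ((\<nu>(i := Suc (\<nu> i))) j)) x" .
qed

lemma iter_partial_deriv_tensor:
  fixes F :: "'d::finite \<Rightarrow> nat \<Rightarrow> real \<Rightarrow> complex"
  assumes "\<And>j. derivative_sequence (F j)"
  shows "iter_partial_deriv js (tensor (\<lambda>j. F j 0)) = tensor (\<lambda>j. F j (count_list js j))"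
proof (induction js)
  case (Cons i js)
  have "(\<lambda>j. F j (((\<lambda>j. count_list js j)(i := Suc (count_list js i))) j)) = (\<lambda>j. F j (count_list (i # js) j))"
    by (auto simp: fun_eq_iff)
  then show ?case
    using Cons partial_deriv_tensor[of F i "count_list js", OF assms] by simp
qed simp

lemma smooth_function_tensor:
  fixes F :: "'d::finite \<Rightarrow> nat \<Rightarrow> real \<Rightarrow> complex"
  assumes "\<And>j. derivative_sequence (F j)"
  shows "smooth_function (tensor (\<lambda>j. F j 0))"
  unfolding smooth_function_def iter_partial_deriv_tensor[of F, OF assms]
  using tensor_has_derivative[of F, OF assms] unfolding differentiable_def by blast

lemma one_plus_sum_le_prod:
  fixes a :: "'b \<Rightarrow> real"
  assumes "finite A" "\<And>j. j \<in> A \<Longrightarrow> a j \<ge> 0"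
  shows "1 + (\<Sum>j\<in>A. a j) \<le> (\<Prod>j\<in>A. 1 + a j)"
  using assms
proof (induction rule: finite_induct)
  case (insert j A)
  have "1 + (\<Sum>j\<in>insert j A. a j) \<le> (1 + a j) * (1 + (\<Sum>j\<in>A. a j))"
    using insert by (auto simp: algebra_simps intro!: mult_nonneg_nonneg sum_nonneg)
  also have "\<dots> \<le> (1 + a j) * (\<Prod>j\<in>A. 1 + a j)"
    using insert by (intro mult_left_mono) auto
  finally show ?case using insert by simp
qed simp

text \<open>
  The weights of the Schwartz norms are dominated by products of weights in one variable, so
  decay can be checked factor by factor.
\<close>

lemma one_plus_norm_le_prod:
  fixes x :: "real^'d"
  shows "1 + norm x \<le> (\<Prod>j\<in>UNIV. 1 + \<bar>x $ j\<bar>)"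
  using norm_le_l1_cart[of x] one_plus_sum_le_prod[of UNIV "\<lambda>j. \<bar>x $ j\<bar>"] by simp

lemma one_plus_norm_power_le_prod:
  fixes x :: "real^'d"
  shows "(1 + norm x) ^ k \<le> (\<Prod>j\<in>UNIV. (1 + \<bar>x $ j\<bar>) ^ k)"
  unfolding prod_power_distrib[symmetric] by (intro power_mono one_plus_norm_le_prod) simp

lemma tensor_decay:
  fixes x :: "real^'d"
  assumes "\<And>j. (1 + \<bar>x $ j\<bar>) ^ k * norm (f j (x $ j)) \<le> C j"
  shows "(1 + norm x) ^ k * norm (tensor f x :: complex) \<le> (\<Prod>j\<in>UNIV. C j)"
proof -
  have "(1 + norm x) ^ k * norm (tensor f x) \<le> (\<Prod>j\<in>UNIV. (1 + \<bar>x $ j\<bar>) ^ k) * norm (tensor f x)"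
    by (intro mult_right_mono one_plus_norm_power_le_prod) simp
  also have "\<dots> = (\<Prod>j\<in>UNIV. (1 + \<bar>x $ j\<bar>) ^ k * norm (f j (x $ j)))"
    by (simp add: tensor_def prod_norm prod.distrib)
  also have "\<dots> \<le> (\<Prod>j\<in>UNIV. C j)"
    by (intro prod_mono) (use assms in auto)
  finally show ?thesis .
qed

lemma schwartz_tensor:
  assumes F: "\<And>j. derivative_sequence (F j)" and "\<And>j n. rapidly_decreasing (F j n)"
  shows "schwartz (tensor (\<lambda>j. F j 0) :: real^'d \<Rightarrow> complex)"
  unfolding schwartz_def
proof (intro conjI allI)
  show "smooth_function (tensor (\<lambda>j. F j 0) :: real^'d \<Rightarrow> complex)" by (rule smooth_function_tensor[OF F])
  fix k :: nat and js :: "'d list"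
  have "\<forall>j. \<exists>C. \<forall>t. (1 + \<bar>t\<bar>) ^ k * norm (F j (count_list js j) t) \<le> C"
    using assms(2) unfolding rapidly_decreasing_def by blast
  then obtain C where C: "\<And>j t. (1 + \<bar>t\<bar>) ^ k * norm (F j (count_list js j) t) \<le> C j"
    by metis
  show "bounded (range (\<lambda>x. (1 + norm x) ^ k *\<^sub>R iter_partial_deriv js (tensor (\<lambda>j. F j 0)) x))"
    unfolding bounded_iff iter_partial_deriv_tensor[of F, OF F]
    using tensor_decay[where f = "\<lambda>j. F j (count_list js j)" and C = C and k = k] C
    by (auto simp: abs_of_nonneg)
qed

lemma test_function_tensor:
  assumes "\<And>j. smooth_supported r (f j)"
  shows "test_function (tensor f :: real^'d \<Rightarrow> complex)"
proof -
  have "\<forall>j. \<exists>F. derivative_sequence F \<and> F 0 = f j"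
    using assms unfolding smooth_supported_def by blast
  then obtain F where F: "\<And>j. derivative_sequence (F j)" "\<And>j. F j 0 = f j" by metis
  have "smooth_function (tensor f :: real^'d \<Rightarrow> complex)"
    using smooth_function_tensor[OF F(1)] F(2) by simp
  moreover have "{x. tensor f x \<noteq> 0} \<subseteq> cbox (\<chi> j. - r) (\<chi> j. r)"
  proof
    fix x :: "real^'d"
    assume "x \<in> {x. tensor f x \<noteq> 0}"
    then have "f j (x $ j) \<noteq> 0" for j
      by (auto simp: tensor_def)
    then have "\<bar>x $ j\<bar> \<le> r" for j
      using assms by (meson not_less smooth_supported_def)
    then show "x \<in> cbox (\<chi> j. - r) (\<chi> j. r)"
      by (auto simp: mem_box_cart abs_le_iff) (metis add.inverse_inverse neg_le_iff_le)
  qed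
  then have "bounded {x. tensor f x \<noteq> 0}"
    using bounded_cbox bounded_subset by blast
  ultimately show ?thesis
    by (simp add: test_function_def)
qed

section \<open>Sums over a quasicrystal\<close>

text \<open>
  The derivatives of \<open>t \<mapsto> F 0 t * X 0 (t / m)\<close>.
\<close>

definition cutoff_sequence ::
  "(nat \<Rightarrow> real \<Rightarrow> complex) \<Rightarrow> (nat \<Rightarrow> real \<Rightarrow> complex) \<Rightarrow> real \<Rightarrow> nat \<Rightarrow> real \<Rightarrow> complex" where
  "cutoff_sequence F X m = leibniz_product F (\<lambda>n t. of_real ((1 / m) ^ n) * X n (1 / m * t + 0))"

lemma cutoff_sequence_0: "cutoff_sequence F X m 0 t = F 0 t * X 0 (t / m)"
  by (simp add: cutoff_sequence_def leibniz_product_0)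

lemma derivative_sequence_cutoff:
  "derivative_sequence F \<Longrightarrow> derivative_sequence X \<Longrightarrow> derivative_sequence (cutoff_sequence F X m)"
  unfolding cutoff_sequence_def
  by (intro derivative_sequence_leibniz_product derivative_sequence_affine)

lemma derivative_sequence_lipschitz:
  assumes "derivative_sequence X" "\<And>t. norm (X (Suc n) t) \<le> B"
  shows "norm (X n s - X n t) \<le> B * \<bar>s - t\<bar>"
proof -
  have "norm (X n s - X n t) \<le> B * norm (s - t)"
  proof (rule differentiable_bound[of UNIV "X n" "\<lambda>t h. h *\<^sub>R X (Suc n) t"])
    fix x :: real
    show "(X n has_derivative (\<lambda>h. h *\<^sub>R X (Suc n) x)) (at x within UNIV)"
      using derivative_sequenceD[OF assms(1)] by (simp add: has_vector_derivative_def)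
    show "onorm (\<lambda>h. h *\<^sub>R X (Suc n) x) \<le> B"
    proof (rule onorm_le)
      show "norm (h *\<^sub>R X (Suc n) x) \<le> B * norm h" for h
        using mult_right_mono[OF assms(2)[of x] norm_ge_zero[of h]] by (simp add: mult.commute)
    qed
  qed auto
  then show ?thesis by simp
qed

text \<open>
  In the Leibniz expansion, each term that differentiates the cutoff carries a positive
  power of \<open>1 / m\<close>.  The remaining term is \<open>F n t * (X 0 (t / m) - X 0
  0)\<close>, where the Lipschitz bound on \<open>X 0\<close> gives \<open>\<bar>t\<bar> /
  m\<close> and the factor \<open>\<bar>t\<bar>\<close> is absorbed by the decay of \<open>F
  n\<close>.
\<close>

lemma cutoff_sequence_error:
  assumes X: "derivative_sequence X" "X 0 0 = 1"
    and XB: "\<And>n t. norm (X n t) \<le> B n"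
    and A: "\<And>n k t. (1 + \<bar>t\<bar>) ^ k * norm (F n t) \<le> A n k"
  shows "\<exists>C. \<forall>m\<ge>1. \<forall>t. (1 + \<bar>t\<bar>) ^ k * norm (cutoff_sequence F X m n t - F n t) \<le> C / m"
proof (intro exI allI impI)
  fix m t :: real
  assume m: "m \<ge> 1"
  have B0: "B i \<ge> 0" for i using XB[of i 0] norm_ge_zero order_trans by blast
  have A0: "A i k \<ge> 0" for i k
    using A[of 0 k i] order_trans[OF norm_ge_zero[of "F i 0"]] by simp
  let ?w = "(1 + \<bar>t\<bar>) ^ k"
  let ?T = "\<lambda>i. of_nat (n choose Suc i) * (F (n - Suc i) t * (of_real ((1 / m) ^ Suc i) * X (Suc i) (t / m)))"
  have "cutoff_sequence F X m n t - F n t = F n t * (X 0 (t / m) - X 0 0) + (\<Sum>i<n. ?T i)"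
    unfolding cutoff_sequence_def leibniz_product_def
    by (subst sum.atMost_shift) (simp add: X(2) algebra_simps)
  then have "?w * norm (cutoff_sequence F X m n t - F n t)
      \<le> ?w * (norm (F n t * (X 0 (t / m) - X 0 0)) + (\<Sum>i<n. norm (?T i)))"
    by (intro mult_left_mono) (auto intro: order_trans[OF norm_triangle_ineq] norm_sum add_left_mono)
  also have "\<dots> = ?w * norm (F n t) * norm (X 0 (t / m) - X 0 0) + (\<Sum>i<n. ?w * norm (?T i))"
    by (simp add: norm_mult distrib_left sum_distrib_left)
  also have "\<dots> \<le> A n (Suc k) * B 1 / m + (\<Sum>i<n. of_nat (n choose Suc i) * (A (n - Suc i) k * B (Suc i)) / m)"
  proof (intro add_mono sum_mono)
    have "norm (X 0 (t / m) - X 0 0) \<le> B (Suc 0) * \<bar>t / m - 0\<bar>"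
      by (rule derivative_sequence_lipschitz[OF X(1) XB])
    then have "?w * norm (F n t) * norm (X 0 (t / m) - X 0 0) \<le> ?w * norm (F n t) * (B 1 * (\<bar>t\<bar> / m))"
      using m by (intro mult_left_mono) auto
    also have "\<dots> \<le> ?w * norm (F n t) * (B 1 * ((1 + \<bar>t\<bar>) / m))"
      using m B0 by (intro mult_left_mono divide_right_mono) auto
    also have "\<dots> = ((1 + \<bar>t\<bar>) ^ Suc k * norm (F n t)) * (B 1 / m)"
      by (simp add: mult_ac)
    also have "\<dots> \<le> A n (Suc k) * (B 1 / m)"
      using B0 m by (intro mult_right_mono A) auto
    finally show "?w * norm (F n t) * norm (X 0 (t / m) - X 0 0) \<le> A n (Suc k) * B 1 / m" by simp
  next
    fix i assume "i \<in> {..<n}"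
    have p: "(1 / m) ^ Suc i \<le> 1 / m"
      using m power_le_one[of "1 / m" i] by (simp add: mult_left_le_one_le divide_le_eq)
    have "?w * norm (?T i) = of_nat (n choose Suc i) * ((?w * norm (F (n - Suc i) t)) * norm (X (Suc i) (t / m))) * (1 / m) ^ Suc i"
      using m by (simp add: norm_mult norm_power norm_divide mult_ac)
    also have "\<dots> \<le> of_nat (n choose Suc i) * (A (n - Suc i) k * B (Suc i)) * (1 / m)"
      using m by (intro mult_mono p A XB mult_left_mono mult_nonneg_nonneg A0 B0) auto
    finally show "?w * norm (?T i) \<le> of_nat (n choose Suc i) * (A (n - Suc i) k * B (Suc i)) / m"
      by simp
  qed
  also have "\<dots> = (A n (Suc k) * B 1 + (\<Sum>i<n. of_nat (n choose Suc i) * (A (n - Suc i) k * B (Suc i)))) / m"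
    by (simp add: add_divide_distrib sum_divide_distrib)
  finally show "?w * norm (cutoff_sequence F X m n t - F n t)
     \<le> (A n (Suc k) * B 1 + (\<Sum>i<n. of_nat (n choose Suc i) * (A (n - Suc i) k * B (Suc i)))) / m" .
qed

lemma rapidly_decreasing_cutoff:
  assumes "rapidly_decreasing (F n)"
    and "\<And>k. \<exists>C. \<forall>m\<ge>1. \<forall>t. (1 + \<bar>t\<bar>) ^ k * norm (cutoff_sequence F X m n t - F n t) \<le> C / m"
    and "m \<ge> 1"
  shows "rapidly_decreasing (cutoff_sequence F X m n)"
  unfolding rapidly_decreasing_def
proof
  fix k
  obtain A C where A: "\<And>t. (1 + \<bar>t\<bar>) ^ k * norm (F n t) \<le> A"
    and C: "\<And>t. (1 + \<bar>t\<bar>) ^ k * norm (cutoff_sequence F X m n t - F n t) \<le> C / m"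
    using assms unfolding rapidly_decreasing_def by metis
  have "(1 + \<bar>t\<bar>) ^ k * norm (cutoff_sequence F X m n t) \<le> A + C / m" for t
  proof -
    have "norm (cutoff_sequence F X m n t) \<le> norm (F n t) + norm (cutoff_sequence F X m n t - F n t)"
      using norm_triangle_ineq[of "F n t" "cutoff_sequence F X m n t - F n t"] by simp
    then have "(1 + \<bar>t\<bar>) ^ k * norm (cutoff_sequence F X m n t) \<le>
       (1 + \<bar>t\<bar>) ^ k * (norm (F n t) + norm (cutoff_sequence F X m n t - F n t))"
      by (intro mult_left_mono) auto
    also have "\<dots> \<le> A + C / m"
      using A[of t] C[of t] by (simp add: distrib_left)
    finally show ?thesis .
  qed
  then show "\<exists>C. \<forall>t. (1 + \<bar>t\<bar>) ^ k * norm (cutoff_sequence F X m n t) \<le> C" by blast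
qed

text \<open>
  Telescoping, after scaling all factors into the unit disc.
\<close>

lemma prod_difference_weighted:
  fixes a b :: "'i \<Rightarrow> complex" and w :: "'i \<Rightarrow> real"
  assumes "finite I" "K > 0" and w: "\<And>j. j \<in> I \<Longrightarrow> w j \<ge> 0"
    and a: "\<And>j. j \<in> I \<Longrightarrow> w j * norm (a j) \<le> K"
    and b: "\<And>j. j \<in> I \<Longrightarrow> w j * norm (b j) \<le> K"
    and d: "\<And>j. j \<in> I \<Longrightarrow> w j * norm (a j - b j) \<le> e"
  shows "(\<Prod>j\<in>I. w j) * norm ((\<Prod>j\<in>I. a j) - (\<Prod>j\<in>I. b j)) \<le> K ^ card I * (card I * (e / K))"
proof -
  let ?s = "\<lambda>c j. of_real (w j / K) * c j :: complex"
  have n: "norm (?s c j) = w j * norm (c j) / K" if "j \<in> I" for c j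
    using w[OF that] \<open>K > 0\<close> by (simp add: norm_mult norm_divide)
  have pr: "(\<Prod>j\<in>I. ?s c j) = of_real ((\<Prod>j\<in>I. w j) / K ^ card I) * (\<Prod>j\<in>I. c j)" for c
    by (simp add: prod.distrib prod_dividef)
  have "norm ((\<Prod>j\<in>I. ?s a j) - (\<Prod>j\<in>I. ?s b j)) \<le> (\<Sum>j\<in>I. norm (?s a j - ?s b j))"
    by (rule norm_prod_diff) (use n a b \<open>K > 0\<close> in \<open>auto simp: divide_le_eq\<close>)
  also have "\<dots> \<le> (\<Sum>j\<in>I. e / K)"
  proof (rule sum_mono)
    fix j assume "j \<in> I"
    have "norm (?s a j - ?s b j) = norm (?s (\<lambda>j. a j - b j) j)"
      by (simp only: right_diff_distrib)
    also have "\<dots> \<le> e / K"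
      using n[OF \<open>j \<in> I\<close>, of "\<lambda>j. a j - b j"] d[OF \<open>j \<in> I\<close>] \<open>K > 0\<close>
      by (simp add: divide_right_mono)
    finally show "norm (?s a j - ?s b j) \<le> e / K" .
  qed
  also have "\<dots> = card I * (e / K)" by simp
  finally have "norm ((\<Prod>j\<in>I. ?s a j) - (\<Prod>j\<in>I. ?s b j)) \<le> card I * (e / K)" .
  moreover have "(\<Prod>j\<in>I. ?s a j) - (\<Prod>j\<in>I. ?s b j)
      = of_real ((\<Prod>j\<in>I. w j) / K ^ card I) * ((\<Prod>j\<in>I. a j) - (\<Prod>j\<in>I. b j))"
    by (simp only: pr right_diff_distrib)
  moreover have "(\<Prod>j\<in>I. w j) \<ge> 0" using w by (intro prod_nonneg) auto
  ultimately have "(\<Prod>j\<in>I. w j) / K ^ card I * norm ((\<Prod>j\<in>I. a j) - (\<Prod>j\<in>I. b j)) \<le> card I * (e / K)"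
    using \<open>K > 0\<close> by (simp add: norm_mult norm_divide norm_power abs_of_nonneg flip: of_real_prod)
  then have "(\<Prod>j\<in>I. w j) * norm ((\<Prod>j\<in>I. a j) - (\<Prod>j\<in>I. b j)) / K ^ card I \<le> card I * (e / K)"
    by simp
  then show ?thesis
    using \<open>K > 0\<close> by (simp only: divide_le_eq zero_less_power if_True mult.commute)
qed

lemma iter_partial_deriv_linear:
  assumes "smooth_function f" "smooth_function g"
  shows "iter_partial_deriv js (\<lambda>x. f x + c * g x) = (\<lambda>x. iter_partial_deriv js f x + c * iter_partial_deriv js g x)"
proof (induction js)
  case (Cons j js)
  show ?case
  proof
    fix x
    let ?f = "iter_partial_deriv js f" and ?g = "iter_partial_deriv js g"
    have "(?f has_derivative frechet_derivative ?f (at x)) (at x)"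
      "(?g has_derivative frechet_derivative ?g (at x)) (at x)"
      using assms by (auto simp: smooth_function_def frechet_derivative_works[symmetric])
    then have "((\<lambda>x. ?f x + c * ?g x) has_derivative
        (\<lambda>v. frechet_derivative ?f (at x) v + c * frechet_derivative ?g (at x) v)) (at x)"
      by (intro has_derivative_add has_derivative_mult_right)
    from frechet_derivative_at[OF this]
    show "iter_partial_deriv (j # js) (\<lambda>x. f x + c * g x) x
        = iter_partial_deriv (j # js) f x + c * iter_partial_deriv (j # js) g x"
      by (simp add: Cons partial_deriv_def fun_eq_iff)
  qed
qed simp

lemma schwartz_linear:
  assumes "schwartz f" "schwartz g"
  shows "schwartz (\<lambda>x. f x + c * g x)"
proof -
  have sm: "smooth_function f" "smooth_function g" using assms by (auto simp: schwartz_def)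
  have "smooth_function (\<lambda>x. f x + c * g x)"
    using sm unfolding smooth_function_def iter_partial_deriv_linear[OF sm]
    by (auto intro!: differentiable_add differentiable_mult differentiable_const)
  moreover have "bounded (range (\<lambda>x. (1 + norm x) ^ k *\<^sub>R iter_partial_deriv js (\<lambda>x. f x + c * g x) x))" for k js
  proof -
    have "bounded (range (\<lambda>x. (1 + norm x) ^ k *\<^sub>R iter_partial_deriv js f x))"
      "bounded (range (\<lambda>x. c * ((1 + norm x) ^ k *\<^sub>R iter_partial_deriv js g x)))"
      using assms bounded_linear_image[of "range (\<lambda>x. (1 + norm x) ^ k *\<^sub>R iter_partial_deriv js g x)" "(*) c"]
      by (auto simp: schwartz_def image_image bounded_linear_mult_right)
    from bounded_plus_comp[OF this] show ?thesis
      by (simp add: iter_partial_deriv_linear[OF sm] scaleR_right_distrib)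
  qed
  ultimately show ?thesis by (simp add: schwartz_def)
qed

text \<open>
  The continuity of \<open>T\<close> is a bound by one Schwartz norm, applied to \<open>fm m
  - f\<close>.
\<close>

lemma tempered_distribution_tendsto:
  assumes T: "tempered_distribution T" and f: "schwartz f" and fm: "\<And>m::nat. schwartz (fm m)"
    and bd: "\<And>N. \<exists>K. \<forall>m js x. length js \<le> N \<longrightarrow> (1 + norm x) ^ N *
       norm (iter_partial_deriv js (fm m) x - iter_partial_deriv js f x) \<le> K / Suc m"
  shows "(\<lambda>m. T (fm m)) \<longlonglongrightarrow> T f"
proof -
  obtain C N where CN: "\<And>f. schwartz f \<Longrightarrow> norm (T f) \<le> C * schwartz_norm N f"
    using T unfolding tempered_distribution_def by blast
  obtain K where K: "\<And>m js x. length js \<le> N \<Longrightarrow> (1 + norm x) ^ N *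
       norm (iter_partial_deriv js (fm m) x - iter_partial_deriv js f x) \<le> K / Suc m"
    using bd[of N] by blast
  define d where "d m = (\<lambda>x. fm m x + (- 1) * f x)" for m
  have sd: "schwartz (d m)" for m
    unfolding d_def by (intro schwartz_linear fm f)
  have Td: "T (d m) = T (fm m) - T f" for m
  proof -
    \<comment> \<open>Write \<open>- f\<close> as \<open>f + (- 2) * f\<close>.\<close>
    have "schwartz (\<lambda>x. (- 1) * f x)"
      using schwartz_linear[OF f f, of "- 2"] by (simp add: algebra_simps)
    then have "T (d m) = T (fm m) + T (\<lambda>x. (- 1) * f x)"
      using T fm unfolding tempered_distribution_def d_def by blast
    also have "T (\<lambda>x. (- 1) * f x) = (- 1) * T f"
      using T f unfolding tempered_distribution_def by blast
    finally show ?thesis by simp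
  qed
  have sn: "0 \<le> schwartz_norm N (d m)" "schwartz_norm N (d m) \<le> K / Suc m" for m
  proof -
    have le: "(1 + norm x) ^ N * norm (iter_partial_deriv js (d m) x) \<le> K / Suc m" if "length js \<le> N" for js x
    proof -
      have "iter_partial_deriv js (d m) x = iter_partial_deriv js (fm m) x - iter_partial_deriv js f x"
        using f fm unfolding d_def by (subst iter_partial_deriv_linear) (auto simp: schwartz_def)
      then show ?thesis using K[OF that] by simp
    qed
    show "schwartz_norm N (d m) \<le> K / Suc m"
      unfolding schwartz_norm_def by (rule cSUP_least) (use le in \<open>auto intro!: exI[of _ "[]"]\<close>)
    show "0 \<le> schwartz_norm N (d m)"
      unfolding schwartz_norm_def
      by (rule cSUP_upper2[of _ _ "([], 0)"])
         (use le in \<open>auto intro!: bdd_aboveI2[of _ _ "K / Suc m"] exI[of _ "[]"]\<close>)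
  qed
  have le: "norm (T (d m)) \<le> (\<bar>C\<bar> * K) * (1 / real (Suc m))" for m
  proof -
    have "norm (T (d m)) \<le> C * schwartz_norm N (d m)" by (rule CN[OF sd])
    also have "\<dots> \<le> \<bar>C\<bar> * schwartz_norm N (d m)"
      using sn(1) by (intro mult_right_mono) auto
    also have "\<dots> \<le> \<bar>C\<bar> * (K / Suc m)"
      using sn(2) by (intro mult_left_mono) auto
    finally show ?thesis by simp
  qed
  have "(\<lambda>m. (\<bar>C\<bar> * K) * (1 / real (Suc m))) \<longlonglongrightarrow> (\<bar>C\<bar> * K) * 0"
    using LIMSEQ_inverse_real_of_nat by (intro tendsto_mult tendsto_const) (simp add: inverse_eq_divide)
  then have "(\<lambda>m. (\<bar>C\<bar> * K) * (1 / real (Suc m))) \<longlonglongrightarrow> 0" by simp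
  then have "(\<lambda>m. T (d m)) \<longlonglongrightarrow> 0"
    by (rule Lim_null_comparison[rotated]) (use le in simp)
  then show ?thesis
    unfolding Td by (simp add: LIM_zero_iff)
qed

text \<open>
  Every derivative of a tensor product is a product of derivatives of its factors, so the
  error estimate in one variable gives an error \<open>O(1 / m)\<close> in each Schwartz
  norm.
\<close>

lemma tempered_distribution_cutoff_tendsto:
  fixes F :: "'d::finite \<Rightarrow> nat \<Rightarrow> real \<Rightarrow> complex"
  assumes T: "tempered_distribution T"
    and F: "\<And>j. derivative_sequence (F j)" "\<And>j n. rapidly_decreasing (F j n)"
    and X: "derivative_sequence X" "X 0 0 = 1" "\<And>n. \<exists>B. \<forall>t. norm (X n t) \<le> B"
  shows "(\<lambda>m. T (tensor (\<lambda>j. cutoff_sequence (F j) X (Suc m) 0))) \<longlonglongrightarrow> T (tensor (\<lambda>j. F j 0))"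
proof -
  obtain B where B: "\<And>n t. norm (X n t) \<le> B n"
    using X(3) by metis
  have ex: "\<exists>C. \<forall>m\<ge>1. \<forall>t. (1 + \<bar>t\<bar>) ^ k * norm (cutoff_sequence (F j) X m n t - F j n t) \<le> C / m" for j n k
  proof -
    obtain A where "\<And>n k t. (1 + \<bar>t\<bar>) ^ k * norm (F j n t) \<le> A n k"
      using F(2)[of j] unfolding rapidly_decreasing_def by metis
    from cutoff_sequence_error[OF X(1,2) B this] show ?thesis .
  qed
  let ?Z = "\<lambda>m j. cutoff_sequence (F j) X (real (Suc m))"
  have Zd: "derivative_sequence (?Z m j)" for m j
    by (intro derivative_sequence_cutoff F X)
  have Zr: "rapidly_decreasing (?Z m j n)" for m j n
    by (rule rapidly_decreasing_cutoff[OF F(2) ex]) simp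
  show ?thesis
  proof (rule tempered_distribution_tendsto[OF T])
    show "schwartz (tensor (\<lambda>j. F j 0))" by (intro schwartz_tensor F)
    show "schwartz (tensor (\<lambda>j. ?Z m j 0))" for m by (intro schwartz_tensor Zd Zr)
    fix N
    have "\<forall>j n. \<exists>C. \<forall>t. (1 + \<bar>t\<bar>) ^ N * norm (F j n t) \<le> C"
      using F(2) unfolding rapidly_decreasing_def by blast
    then obtain A where A: "\<And>j n t. (1 + \<bar>t\<bar>) ^ N * norm (F j n t) \<le> A j n"
      by metis
    obtain E where E: "\<And>j n m t. m \<ge> 1 \<Longrightarrow> (1 + \<bar>t\<bar>) ^ N * norm (cutoff_sequence (F j) X m n t - F j n t) \<le> E j n / m"
      using ex by metis
    have A0: "A j n \<ge> 0" for j n using A[of 0 j n] order_trans[OF norm_ge_zero[of "F j n 0"]] by simp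
    have E0: "E j n \<ge> 0" for j n
    proof -
      have "0 \<le> (1 + \<bar>0\<bar>) ^ N * norm (cutoff_sequence (F j) X 1 n 0 - F j n 0)" by simp
      also have "\<dots> \<le> E j n / 1" by (rule E) simp
      finally show ?thesis by simp
    qed
    define K where "K = 1 + (\<Sum>j\<in>UNIV. \<Sum>n\<le>N. A j n + E j n)"
    have KA: "A j n + E j n \<le> K" if "n \<le> N" for j n
    proof -
      have "A j n + E j n \<le> (\<Sum>n\<le>N. A j n + E j n)"
        using that A0 E0 by (intro member_le_sum) auto
      also have "\<dots> \<le> (\<Sum>j\<in>UNIV. \<Sum>n\<le>N. A j n + E j n)"
        by (rule member_le_sum[where f = "\<lambda>j. \<Sum>n\<le>N. A j n + E j n"]) (use A0 E0 in \<open>auto intro!: sum_nonneg\<close>)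
      finally show ?thesis by (simp add: K_def)
    qed
    have K: "K \<ge> 1" unfolding K_def using A0 E0 by (simp add: sum_nonneg)
    show "\<exists>K. \<forall>m js x. length js \<le> N \<longrightarrow> (1 + norm x) ^ N *
       norm (iter_partial_deriv js (tensor (\<lambda>j. ?Z m j 0)) x - iter_partial_deriv js (tensor (\<lambda>j. F j 0)) x)
        \<le> K / Suc m"
    proof (intro exI allI impI)
      fix m :: nat and js :: "'d list" and x :: "real^'d"
      assume js: "length js \<le> N"
      let ?\<nu> = "count_list js"
      have \<nu>: "?\<nu> j \<le> N" for j using js count_le_length[of js j] by linarith
      let ?w = "\<lambda>j. (1 + \<bar>x $ j\<bar>) ^ N"
      have e: "?w j * norm (?Z m j (?\<nu> j) (x $ j) - F j (?\<nu> j) (x $ j)) \<le> K / Suc m" for j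
      proof -
        have "?w j * norm (?Z m j (?\<nu> j) (x $ j) - F j (?\<nu> j) (x $ j)) \<le> E j (?\<nu> j) / Suc m"
          by (rule E) simp
        also have "\<dots> \<le> K / Suc m" using KA[OF \<nu>[of j], of j] A0[of j "?\<nu> j"] by (intro divide_right_mono) auto
        finally show ?thesis .
      qed
      have b: "?w j * norm (F j (?\<nu> j) (x $ j)) \<le> K" for j
        using A[where j = j and n = "?\<nu> j" and t = "x $ j"] KA[OF \<nu>[of j], of j] E0[of j "?\<nu> j"] by linarith
      have a: "?w j * norm (?Z m j (?\<nu> j) (x $ j)) \<le> K + K" for j
      proof -
        have "norm (?Z m j (?\<nu> j) (x $ j)) \<le> norm (F j (?\<nu> j) (x $ j)) + norm (?Z m j (?\<nu> j) (x $ j) - F j (?\<nu> j) (x $ j))"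
          using norm_triangle_ineq[of "F j (?\<nu> j) (x $ j)" "?Z m j (?\<nu> j) (x $ j) - F j (?\<nu> j) (x $ j)"] by simp
        then have "?w j * norm (?Z m j (?\<nu> j) (x $ j)) \<le>
          ?w j * (norm (F j (?\<nu> j) (x $ j)) + norm (?Z m j (?\<nu> j) (x $ j) - F j (?\<nu> j) (x $ j)))"
          by (intro mult_left_mono) auto
        also have "\<dots> \<le> K + K / Suc m" using b[of j] e[of j] by (simp add: distrib_left)
        also have "\<dots> \<le> K + K" using K by (simp add: divide_le_eq mult_le_cancel_left1)
        finally show ?thesis .
      qed
      have "(1 + norm x) ^ N * norm (tensor (\<lambda>j. ?Z m j (?\<nu> j)) x - tensor (\<lambda>j. F j (?\<nu> j)) x)
         \<le> (\<Prod>j\<in>UNIV. ?w j) * norm (tensor (\<lambda>j. ?Z m j (?\<nu> j)) x - tensor (\<lambda>j. F j (?\<nu> j)) x)"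
        by (intro mult_right_mono one_plus_norm_power_le_prod) simp
      also have "\<dots> \<le> (K + K) ^ card (UNIV :: 'd set) * (card (UNIV :: 'd set) * ((K / Suc m) / (K + K)))"
        unfolding tensor_def
        by (rule prod_difference_weighted) (use K a b e in \<open>auto intro: order_trans[OF b]\<close>)
      also have "(K / Suc m) / (K + K) = (K / (K + K)) / Suc m"
        by (simp only: divide_divide_eq_left mult.commute)
      finally show "(1 + norm x) ^ N * norm (iter_partial_deriv js (tensor (\<lambda>j. ?Z m j 0)) x - iter_partial_deriv js (tensor (\<lambda>j. F j 0)) x)
        \<le> (K + K) ^ card (UNIV :: 'd set) * (card (UNIV :: 'd set) * (K / (K + K))) / Suc m"
        unfolding iter_partial_deriv_tensor[of F, OF F(1)] iter_partial_deriv_tensor[of "?Z m", OF Zd]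
        by (simp only: times_divide_eq_right)
    qed
  qed
qed

lemma rapidly_decreasing_translate:
  assumes "rapidly_decreasing f"
  shows "rapidly_decreasing (\<lambda>t. f (t - a))"
  unfolding rapidly_decreasing_def
proof
  fix k
  obtain C where C: "\<And>t. (1 + \<bar>t\<bar>) ^ k * norm (f t) \<le> C"
    using assms unfolding rapidly_decreasing_def by metis
  have "(1 + \<bar>t\<bar>) ^ k * norm (f (t - a)) \<le> (1 + \<bar>a\<bar>) ^ k * C" for t
  proof -
    have "0 \<le> \<bar>a\<bar> * \<bar>t - a\<bar>" by simp
    then have "1 + \<bar>t\<bar> \<le> 1 + \<bar>a\<bar> + \<bar>t - a\<bar> + \<bar>a\<bar> * \<bar>t - a\<bar>" by linarith
    also have "\<dots> = (1 + \<bar>a\<bar>) * (1 + \<bar>t - a\<bar>)" by (simp add: algebra_simps)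
    finally have "(1 + \<bar>t\<bar>) ^ k \<le> ((1 + \<bar>a\<bar>) * (1 + \<bar>t - a\<bar>)) ^ k"
      by (intro power_mono) auto
    then have "(1 + \<bar>t\<bar>) ^ k * norm (f (t - a)) \<le> ((1 + \<bar>a\<bar>) * (1 + \<bar>t - a\<bar>)) ^ k * norm (f (t - a))"
      by (intro mult_right_mono) auto
    also have "\<dots> = (1 + \<bar>a\<bar>) ^ k * ((1 + \<bar>t - a\<bar>) ^ k * norm (f (t - a)))"
      by (simp add: power_mult_distrib)
    also have "\<dots> \<le> (1 + \<bar>a\<bar>) ^ k * C" by (intro mult_left_mono C) auto
    finally show ?thesis .
  qed
  then show "\<exists>C. \<forall>t. (1 + \<bar>t\<bar>) ^ k * norm (f (t - a)) \<le> C" by blast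
qed

lemma fourier1_modulation:
  "fourier1 (\<lambda>t. f t * cis (2 * pi * a * t)) s = fourier1 f (s - a)"
proof -
  have "f t * cis (2 * pi * a * t) * cis (- 2 * pi * (t * s)) = f t * cis (- 2 * pi * (t * (s - a)))" for t
  proof -
    have "cis (2 * pi * a * t) * cis (- 2 * pi * (t * s)) = cis (- 2 * pi * (t * (s - a)))"
      by (simp add: cis_mult algebra_simps)
    then show ?thesis by (simp only: mult.assoc)
  qed
  then show ?thesis by (simp only: fourier1_def)
qed

lemma smooth_supported_modulation:
  assumes "smooth_supported r f"
  shows "smooth_supported r (\<lambda>t. f t * cis (a * t))"
  using smooth_supported_mult[OF assms derivative_sequence_cis[of a]] by simp

lemma smooth_bump_sequence_bounded:
  assumes "derivative_sequence X" "\<forall>n t. \<bar>t\<bar> > r \<longrightarrow> X n t = 0"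
  shows "\<exists>B. \<forall>t. norm (X n t) \<le> B"
proof -
  have "compact (X n ` {-r..r})"
    by (intro compact_continuous_image derivative_sequence_continuous[OF assms(1)]) auto
  then obtain B where B: "\<forall>t\<in>{-r..r}. norm (X n t) \<le> B"
    using compact_imp_bounded[of "X n ` {-r..r}"] by (auto simp: bounded_iff)
  have "norm (X n t) \<le> max B 0" for t
  proof (cases "\<bar>t\<bar> > r")
    case False
    then have "t \<in> {-r..r}" by auto
    with B have "norm (X n t) \<le> B" by blast
    then show ?thesis by simp
  qed (use assms(2) in simp)
  then show ?thesis by blast
qed

text \<open>
  Finite partial sums of \<open>g\<close> are limits of partial sums of \<open>u m\<close>, hence at most \<open>c\<close>, which
  gives summability; conversely each total of \<open>u m\<close> is at most the sum of \<open>g\<close>.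
\<close>

lemma has_sum_by_cutoffs:
  fixes g :: "'a \<Rightarrow> real" and u :: "nat \<Rightarrow> 'a \<Rightarrow> real"
  assumes fin: "\<And>m. finite {x\<in>S. u m x \<noteq> 0}"
    and u: "\<And>m x. x \<in> S \<Longrightarrow> 0 \<le> u m x" "\<And>m x. x \<in> S \<Longrightarrow> u m x \<le> g x"
    and lim: "\<And>x. x \<in> S \<Longrightarrow> (\<lambda>m. u m x) \<longlonglongrightarrow> g x"
    and tot: "(\<lambda>m. \<Sum>x\<in>{x\<in>S. u m x \<noteq> 0}. u m x) \<longlonglongrightarrow> c"
  shows "(g has_sum c) S"
proof -
  have g0: "0 \<le> g x" if "x \<in> S" for x
    using u(1)[OF that, of 0] u(2)[OF that, of 0] by linarith
  have le: "sum g A \<le> c" if A: "finite A" "A \<subseteq> S" for A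
  proof (rule LIMSEQ_le)
    show "(\<lambda>m. \<Sum>x\<in>A. u m x) \<longlonglongrightarrow> sum g A"
      using A by (intro tendsto_sum lim) auto
    show "\<exists>N. \<forall>m\<ge>N. (\<Sum>x\<in>A. u m x) \<le> (\<Sum>x\<in>{x\<in>S. u m x \<noteq> 0}. u m x)"
    proof (intro exI allI impI)
      fix m
      have "(\<Sum>x\<in>A. u m x) = (\<Sum>x\<in>{x\<in>A. u m x \<noteq> 0}. u m x)"
        using A by (intro sum.mono_neutral_right) auto
      also have "\<dots> \<le> (\<Sum>x\<in>{x\<in>S. u m x \<noteq> 0}. u m x)"
        using A fin u(1) by (intro sum_mono2) auto
      finally show "(\<Sum>x\<in>A. u m x) \<le> (\<Sum>x\<in>{x\<in>S. u m x \<noteq> 0}. u m x)" .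
    qed
  qed (rule tot)
  have s: "g summable_on S"
    by (rule nonneg_bdd_above_summable_on) (use g0 le in \<open>auto intro!: bdd_aboveI2\<close>)
  have "c \<le> infsum g S"
  proof (rule LIMSEQ_le_const2[OF tot])
    show "\<exists>N. \<forall>m\<ge>N. (\<Sum>x\<in>{x\<in>S. u m x \<noteq> 0}. u m x) \<le> infsum g S"
    proof (intro exI allI impI)
      fix m
      have "(\<Sum>x\<in>{x\<in>S. u m x \<noteq> 0}. u m x) \<le> (\<Sum>x\<in>{x\<in>S. u m x \<noteq> 0}. g x)"
        by (intro sum_mono) (use u in auto)
      also have "\<dots> \<le> infsum g S"
        by (rule finite_sum_le_infsum[OF s fin]) (use g0 in auto)
      finally show "(\<Sum>x\<in>{x\<in>S. u m x \<noteq> 0}. u m x) \<le> infsum g S" .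
    qed
  qed
  moreover have "infsum g S \<le> c"
    by (rule infsum_le_finite_sums[OF s]) (use le in auto)
  ultimately show ?thesis using has_sum_infsum[OF s] by simp
qed

text \<open>
  The sum is the value of \<open>T\<close> on the Fourier transform of a modulated bump
  function, and by the hypothesis on the transform of \<open>T\<close> this value sees only
  the mass at the frequency \<open>0\<close>, where the modulation is invisible.
\<close>

theorem quasicrystal_constant_convolution:
  fixes \<Lambda> :: "(real^'d) set"
  assumes lf: "locally_finite_set \<Lambda>"
    and fq: "fourier_quasicrystal (\<lambda>x. if x \<in> \<Lambda> then 1 else 0)"
  obtains G :: "real \<Rightarrow> real" and c where
    "continuous_on UNIV G" "\<forall>t. G t \<ge> 0" "G 0 > 0" "\<forall>k. \<exists>C. \<forall>t. (1 + \<bar>t\<bar>) ^ k * G t \<le> C"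
    "\<forall>x. ((\<lambda>p. tensor (\<lambda>_. G) (p - x)) has_sum c) \<Lambda>"
proof -
  let ?a = "\<lambda>x. if x \<in> \<Lambda> then 1 else 0 :: complex"
  obtain T b where T: "tempered_distribution T" and Ta: "is_measure T ?a"
    and b: "discrete_measure b" and Tb: "is_measure (distr_fourier T) b"
    using fq unfolding fourier_quasicrystal_def by blast
  have "finite ({y. b y \<noteq> 0} \<inter> ball 0 1)"
    using b by (simp add: discrete_measure_def locally_finite_set_def)
  then obtain e where e: "e > 0" "\<And>y. b y \<noteq> 0 \<Longrightarrow> norm y < 1 \<Longrightarrow> y \<noteq> 0 \<Longrightarrow> e \<le> norm y"
    using finite_set_avoid[of "{y. b y \<noteq> 0} \<inter> ball 0 1" 0] by auto
  define n where "n = real CARD('d)"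
  have n: "n \<ge> 1" by (simp add: n_def Suc_le_eq)
  \<comment> \<open>The cube of half side \<open>2 * r\<close> lies in the ball of radius \<open>min e 1\<close> and so contains no frequency besides \<open>0\<close>.\<close>
  define r where "r = min e 1 / (4 * n)"
  have r: "r > 0" using e n by (simp add: r_def)
  have small: "y = 0" if "b y \<noteq> 0" "\<And>j. \<bar>y $ j\<bar> \<le> 2 * r" for y
  proof (rule ccontr)
    assume "y \<noteq> 0"
    have "norm y \<le> (\<Sum>j\<in>UNIV. \<bar>y $ j\<bar>)" by (rule norm_le_l1_cart)
    also have "\<dots> \<le> (\<Sum>j\<in>(UNIV::'d set). 2 * r)" by (intro sum_mono that)
    also have "\<dots> = min e 1 / 2" using n by (simp add: r_def n_def)
    finally have "norm y \<le> min e 1 / 2" .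
    then show False using e(2)[OF that(1) _ \<open>y \<noteq> 0\<close>] e(1) by (auto simp: min_def split: if_splits)
  qed
  obtain \<beta> :: "real \<Rightarrow> real" where \<beta>: "smooth_supported r (\<lambda>t. of_real (\<beta> t))" "\<forall>t. 0 \<le> \<beta> t \<and> \<beta> t \<le> 1" "\<beta> 0 = 1"
    by (rule smooth_bump_exists[OF r])
  have \<beta>0: "\<beta> t \<ge> 0" for t using \<beta>(2) by simp
  obtain \<phi> where \<phi>: "smooth_supported (2 * r) \<phi>"
    "\<forall>x. fourier1 \<phi> x = of_real ((norm (fourier1 (\<lambda>t. of_real (\<beta> t)) x))\<^sup>2)"
    by (rule fourier1_autocorrelation[OF \<beta>(1) r])
  define G where "G x = (norm (fourier1 (\<lambda>t. of_real (\<beta> t)) x))\<^sup>2" for x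
  obtain P where P: "derivative_sequence P" "P 0 = fourier1 \<phi>" "\<forall>n. rapidly_decreasing (P n)"
    by (rule fourier1_smooth_rapidly_decreasing[OF \<phi>(1)])
  have PG: "P 0 t = of_real (G t)" for t
    by (simp add: P(2) \<phi>(2) G_def)
  have G0: "G t \<ge> 0" for t by (simp add: G_def)
  obtain \<eta> :: "real \<Rightarrow> real" where \<eta>': "smooth_supported 1 (\<lambda>t. of_real (\<eta> t))" "\<forall>t. 0 \<le> \<eta> t \<and> \<eta> t \<le> 1" "\<eta> 0 = 1"
    by (rule smooth_bump_exists[OF zero_less_one])
  have \<eta>: "smooth_supported 1 (\<lambda>t. of_real (\<eta> t))" "\<eta> t \<ge> 0" "\<eta> t \<le> 1" "\<eta> 0 = 1" for t
    using \<eta>' by auto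
  obtain X where X: "derivative_sequence X" "X 0 = (\<lambda>t. of_real (\<eta> t))" "\<forall>n t. \<bar>t\<bar> > 1 \<longrightarrow> X n t = 0"
    by (rule smooth_supportedE[OF \<eta>(1)])
  \<comment> \<open>The total mass of a modulated test function against the transform of \<open>\<mu>\<close>; it is a limit of real sums, hence real.\<close>
  define c where "c = Re (b 0 * \<phi> 0 ^ CARD('d))"
  have sum: "((\<lambda>p. tensor (\<lambda>_. G) (p - x)) has_sum c) \<Lambda>" for x
  proof -
    \<comment> \<open>Modulating the tensor product of the \<open>\<phi>\<close> translates its transform by \<open>x\<close>.\<close>
    define f where "f j t = \<phi> t * cis (2 * pi * (x $ j) * t)" for j t
    have f: "smooth_supported (2 * r) (f j)" for j
      unfolding f_def by (rule smooth_supported_modulation[OF \<phi>(1)])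
    have "test_function (tensor f)" by (rule test_function_tensor[OF f])
    then have "T (fourier (tensor f)) = measure_pairing b (tensor f)"
      using Tb by (simp add: is_measure_def distr_fourier_def)
    also have "\<dots> = (\<Sum>y\<in>{0}. b y * tensor f y)"
      unfolding measure_pairing_def
    proof (rule sum.mono_neutral_left)
      show "{y. b y \<noteq> 0 \<and> tensor f y \<noteq> 0} \<subseteq> {0}"
      proof
        fix y assume y: "y \<in> {y. b y \<noteq> 0 \<and> tensor f y \<noteq> 0}"
        then have "f j (y $ j) \<noteq> 0" for j by (auto simp: tensor_def)
        then have "\<bar>y $ j\<bar> \<le> 2 * r" for j using f by (meson not_less smooth_supported_def)
        then show "y \<in> {0}" using small y by auto
      qed
    qed auto
    also have "\<dots> = b 0 * \<phi> 0 ^ CARD('d)" by (simp add: tensor_def f_def)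
    finally have Tf: "T (fourier (tensor f)) = b 0 * \<phi> 0 ^ CARD('d)" .
    define F where "F j n t = P n (t - x $ j)" for j n t
    have F: "derivative_sequence (F j)" "rapidly_decreasing (F j n)" for j n
      using derivative_sequence_affine[OF P(1), of 1 "- x $ j"] rapidly_decreasing_translate[OF P(3)[rule_format]]
      by (simp_all add: F_def[abs_def])
    have "fourier (tensor f) = tensor (\<lambda>j. fourier1 (f j))"
    proof (rule fourier_tensor)
      show "integrable lborel (f j)" for j
        by (rule supported_integral(1)[OF smooth_supported_continuous[OF f]])
           (use f in \<open>auto simp: smooth_supported_def\<close>)
    qed
    also have "\<dots> = tensor (\<lambda>j. F j 0)"
      by (intro arg_cong[of _ _ tensor] ext)
         (simp add: f_def[abs_def] F_def[abs_def] fourier1_modulation P(2))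
    finally have FT: "fourier (tensor f) = tensor (\<lambda>j. F j 0)" .
    define u where "u m p = tensor (\<lambda>_. G) (p - x) * tensor (\<lambda>_ t. \<eta> (t / Suc m)) p" for m :: nat and p :: "real^'d"
    let ?Z = "\<lambda>m j. cutoff_sequence (F j) X (Suc m) 0"
    have Zu: "tensor (?Z m) p = of_real (u m p)" for m p
      by (simp add: tensor_def u_def cutoff_sequence_0 F_def PG X(2) prod.distrib)
    have Zs: "smooth_supported (Suc m) (?Z m j)" for m j
      unfolding smooth_supported_def
    proof (intro conjI exI[of _ "cutoff_sequence (F j) X (Suc m)"] derivative_sequence_cutoff F X refl allI impI)
      fix t :: real assume "\<bar>t\<bar> > Suc m"
      then have "\<bar>t / Suc m\<bar> > 1" by (simp add: abs_divide less_divide_eq)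
      then show "?Z m j t = 0" using X(3) by (simp only: cutoff_sequence_0) simp
    qed
    have Zt: "test_function (tensor (?Z m))" for m
      by (rule test_function_tensor[OF Zs])
    have fin: "finite {p\<in>\<Lambda>. u m p \<noteq> 0}" for m
    proof -
      have "compact (closure {y. tensor (?Z m) y \<noteq> 0})"
        using Zt[of m] unfolding test_function_def by (rule conjunct2)
      then have "bounded {y. tensor (?Z m) y \<noteq> 0}"
        by (rule bounded_subset[OF compact_imp_bounded closure_subset])
      then obtain R where R: "{y. tensor (?Z m) y \<noteq> 0} \<subseteq> ball 0 R"
        by (rule bounded_subset_ballD[of _ 0, THEN exE]) (erule conjE, rule that)
      have "{p\<in>\<Lambda>. u m p \<noteq> 0} \<subseteq> \<Lambda> \<inter> ball 0 R"
      proof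
        fix p assume p: "p \<in> {p\<in>\<Lambda>. u m p \<noteq> 0}"
        then have "tensor (?Z m) p \<noteq> 0" by (simp only: Zu of_real_eq_0_iff mem_Collect_eq not_False_eq_True)
        with R p show "p \<in> \<Lambda> \<inter> ball 0 R" by blast
      qed
      then show ?thesis
        by (rule finite_subset) (use lf in \<open>simp add: locally_finite_set_def\<close>)
    qed
    have TZ: "T (tensor (?Z m)) = of_real (\<Sum>p\<in>{p\<in>\<Lambda>. u m p \<noteq> 0}. u m p)" for m
    proof -
      have "T (tensor (?Z m)) = measure_pairing ?a (tensor (?Z m))"
        using Ta Zt by (simp add: is_measure_def)
      also have "\<dots> = (\<Sum>p\<in>{p\<in>\<Lambda>. u m p \<noteq> 0}. of_real (u m p))"
        unfolding measure_pairing_def Zu by (rule sum.cong) auto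
      finally show ?thesis by simp
    qed
    have "(\<lambda>m. T (tensor (?Z m))) \<longlonglongrightarrow> T (tensor (\<lambda>j. F j 0))"
      by (rule tempered_distribution_cutoff_tendsto[OF T F X(1)])
         (use X(2) \<eta>(4) smooth_bump_sequence_bounded[OF X(1,3)] in auto)
    then have "(\<lambda>m. T (tensor (?Z m))) \<longlonglongrightarrow> b 0 * \<phi> 0 ^ CARD('d)"
      by (simp only: FT[symmetric] Tf)
    from tendsto_Re[OF this]
    have tot: "(\<lambda>m. \<Sum>p\<in>{p\<in>\<Lambda>. u m p \<noteq> 0}. u m p) \<longlonglongrightarrow> c"
      by (simp only: TZ c_def Re_complex_of_real)
    show ?thesis
    proof (rule has_sum_by_cutoffs[OF fin _ _ _ tot])
      fix p :: "real^'d" and m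
      have g: "tensor (\<lambda>_. G) (p - x) \<ge> 0" by (auto simp: tensor_def intro!: prod_nonneg G0)
      show "0 \<le> u m p"
        using g by (auto simp: u_def tensor_def intro!: mult_nonneg_nonneg prod_nonneg \<eta>)
      have "tensor (\<lambda>_ t. \<eta> (t / Suc m)) p \<le> 1"
        unfolding tensor_def by (intro prod_le_1) (use \<eta> in auto)
      then show "u m p \<le> tensor (\<lambda>_. G) (p - x)"
        using g unfolding u_def by (simp add: mult_left_le)
      have "isCont \<eta> 0"
        using continuous_on_Re[OF smooth_supported_continuous[OF \<eta>(1), of UNIV]]
        by (simp add: continuous_on_eq_continuous_at)
      moreover have "(\<lambda>m. p $ j / real (Suc m)) \<longlonglongrightarrow> 0" for j
        using tendsto_mult[OF tendsto_const[of "p $ j"] LIMSEQ_inverse_real_of_nat]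
        by (simp add: divide_inverse)
      ultimately have "(\<lambda>m. \<eta> (p $ j / real (Suc m))) \<longlonglongrightarrow> 1" for j
        using \<eta>(4) isCont_tendsto_compose[of 0 \<eta>] by metis
      then have "(\<lambda>m. u m p) \<longlonglongrightarrow> tensor (\<lambda>_. G) (p - x) * (\<Prod>j\<in>(UNIV::'d set). 1)"
        unfolding u_def tensor_def by (intro tendsto_mult tendsto_const tendsto_prod)
      then show "(\<lambda>m. u m p) \<longlonglongrightarrow> tensor (\<lambda>_. G) (p - x)" by simp
    qed
  qed
  show ?thesis
  proof (rule that)
    show "continuous_on UNIV G"
      unfolding G_def
    proof (intro continuous_intros)
      show "continuous_on UNIV (fourier1 (\<lambda>t. complex_of_real (\<beta> t)))"
        by (rule fourier1_smooth_rapidly_decreasing[OF \<beta>(1)])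
           (metis derivative_sequence_continuous)
    qed
    show "G 0 > 0"
      using fourier1_at_0_nonzero[OF \<beta>(1) \<beta>0 \<beta>(3) r] by (simp add: G_def)
    show "\<forall>k. \<exists>C. \<forall>t. (1 + \<bar>t\<bar>) ^ k * G t \<le> C"
      using P(3)[rule_format, of 0] G0 by (simp add: rapidly_decreasing_def PG)
  qed (use G0 sum in auto)
qed

section \<open>Discrepancy of point counts\<close>

lemma power_difference_le:
  fixes a b :: real
  assumes "0 \<le> a" "a \<le> b"
  shows "b ^ n - a ^ n \<le> real n * (b - a) * b ^ (n - 1)"
proof -
  have "b ^ n - a ^ n = (b - a) * (\<Sum>i<n. a ^ (n - Suc i) * b ^ i)"
    by (rule power_diff_sumr2)
  also have "\<dots> \<le> (b - a) * (\<Sum>i<n. b ^ (n - 1))"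
  proof (intro mult_left_mono sum_mono)
    fix i assume "i \<in> {..<n}"
    then have "n - 1 = (n - Suc i) + i" by auto
    then have "b ^ (n - 1) = b ^ (n - Suc i) * b ^ i" by (simp only: power_add)
    then show "a ^ (n - Suc i) * b ^ i \<le> b ^ (n - 1)"
      using assms by (auto intro!: mult_right_mono power_mono)
  qed (use assms in simp)
  finally show ?thesis by (simp add: mult_ac)
qed

lemma lborel_reflect: "distr lborel borel (\<lambda>y. p - y) = (lborel :: 'a::euclidean_space measure)"
  by (subst (2) lborel_affine[of "-1" p]) (auto simp: density_1)

lemma lborel_integral_reflect:
  fixes f :: "'a::euclidean_space \<Rightarrow> real"
  assumes [measurable]: "f \<in> borel_measurable borel"
  shows "integrable lborel (\<lambda>y. f (p - y)) \<longleftrightarrow> integrable lborel f"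
    and "(\<integral>y. f (p - y) \<partial>lborel) = integral\<^sup>L lborel f"
  using integrable_distr_eq[of "\<lambda>y. p - y" lborel borel f] integral_distr[of "\<lambda>y. p - y" lborel borel f]
  by (simp_all add: lborel_reflect)

text \<open>
  What the Fourier transform provides for counting: a nonnegative kernel \<open>g\<close>
  whose sum over \<open>\<Lambda> - x\<close> does not depend on \<open>x\<close>, with a
  finite first moment and a positive lower bound \<open>\<kappa>\<close> on the ball of
  radius \<open>\<rho>\<close>.
\<close>

locale constant_convolution =
  fixes \<Lambda> :: "(real^'d) set" and g :: "real^'d \<Rightarrow> real" and c \<kappa> \<rho> :: real
  assumes locally_finite: "locally_finite_set \<Lambda>"
    and nonempty: "\<Lambda> \<noteq> {}"
    and measurable_g [measurable]: "g \<in> borel_measurable borel"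
    and g_nonneg: "g x \<ge> 0"
    and first_moment: "integrable lborel (\<lambda>x. (1 + norm x) * g x)"
    and \<rho>: "0 < \<rho>" "\<rho> \<le> 1" and \<kappa>: "0 < \<kappa>"
    and g_near_0: "norm x < \<rho> \<Longrightarrow> \<kappa> \<le> g x"
    and convolution_constant: "((\<lambda>p. g (p - x)) has_sum c) \<Lambda>"
begin

definition mass :: real where "mass = integral\<^sup>L lborel g"

definition point_density :: real where "point_density = c / mass"

lemma integrable_g: "integrable lborel g"
proof (rule Bochner_Integration.integrable_bound[OF first_moment])
  show "AE x in lborel. norm (g x) \<le> norm ((1 + norm x) * g x)"
  proof (rule AE_I2)
    show "norm (g x) \<le> norm ((1 + norm x) * g x)" for x
      using mult_right_mono[of 1 "1 + norm x" "g x"] g_nonneg[of x] by (simp add: abs_mult)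
  qed
qed simp

lemma finite_sum_le: "finite A \<Longrightarrow> A \<subseteq> \<Lambda> \<Longrightarrow> (\<Sum>p\<in>A. g (p - x)) \<le> c"
  using convolution_constant g_nonneg
  by (metis has_sum_imp_summable finite_sum_le_infsum infsumI)

lemma c_pos: "c > 0"
proof -
  obtain p where "p \<in> \<Lambda>" using nonempty by blast
  then have "g 0 \<le> c" using finite_sum_le[of "{p}" p] by simp
  then show ?thesis using g_near_0[of 0] \<rho> \<kappa> by simp
qed

lemma unit_volume_pos: "measure lborel (ball (0::real^'d) \<rho>) > 0"
  using \<rho> content_ball_pos by blast

lemma ball_integral_ge:
  "\<kappa> * measure lborel (ball (0::real^'d) \<rho>) \<le> (\<integral>x. indicator (ball 0 \<rho>) x * g x \<partial>lborel)"
proof -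
  have "\<kappa> * measure lborel (ball (0::real^'d) \<rho>) = (\<integral>x. indicator (ball (0::real^'d) \<rho>) x * \<kappa> \<partial>lborel)"
    by simp
  also have "\<dots> \<le> (\<integral>x. indicator (ball 0 \<rho>) x * g x \<partial>lborel)"
  proof (rule integral_mono)
    show "integrable lborel (\<lambda>x. indicator (ball (0::real^'d) \<rho>) x * \<kappa>)"
      by (intro integrable_mult_left integrable_real_indicator emeasure_bounded_finite bounded_ball) simp
    show "integrable lborel (\<lambda>x. indicator (ball 0 \<rho>) x * g x)"
      using integrable_mult_indicator[OF _ integrable_g, of "ball 0 \<rho>"] by simp
  qed (use g_near_0 in \<open>auto simp: indicator_def\<close>)
  finally show ?thesis .
qed

lemma mass_pos: "mass > 0"
proof -
  have "0 < \<kappa> * measure lborel (ball (0::real^'d) \<rho>)" using unit_volume_pos \<kappa> by simp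
  also have "\<dots> \<le> (\<integral>x. indicator (ball 0 \<rho>) x * g x \<partial>lborel)" by (rule ball_integral_ge)
  also have "\<dots> \<le> mass"
    unfolding mass_def
  proof (rule integral_mono)
    show "integrable lborel (\<lambda>x. indicator (ball 0 \<rho>) x * g x)"
      using integrable_mult_indicator[OF _ integrable_g, of "ball 0 \<rho>"] by simp
  qed (use g_nonneg integrable_g in \<open>auto simp: indicator_def\<close>)
  finally show ?thesis .
qed

lemma point_density_pos: "point_density > 0"
  using c_pos mass_pos by (simp add: point_density_def)

text \<open>
  The number of points in a set is at most this constant times the volume of a neighbourhood
  of it.
\<close>

definition packing :: real where
  "packing = c / (\<kappa> * measure lborel (ball (0::real^'d) \<rho>))"

lemma packing_nonneg: "packing \<ge> 0"
  using c_pos \<kappa> by (simp add: packing_def)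

text \<open>
  Integrate \<open>(\<Sum>p. g (p - u - y)) \<le> c\<close> over \<open>y \<in> S'\<close>:
  each point \<open>p\<close> with \<open>p - u \<in> S\<close> contributes at least the
  integral of \<open>g\<close> over the ball of radius \<open>\<rho>\<close>.
\<close>

lemma card_translate_le:
  assumes S': "S' \<in> sets borel" "bounded S'" and S: "\<And>x. x \<in> S \<Longrightarrow> ball x 1 \<subseteq> S'"
  shows "finite {p\<in>\<Lambda>. p - u \<in> S} \<and> real (card {p\<in>\<Lambda>. p - u \<in> S}) \<le> packing * measure lborel S'"
proof -
  have S'f: "emeasure lborel S' < \<infinity>" using S'(2) by (rule emeasure_bounded_finite)
  let ?v = "measure lborel (ball (0::real^'d) \<rho>)"
  have bound: "real (card A) \<le> packing * measure lborel S'" if A: "A \<subseteq> {p\<in>\<Lambda>. p - u \<in> S}" "finite A" for A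
  proof -
    have int: "integrable lborel (\<lambda>y. indicator S' y * g (p - u - y))" for p
      using integrable_mult_indicator[of S' lborel "\<lambda>y. g (p - u - y)"] S'(1) integrable_g
      by (simp add: lborel_integral_reflect)
    have "\<kappa> * ?v \<le> (\<integral>y. indicator S' y * g (p - u - y) \<partial>lborel)" if "p \<in> A" for p
    proof -
      have "(\<integral>x. indicator (ball 0 \<rho>) x * g x \<partial>lborel) = (\<integral>y. indicator (ball 0 \<rho>) (p - u - y) * g (p - u - y) \<partial>lborel)"
        by (rule lborel_integral_reflect(2)[where f = "\<lambda>x. indicator (ball 0 \<rho>) x * g x", symmetric])
           (intro borel_measurable_times borel_measurable_indicator measurable_g, simp)
      also have "\<dots> \<le> (\<integral>y. indicator S' y * g (p - u - y) \<partial>lborel)"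
      proof (rule integral_mono[OF _ int])
        have "integrable lborel (\<lambda>x. indicator (ball 0 \<rho>) x * g x)"
          using integrable_mult_indicator[OF _ integrable_g, of "ball 0 \<rho>"] by simp
        then show "integrable lborel (\<lambda>y. indicator (ball 0 \<rho>) (p - u - y) * g (p - u - y))"
          by (subst lborel_integral_reflect(1)[where f = "\<lambda>x. indicator (ball 0 \<rho>) x * g x"]) auto
        fix y
        have "y \<in> S'" if "p - u - y \<in> ball 0 \<rho>"
        proof -
          have "y \<in> ball (p - u) 1" using that \<rho> by (auto simp: dist_norm norm_minus_commute)
          then show ?thesis using S \<open>p \<in> A\<close> A by blast
        qed
        then show "indicator (ball 0 \<rho>) (p - u - y) * g (p - u - y) \<le> indicator S' y * g (p - u - y)"
          using g_nonneg by (auto simp: indicator_def)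
      qed
      finally show ?thesis using ball_integral_ge by linarith
    qed
    then have "(\<Sum>p\<in>A. \<kappa> * ?v) \<le> (\<Sum>p\<in>A. \<integral>y. indicator S' y * g (p - u - y) \<partial>lborel)"
      by (rule sum_mono)
    also have "\<dots> = (\<integral>y. (\<Sum>p\<in>A. indicator S' y * g (p - u - y)) \<partial>lborel)"
      using int by (simp add: Bochner_Integration.integral_sum)
    also have "\<dots> \<le> (\<integral>y. indicator S' y * c \<partial>lborel)"
    proof (rule integral_mono)
      show "integrable lborel (\<lambda>y. \<Sum>p\<in>A. indicator S' y * g (p - u - y))" using int by simp
      show "integrable lborel (\<lambda>y. indicator S' y * c)"
        using S'f S'(1) by (intro integrable_mult_left integrable_real_indicator) auto
      fix y
      have "(\<Sum>p\<in>A. g (p - (u + y))) \<le> c" using A by (intro finite_sum_le) auto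
      then show "(\<Sum>p\<in>A. indicator S' y * g (p - u - y)) \<le> indicator S' y * c"
        by (auto simp: indicator_def diff_diff_eq)
    qed
    also have "\<dots> = c * measure lborel S'" using S'(1) by simp
    finally have "real (card A) * (\<kappa> * ?v) \<le> c * measure lborel S'" by simp
    then show ?thesis
      using unit_volume_pos \<kappa> by (simp add: packing_def field_simps)
  qed
  have "finite {p\<in>\<Lambda>. p - u \<in> S} \<and> card {p\<in>\<Lambda>. p - u \<in> S} \<le> nat \<lfloor>packing * measure lborel S'\<rfloor>"
    by (rule finite_if_finite_subsets_card_bdd) (use bound in \<open>simp add: le_nat_floor\<close>)
  then show ?thesis using bound[OF order_refl] by blast
qed

definition translate_count :: "(real^'d) set \<Rightarrow> real^'d \<Rightarrow> nat" where
  "translate_count H t = card {p\<in>\<Lambda>. p - t \<in> H}"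

lemma finite_translate:
  assumes "bounded H" shows "finite {p\<in>\<Lambda>. p - t \<in> H}"
proof -
  obtain R where R: "\<And>x. x \<in> H \<Longrightarrow> norm x < R" 
    using assms bounded_subset_ballD[of H 0] by (metis in_mono mem_ball_0)
  have "{p\<in>\<Lambda>. p - t \<in> H} \<subseteq> \<Lambda> \<inter> ball t R"
    using R by (force simp: dist_norm norm_minus_commute)
  then show ?thesis
    using locally_finite finite_subset unfolding locally_finite_set_def by blast
qed

text \<open>
  A point counted for only one of the two translates lies, after subtracting
  \<open>u\<close>, within distance \<open>1\<close> of the boundary of \<open>H\<close>,
  and the number of such points is bounded by the volume of \<open>S'\<close>.
\<close>

lemma translate_count_step:
  assumes H: "bounded H" and S': "S' \<in> sets borel" "bounded S'"
    and bd: "\<And>x y. dist x y \<le> 1 \<Longrightarrow> x \<in> H \<Longrightarrow> y \<notin> H \<Longrightarrow> ball x 1 \<union> ball y 1 \<subseteq> S'"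
    and s: "norm s \<le> 1"
  shows "\<bar>real (translate_count H u) - real (translate_count H (u + s))\<bar> \<le> packing * measure lborel S'"
proof -
  let ?A = "{p\<in>\<Lambda>. p - u \<in> H}" and ?B = "{p\<in>\<Lambda>. p - (u + s) \<in> H}"
  define S where "S = {x. \<exists>y. dist x y \<le> 1 \<and> (x \<in> H \<longleftrightarrow> y \<notin> H)}"
  have "ball x 1 \<subseteq> S'" if xS: "x \<in> S" for x
  proof -
    obtain y where y: "dist x y \<le> 1" "x \<in> H \<longleftrightarrow> y \<notin> H" using xS unfolding S_def by auto
    show ?thesis
    proof (cases "x \<in> H")
      case True
      then show ?thesis using bd[of x y] y by simp
    next
      case False
      then show ?thesis using bd[of y x] y by (simp add: dist_commute)
    qed
  qed
  from card_translate_le[OF S' this, of S u]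
  have S: "finite {p\<in>\<Lambda>. p - u \<in> S}" "real (card {p\<in>\<Lambda>. p - u \<in> S}) \<le> packing * measure lborel S'"
    by auto
  note fin = finite_translate[OF H]
  have sub: "(?A - ?B) \<union> (?B - ?A) \<subseteq> {p\<in>\<Lambda>. p - u \<in> S}"
  proof
    fix p assume p: "p \<in> (?A - ?B) \<union> (?B - ?A)"
    have "dist (p - u) (p - (u + s)) \<le> 1" using s by (simp add: dist_norm)
    with p show "p \<in> {p\<in>\<Lambda>. p - u \<in> S}" unfolding S_def by blast
  qed
  have *: "card X \<le> card Y + card {p\<in>\<Lambda>. p - u \<in> S}" if "finite X" "finite Y" "X - Y \<subseteq> {p\<in>\<Lambda>. p - u \<in> S}" for X Y
  proof -
    have "card X \<le> card (Y \<union> {p\<in>\<Lambda>. p - u \<in> S})"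
      using that S(1) by (intro card_mono) auto
    also have "\<dots> \<le> card Y + card {p\<in>\<Lambda>. p - u \<in> S}" by (rule card_Un_le)
    finally show ?thesis .
  qed
  have "card ?A \<le> card ?B + card {p\<in>\<Lambda>. p - u \<in> S}"
    by (rule *[OF fin fin]) (use sub in blast)
  moreover have "card ?B \<le> card ?A + card {p\<in>\<Lambda>. p - u \<in> S}"
    by (rule *[OF fin fin]) (use sub in blast)
  ultimately show ?thesis using S(2) unfolding translate_count_def by linarith
qed

text \<open>
  Divide \<open>t\<close> into \<open>nat \<lceil>norm t\<rceil>\<close> equal steps.
\<close>

lemma translate_count_difference:
  assumes H: "bounded H" and S': "S' \<in> sets borel" "bounded S'"
    and bd: "\<And>x y. dist x y \<le> 1 \<Longrightarrow> x \<in> H \<Longrightarrow> y \<notin> H \<Longrightarrow> ball x 1 \<union> ball y 1 \<subseteq> S'"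
  shows "\<bar>real (translate_count H 0) - real (translate_count H t)\<bar> \<le> (1 + norm t) * (packing * measure lborel S')"
proof -
  let ?M = "packing * measure lborel S'"
  define n where "n = nat \<lceil>norm t\<rceil>"
  have n: "norm t \<le> n" "n \<le> 1 + norm t" unfolding n_def using norm_ge_zero[of t] by linarith+
  define s where "s = (1 / n) *\<^sub>R t"
  have s: "norm s \<le> 1" using n by (cases "n = 0") (auto simp: s_def divide_le_eq)
  have nt: "real n *\<^sub>R s = t" using n by (cases "n = 0") (auto simp: s_def)
  have "\<bar>real (translate_count H 0) - real (translate_count H (real k *\<^sub>R s))\<bar> \<le> k * ?M" for k
  proof (induction k)
    case (Suc k)
    have "\<bar>real (translate_count H (real k *\<^sub>R s)) - real (translate_count H (real k *\<^sub>R s + s))\<bar> \<le> ?M"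
      by (rule translate_count_step[OF H S' bd s])
    moreover have "real k *\<^sub>R s + s = real (Suc k) *\<^sub>R s" by (simp add: scaleR_left_distrib)
    ultimately show ?case using Suc by (simp add: distrib_right)
  qed simp
  from this[of n] have "\<bar>real (translate_count H 0) - real (translate_count H t)\<bar> \<le> n * ?M"
    by (simp add: nt)
  also have "\<dots> \<le> (1 + norm t) * ?M"
    using n packing_nonneg by (intro mult_right_mono) auto
  finally show ?thesis .
qed

text \<open>
  Both sides are the double integral of \<open>g t\<close> against the indicator of \<open>p
  - t \<in> H\<close>, summed over \<open>p \<in> \<Lambda>\<close>: for fixed
  \<open>p\<close> substitute \<open>y = p - t\<close>, then sum over \<open>p\<close>
  first.  The sums are exhausted by the finite sets \<open>\<Lambda> \<inter> ball 0
  n\<close>, and dominated convergence applies on both sides.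
\<close>

lemma mean_translate_count:
  assumes H: "bounded H" "H \<in> sets borel"
    and w: "\<And>t. real (translate_count H t) \<le> M * (1 + norm t)"
  shows "integrable lborel (\<lambda>t. real (translate_count H t) * g t)"
    and "(\<integral>t. real (translate_count H t) * g t \<partial>lborel) = c * measure lborel H"
proof -
  note [measurable] = H(2)
  define L where "L n = \<Lambda> \<inter> ball 0 (real n)" for n
  have L: "finite (L n)" "L n \<subseteq> \<Lambda>" for n
    using locally_finite by (auto simp: L_def locally_finite_set_def)
  have Hf: "emeasure lborel H < \<infinity>" using H(1) by (rule emeasure_bounded_finite)
  have iH: "integrable lborel (\<lambda>y. indicator H y * k)" for k :: real
    using Hf H(2) by (intro integrable_mult_left integrable_real_indicator) auto
  define q where "q n t = (\<Sum>p\<in>L n. indicator H (p - t)) * g t" for n t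
  have q_int: "integral\<^sup>L lborel (q n) = (\<integral>y. indicator H y * (\<Sum>p\<in>L n. g (p - y)) \<partial>lborel)" for n
  proof -
    have i: "integrable lborel (\<lambda>y. indicator H y * g (p - y))" for p
      using integrable_mult_indicator[of H lborel "\<lambda>y. g (p - y)"] H(2) integrable_g
      by (simp add: lborel_integral_reflect)
    have i': "integrable lborel (\<lambda>t. indicator H (p - t) * g t)" for p
      using lborel_integral_reflect(1)[of "\<lambda>y. indicator H y * g (p - y)" p] i by simp
    have "integral\<^sup>L lborel (q n) = (\<Sum>p\<in>L n. \<integral>t. indicator H (p - t) * g t \<partial>lborel)"
      unfolding q_def sum_distrib_right using i' by (simp add: Bochner_Integration.integral_sum)
    also have "\<dots> = (\<Sum>p\<in>L n. \<integral>y. indicator H y * g (p - y) \<partial>lborel)"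
      using lborel_integral_reflect(2)[of "\<lambda>y. indicator H y * g (p - y)" p for p] by simp
    also have "\<dots> = (\<integral>y. indicator H y * (\<Sum>p\<in>L n. g (p - y)) \<partial>lborel)"
      unfolding sum_distrib_left using i by (simp add: Bochner_Integration.integral_sum)
    finally show ?thesis .
  qed
  have q_card: "q n t = real (card {p\<in>L n. p - t \<in> H}) * g t" for n t
  proof -
    have "(\<Sum>p\<in>L n. indicator H (p - t)) = (\<Sum>p\<in>{p\<in>L n. p - t \<in> H}. 1 :: real)"
      by (rule sum.mono_neutral_cong_right) (use L(1) in auto)
    then show ?thesis by (simp add: q_def)
  qed
  have lim: "(\<lambda>n. q n t) \<longlonglongrightarrow> real (translate_count H t) * g t" for t
  proof (rule tendsto_eventually)
    obtain R where R: "{p\<in>\<Lambda>. p - t \<in> H} \<subseteq> ball 0 R"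
      using bounded_subset_ballD[OF finite_imp_bounded[OF finite_translate[OF H(1), of t]], of 0] by auto
    have qeq: "q n t = real (translate_count H t) * g t" if "real n \<ge> R" for n
    proof -
      have "{p\<in>L n. p - t \<in> H} = {p\<in>\<Lambda>. p - t \<in> H}"
        using subset_trans[OF R subset_ball[OF that]] unfolding L_def by auto
      then show ?thesis by (simp add: q_card translate_count_def)
    qed
    show "\<forall>\<^sub>F n in sequentially. q n t = real (translate_count H t) * g t"
    proof (rule eventually_mono[OF eventually_ge_at_top[of "nat \<lceil>R\<rceil>"]])
      fix n assume "n \<ge> nat \<lceil>R\<rceil>"
      then have "real n \<ge> R" by linarith
      then show "q n t = real (translate_count H t) * g t" by (rule qeq)
    qed
  qed
  have dom: "norm (q n t) \<le> M * ((1 + norm t) * g t)" for n t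
  proof -
    have "card {p\<in>L n. p - t \<in> H} \<le> translate_count H t"
      unfolding translate_count_def
      by (rule card_mono[OF finite_translate[OF H(1)]]) (use L in auto)
    then have "real (card {p\<in>L n. p - t \<in> H}) \<le> M * (1 + norm t)" using w[of t] by linarith
    then show ?thesis using g_nonneg[of t] by (simp add: q_card abs_mult mult_right_mono flip: mult.assoc)
  qed
  \<comment> \<open>The count is measurable as the pointwise limit of the finite sums \<open>q n\<close>.\<close>
  have qm: "q n \<in> borel_measurable lborel" for n unfolding q_def by measurable
  have lm: "(\<lambda>t. real (translate_count H t) * g t) \<in> borel_measurable lborel"
    by (rule borel_measurable_LIMSEQ_real[OF lim qm])
  have im: "integrable lborel (\<lambda>t. M * ((1 + norm t) * g t))" using first_moment by simp
  show "integrable lborel (\<lambda>t. real (translate_count H t) * g t)"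
    by (rule integrable_dominated_convergence[where s = q, OF lm qm im]) (use lim dom in auto)
  have 1: "(\<lambda>n. integral\<^sup>L lborel (q n)) \<longlonglongrightarrow> (\<integral>t. real (translate_count H t) * g t \<partial>lborel)"
    by (rule integral_dominated_convergence[where s = q, OF lm qm im]) (use lim dom in auto)
  have "(\<lambda>n. \<integral>y. indicator H y * (\<Sum>p\<in>L n. g (p - y)) \<partial>lborel) \<longlonglongrightarrow> (\<integral>y. indicator H y * c \<partial>lborel)"
  proof (rule integral_dominated_convergence[OF _ _ iH[of c]])
    have fl: "filterlim L (finite_subsets_at_top \<Lambda>) sequentially"
      unfolding filterlim_finite_subsets_at_top
    proof (intro allI impI)
      fix X assume X: "finite X \<and> X \<subseteq> \<Lambda>"
      then obtain R where R: "X \<subseteq> ball 0 R"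
        using bounded_subset_ballD[OF finite_imp_bounded, of X 0] by auto
      have Leq: "finite (L n) \<and> X \<subseteq> L n \<and> L n \<subseteq> \<Lambda>" if "real n \<ge> R" for n
        using subset_trans[OF R subset_ball[OF that]] X L[of n] unfolding L_def by auto
      show "\<forall>\<^sub>F n in sequentially. finite (L n) \<and> X \<subseteq> L n \<and> L n \<subseteq> \<Lambda>"
      proof (rule eventually_mono[OF eventually_ge_at_top[of "nat \<lceil>R\<rceil>"]])
        fix n assume "n \<ge> nat \<lceil>R\<rceil>"
        then have "real n \<ge> R" by linarith
        then show "finite (L n) \<and> X \<subseteq> L n \<and> L n \<subseteq> \<Lambda>" by fact
      qed
    qed
    have "(\<lambda>n. \<Sum>p\<in>L n. g (p - y)) \<longlonglongrightarrow> c" for y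
      using filterlim_compose[OF convolution_constant[unfolded has_sum_def] fl] .
    then show "AE y in lborel. (\<lambda>n. indicator H y * (\<Sum>p\<in>L n. g (p - y))) \<longlonglongrightarrow> indicator H y * c"
      by (intro AE_I2 tendsto_mult tendsto_const)
    show "AE y in lborel. norm (indicator H y * (\<Sum>p\<in>L n. g (p - y))) \<le> indicator H y * c" for n
      using finite_sum_le[OF L] g_nonneg by (auto simp: indicator_def sum_nonneg abs_of_nonneg)
  qed measurable
  then have 2: "(\<lambda>n. integral\<^sup>L lborel (q n)) \<longlonglongrightarrow> c * measure lborel H"
    using H(2) by (simp add: q_int mult.commute)
  show "(\<integral>t. real (translate_count H t) * g t \<partial>lborel) = c * measure lborel H"
    by (rule LIMSEQ_unique[OF 1 2])
qed

definition discrepancy_constant :: real where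
  "discrepancy_constant = packing * (\<integral>x. (1 + norm x) * g x \<partial>lborel) / mass"

lemma discrepancy_constant_nonneg: "discrepancy_constant \<ge> 0"
  unfolding discrepancy_constant_def using packing_nonneg mass_pos g_nonneg
  by (intro divide_nonneg_pos mult_nonneg_nonneg Bochner_Integration.integral_nonneg) auto

text \<open>
  By \<open>mean_translate_count\<close> the discrepancy, multiplied by the mass of
  \<open>g\<close>, is the \<open>g\<close>-average of the differences between the counts in
  \<open>H\<close> and in its translates.  The set \<open>S'\<close> stands for a
  neighbourhood of the boundary of \<open>H\<close>.
\<close>

theorem discrepancy:
  assumes H: "bounded H" "H \<in> sets borel" and S': "S' \<in> sets borel" "bounded S'"
    and bd: "\<And>x y. dist x y \<le> 1 \<Longrightarrow> x \<in> H \<Longrightarrow> y \<notin> H \<Longrightarrow> ball x 1 \<union> ball y 1 \<subseteq> S'"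
  shows "\<bar>real (card (\<Lambda> \<inter> H)) - point_density * measure lborel H\<bar> \<le> discrepancy_constant * measure lborel S'"
proof -
  let ?q = "\<lambda>t. real (translate_count H t)"
  let ?M = "packing * measure lborel S'"
  have M: "?M \<ge> 0" using packing_nonneg by simp
  have diff: "\<bar>?q 0 - ?q t\<bar> \<le> (1 + norm t) * ?M" for t
    by (rule translate_count_difference[OF H(1) S' bd])
  have q0: "?q 0 = card (\<Lambda> \<inter> H)" by (simp add: translate_count_def Int_def)
  have w: "?q t \<le> (?q 0 + ?M) * (1 + norm t)" for t
  proof -
    have "?q t \<le> ?q 0 + (1 + norm t) * ?M" using diff[of t] by linarith
    also have "\<dots> \<le> ?q 0 * (1 + norm t) + (1 + norm t) * ?M" by (simp add: algebra_simps)
    finally show ?thesis by (simp add: algebra_simps)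
  qed
  note mean = mean_translate_count[OF H w]
  have "?q 0 * mass - c * measure lborel H = (\<integral>t. ?q 0 * g t - ?q t * g t \<partial>lborel)"
    using mean integrable_g by (simp add: mass_def)
  then have "\<bar>?q 0 * mass - c * measure lborel H\<bar> \<le> (\<integral>t. \<bar>?q 0 * g t - ?q t * g t\<bar> \<partial>lborel)"
    using integral_abs_bound by metis
  also have "\<dots> \<le> (\<integral>t. ?M * ((1 + norm t) * g t) \<partial>lborel)"
  proof (rule integral_mono)
    show "integrable lborel (\<lambda>t. \<bar>?q 0 * g t - ?q t * g t\<bar>)"
      using mean(1) integrable_g by (intro integrable_abs Bochner_Integration.integrable_diff) auto
    show "integrable lborel (\<lambda>t. ?M * ((1 + norm t) * g t))" using first_moment by simp
    fix t
    have "\<bar>?q 0 * g t - ?q t * g t\<bar> = \<bar>?q 0 - ?q t\<bar> * g t"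
      using g_nonneg[of t] by (simp add: abs_mult flip: left_diff_distrib)
    also have "\<dots> \<le> (1 + norm t) * ?M * g t"
      by (intro mult_right_mono diff g_nonneg)
    finally show "\<bar>?q 0 * g t - ?q t * g t\<bar> \<le> ?M * ((1 + norm t) * g t)" by (simp add: mult_ac)
  qed
  also have "\<dots> = ?M * (\<integral>t. (1 + norm t) * g t \<partial>lborel)" by simp
  finally have *: "\<bar>?q 0 * mass - c * measure lborel H\<bar> \<le> ?M * (\<integral>t. (1 + norm t) * g t \<partial>lborel)" .
  have "\<bar>?q 0 - point_density * measure lborel H\<bar> = \<bar>?q 0 * mass - c * measure lborel H\<bar> / mass"
  proof -
    have "?q 0 - point_density * measure lborel H = (?q 0 * mass - c * measure lborel H) / mass"
      using mass_pos by (simp add: point_density_def field_simps)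
    then show ?thesis using mass_pos by simp
  qed
  also have "\<dots> \<le> ?M * (\<integral>t. (1 + norm t) * g t \<partial>lborel) / mass"
    using * mass_pos by (intro divide_right_mono) auto
  also have "\<dots> = discrepancy_constant * measure lborel S'"
    by (simp add: discrepancy_constant_def mult_ac)
  finally show ?thesis by (simp add: q0)
qed

text \<open>
  Here the neighbourhood of the boundary is the shell between the radii \<open>R - 2\<close>
  and \<open>R + 2\<close>.
\<close>

theorem ball_discrepancy:
  assumes "R \<ge> 2"
  shows "\<bar>real (card (\<Lambda> \<inter> ball x R)) - point_density * measure lborel (ball x R)\<bar> \<le>
    discrepancy_constant * (measure lborel (ball (0::real^'d) 1) * (real CARD('d) * 4 * 2 ^ (CARD('d) - 1))) * R ^ (CARD('d) - 1)"
proof -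
  let ?S = "ball x (R + 2) - ball x (R - 2)"
  have *: "\<bar>real (card (\<Lambda> \<inter> ball x R)) - point_density * measure lborel (ball x R)\<bar> \<le> discrepancy_constant * measure lborel ?S"
  proof (rule discrepancy)
    show "bounded ?S" using bounded_ball bounded_diff by blast
    fix y z :: "real^'d"
    assume d: "dist y z \<le> 1" and y: "y \<in> ball x R" and z: "z \<notin> ball x R"
    have "dist x w < R + 2 \<and> R - 2 \<le> dist x w" if "w \<in> ball y 1 \<union> ball z 1" for w
    proof -
      have t: "dist x z \<le> dist x y + dist y z" "dist x w \<le> dist x y + dist y w" "dist x w \<le> dist x z + dist z w"
        "dist x y \<le> dist x w + dist y w" "dist x z \<le> dist x w + dist z w"
        by (metis dist_triangle dist_commute)+
      show ?thesis using t d y z that by auto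
    qed
    then show "ball y 1 \<union> ball z 1 \<subseteq> ?S" by (auto simp: not_less subset_iff)
  qed auto
  have "measure lborel ?S = measure lborel (ball x (R + 2)) - measure lborel (ball x (R - 2))"
    by (rule measure_Diff) (use emeasure_lborel_ball_finite[of x "R + 2"] in auto)
  also have "\<dots> = measure lborel (ball (0::real^'d) 1) * ((R + 2) ^ CARD('d) - (R - 2) ^ CARD('d))"
    using assms by (simp add: content_ball_conv_unit_ball[of "R + 2"] content_ball_conv_unit_ball[of "R - 2"] algebra_simps)
  also have "\<dots> \<le> measure lborel (ball (0::real^'d) 1) * (real CARD('d) * 4 * 2 ^ (CARD('d) - 1) * R ^ (CARD('d) - 1))"
  proof (rule mult_left_mono)
    have "(R + 2) ^ CARD('d) - (R - 2) ^ CARD('d) \<le> real CARD('d) * 4 * (R + 2) ^ (CARD('d) - 1)"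
      using power_difference_le[of "R - 2" "R + 2" "CARD('d)"] assms by simp
    also have "\<dots> \<le> real CARD('d) * 4 * (2 * R) ^ (CARD('d) - 1)"
      using assms by (intro mult_left_mono power_mono) auto
    finally show "(R + 2) ^ CARD('d) - (R - 2) ^ CARD('d) \<le> real CARD('d) * 4 * 2 ^ (CARD('d) - 1) * R ^ (CARD('d) - 1)"
      by (simp add: power_mult_distrib)
  qed simp
  finally have "discrepancy_constant * measure lborel ?S \<le> discrepancy_constant *
    (measure lborel (ball (0::real^'d) 1) * (real CARD('d) * 4 * 2 ^ (CARD('d) - 1) * R ^ (CARD('d) - 1)))"
    using discrepancy_constant_nonneg by (rule mult_left_mono)
  with * show ?thesis by (simp only: mult_ac)
qed

end

section \<open>Matchings between infinite sets\<close>

text \<open>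
  Hall's marriage theorem for infinitely many finite sets, by Rado's argument.  Zorn's lemma
  gives a minimal relation \<open>R\<close> satisfying Hall's condition; the condition
  survives intersections of chains because it concerns finitely many pairs at a time.  If
  \<open>R\<close> still offered two partners \<open>x\<close> and \<open>y\<close> to some
  \<open>i\<close>, minimality would give finite sets \<open>A\<close> and \<open>B\<close>
  witnessing that neither can be dropped, and submodularity of the cardinality would
  contradict Hall's condition for \<open>insert i (A \<union> B)\<close> and \<open>A
  \<inter> B\<close>.
\<close>

lemma infinite_hall:
  fixes N :: "'a \<Rightarrow> 'b set"
  assumes fin: "\<And>i. i \<in> I \<Longrightarrow> finite (N i)"
    and hall: "\<And>A. finite A \<Longrightarrow> A \<subseteq> I \<Longrightarrow> card A \<le> card (\<Union>i\<in>A. N i)"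
  obtains f where "inj_on f I" "\<forall>i\<in>I. f i \<in> N i"
proof -
  define G where "G = Sigma I N"
  define hallian where "hallian R \<longleftrightarrow> (\<forall>A. finite A \<and> A \<subseteq> I \<longrightarrow> card A \<le> card (R `` A))" for R :: "('a \<times> 'b) set"
  have Gimg: "G `` A = (\<Union>i\<in>A. N i)" if "A \<subseteq> I" for A
    using that by (auto simp: G_def)
  have finG: "finite (R `` A)" if "finite A" "A \<subseteq> I" "R \<subseteq> G" for R A
  proof (rule finite_subset)
    show "R `` A \<subseteq> (\<Union>i\<in>A. N i)" using that by (auto simp: G_def)
    show "finite (\<Union>i\<in>A. N i)" using that fin by blast
  qed
  \<comment> \<open>Zorn's lemma is applied to the sets of deleted pairs, which turns minimal relations into maximal elements.\<close>
  define P where "P = {D. D \<subseteq> G \<and> hallian (G - D)}"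
  have "\<exists>M\<in>P. \<forall>X\<in>P. M \<subseteq> X \<longrightarrow> X = M"
  proof (rule subset_Zorn')
    fix C assume C: "subset.chain P C"
    then have CP: "C \<subseteq> P" by (simp add: subset_chain_def)
    have "card A \<le> card ((G - \<Union>C) `` A)" if A: "finite A" "A \<subseteq> I" for A
    proof (cases "C = {}")
      case True
      then show ?thesis using hall[OF A] Gimg[OF A(2)] by simp
    next
      case False
      \<comment> \<open>On the finitely many pairs over \<open>A\<close>, the union of the chain agrees with one of its members.\<close>
      have "finite (\<Union>C \<inter> Sigma A N)" using A fin by (intro finite_Int disjI2 finite_SigmaI) auto
      then obtain D where D: "D \<in> C" "\<Union>C \<inter> Sigma A N \<subseteq> D"
        by (rule finite_subset_Union_chain[OF _ Int_lower1 False C])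
      have "card A \<le> card ((G - D) `` A)"
        using D(1) CP A by (auto simp: P_def hallian_def)
      also have "(G - D) `` A = (G - \<Union>C) `` A"
        using D by (auto simp: G_def)
      finally show ?thesis .
    qed
    then show "\<Union>C \<in> P"
      using CP by (auto simp: P_def hallian_def)
  qed
  then obtain D where D: "D \<in> P" and Dmax: "\<And>X. X \<in> P \<Longrightarrow> D \<subseteq> X \<Longrightarrow> X = D"
    by blast
  define R where "R = G - D"
  have RG: "R \<subseteq> G" by (auto simp: R_def)
  have Rhall: "card A \<le> card (R `` A)" if "finite A" "A \<subseteq> I" for A
    using D that by (auto simp: P_def hallian_def R_def)
  \<comment> \<open>Dropping a pair \<open>(i, x)\<close> violates Hall's condition for some set containing \<open>i\<close>.\<close>
  have critical: "\<exists>A. finite A \<and> A \<subseteq> I - {i} \<and> card (R `` A \<union> (R `` {i} - {x})) \<le> card A"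
    if x: "(i, x) \<in> R" for i x
  proof -
    have iI: "i \<in> I" using x RG by (auto simp: G_def)
    have "insert (i, x) D \<notin> P"
      using Dmax[of "insert (i, x) D"] x by (auto simp: R_def)
    moreover have "G - insert (i, x) D = R - {(i, x)}" by (auto simp: R_def)
    moreover have "insert (i, x) D \<subseteq> G" using D x RG by (auto simp: P_def)
    ultimately have "\<not> hallian (R - {(i, x)})" by (simp add: P_def)
    then obtain A where A: "finite A" "A \<subseteq> I" "card ((R - {(i, x)}) `` A) < card A"
      by (auto simp: hallian_def not_le)
    have "i \<in> A"
    proof (rule ccontr)
      assume "i \<notin> A"
      then have "(R - {(i, x)}) `` A = R `` A" by auto
      then show False using A Rhall[OF A(1,2)] by simp
    qed
    have "R `` (A - {i}) \<union> (R `` {i} - {x}) \<subseteq> (R - {(i, x)}) `` A"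
      using \<open>i \<in> A\<close> by auto
    then have "card (R `` (A - {i}) \<union> (R `` {i} - {x})) \<le> card ((R - {(i, x)}) `` A)"
      by (intro card_mono finG A) (use RG in auto)
    also have "\<dots> \<le> card (A - {i})"
      using A \<open>i \<in> A\<close> by (simp add: card_Diff_singleton)
    finally show ?thesis
      using A by (intro exI[of _ "A - {i}"]) auto
  qed
  have unique: "x = y" if xy: "(i, x) \<in> R" "(i, y) \<in> R" for i x y
  proof (rule ccontr)
    assume ne: "x \<noteq> y"
    have iI: "i \<in> I" using xy RG by (auto simp: G_def)
    obtain A where A: "finite A" "A \<subseteq> I - {i}" "card (R `` A \<union> (R `` {i} - {x})) \<le> card A"
      using critical[OF xy(1)] by blast
    obtain B where B: "finite B" "B \<subseteq> I - {i}" "card (R `` B \<union> (R `` {i} - {y})) \<le> card B"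
      using critical[OF xy(2)] by blast
    let ?U = "R `` A \<union> (R `` {i} - {x})" and ?V = "R `` B \<union> (R `` {i} - {y})"
    have fU: "finite ?U" "finite ?V"
      using finG[of A R] finG[of B R] finG[of "{i}" R] A B iI RG by auto
    have "card (insert i (A \<union> B)) + card (A \<inter> B) \<le> card (R `` (insert i (A \<union> B))) + card (R `` (A \<inter> B))"
      using A B iI by (intro add_mono Rhall) auto
    also have "R `` (insert i (A \<union> B)) = ?U \<union> ?V" using ne by auto
    also have "card (R `` (A \<inter> B)) \<le> card (?U \<inter> ?V)"
      using fU by (intro card_mono) auto
    also have "card (?U \<union> ?V) + card (?U \<inter> ?V) = card ?U + card ?V"
      using card_Un_Int[OF fU] by simp
    also have "\<dots> \<le> card A + card B" using A B by simp
    also have "\<dots> = card (A \<union> B) + card (A \<inter> B)" by (rule card_Un_Int[OF A(1) B(1)])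
    finally have "card (insert i (A \<union> B)) \<le> card (A \<union> B)" by simp
    moreover have "i \<notin> A \<union> B" using A B by auto
    ultimately show False using A B by simp
  qed
  have ex: "\<exists>x. (i, x) \<in> R" if "i \<in> I" for i
  proof (rule ccontr)
    assume "\<nexists>x. (i, x) \<in> R"
    then have "R `` {i} = {}" by auto
    then show False using Rhall[of "{i}"] that by simp
  qed
  then obtain f where f: "\<And>i. i \<in> I \<Longrightarrow> (i, f i) \<in> R" by metis
  show ?thesis
  proof (rule that)
    show "inj_on f I"
    proof (rule inj_onI, rule ccontr)
      fix i j assume ij: "i \<in> I" "j \<in> I" "f i = f j" "i \<noteq> j"
      have "R `` {i, j} \<subseteq> {f i}"
        using unique[OF f[OF ij(1)]] unique[OF f[OF ij(2)]] ij(3) by auto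
      from card_mono[OF _ this] have "card (R `` {i, j}) \<le> 1" by simp
      then show False using Rhall[of "{i, j}"] ij by simp
    qed
    show "\<forall>i\<in>I. f i \<in> N i" using f RG by (auto simp: G_def)
  qed
qed

text \<open>
  The Schroeder-Bernstein theorem in Banach's form: the bijection is pieced together from
  \<open>f\<close> and the inverse of \<open>g\<close>, so it inherits every relation that
  both injections respect.
\<close>

lemma banach_decomposition:
  assumes f: "inj_on f A" "f ` A \<subseteq> B" and g: "inj_on g B" "g ` B \<subseteq> A"
  obtains h where "bij_betw h A B" "\<forall>a\<in>A. h a = f a \<or> g (h a) = a"
proof -
  define X where "X = lfp (\<lambda>X. A - (g ` (B - (f ` X))))"
  define h where "h z = (if z \<in> X then f z else the_inv_into B g z)" for z
  have X: "X = A - (g ` (B - (f ` X)))"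
    unfolding X_def by (rule lfp_unfold) (blast intro: monoI)
  then have X_compl: "A - X = g ` (B - (f ` X))" using g(2) by blast
  have XA: "X \<subseteq> A" using X by auto
  have inv: "the_inv_into B g (g b) = b" if "b \<in> B" for b
    using g(1) that by (rule the_inv_into_f_f)
  have 1: "bij_betw h X (f ` X)"
    using f(1) XA by (auto simp: bij_betw_def h_def inj_on_def)
  have 2: "bij_betw h (A - X) (B - f ` X)"
  proof (rule bij_betw_byWitness[where f' = g])
    show "\<forall>a\<in>A - X. g (h a) = a" unfolding X_compl using X_compl inv by (auto simp: h_def)
    show "\<forall>b\<in>B - f ` X. h (g b) = b"
    proof
      fix b assume b: "b \<in> B - f ` X"
      then have "g b \<in> A - X" unfolding X_compl by blast
      then show "h (g b) = b" using b inv by (simp add: h_def)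
    qed
    show "h ` (A - X) \<subseteq> B - f ` X" using X_compl inv by (auto simp: h_def)
    show "g ` (B - f ` X) \<subseteq> A - X" using X_compl by simp
  qed
  have "bij_betw h (X \<union> (A - X)) (f ` X \<union> (B - f ` X))"
    using 1 2 by (rule bij_betw_combine) auto
  moreover have "X \<union> (A - X) = A" "f ` X \<union> (B - f ` X) = B" using XA f(2) by auto
  ultimately have "bij_betw h A B" by simp
  moreover have "\<forall>a\<in>A. h a = f a \<or> g (h a) = a"
  proof
    fix a assume "a \<in> A"
    show "h a = f a \<or> g (h a) = a"
    proof (cases "a \<in> X")
      case False
      with \<open>a \<in> A\<close> have "a \<in> g ` (B - f ` X)" using X_compl by blast
      then show ?thesis using False inv by (auto simp: h_def)
    qed (simp add: h_def)
  qed
  ultimately show ?thesis by (rule that)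
qed

section \<open>Unions of cubes\<close>

text \<open>
  The index of the half-open cube of side \<open>L\<close> that contains \<open>x\<close>.
\<close>

definition cell :: "real \<Rightarrow> real^'d \<Rightarrow> int^'d" where
  "cell L x = (\<chi> j. \<lfloor>x $ j / L\<rfloor>)"

text \<open>
  Cubes that share only a corner count as adjacent, and so does a cube with itself.
\<close>

definition adjacent :: "int^'d \<Rightarrow> int^'d \<Rightarrow> bool" where
  "adjacent k l \<longleftrightarrow> (\<forall>j. \<bar>k $ j - l $ j\<bar> \<le> 1)"

definition neighbourhood :: "(int^'d) set \<Rightarrow> (int^'d) set" where
  "neighbourhood K = {l. \<exists>k\<in>K. adjacent k l}"

definition cells :: "real \<Rightarrow> (int^'d) set \<Rightarrow> (real^'d) set" where
  "cells L K = {x. cell L x \<in> K}"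

lemma adjacent_refl: "adjacent k k"
  by (simp add: adjacent_def)

lemma adjacent_sym: "adjacent k l \<Longrightarrow> adjacent l k"
  by (simp add: adjacent_def abs_minus_commute)

lemma subset_neighbourhood: "K \<subseteq> neighbourhood K"
  using adjacent_refl by (auto simp: neighbourhood_def)

lemma card_vec_choices:
  fixes S :: "'d::finite \<Rightarrow> 'a set"
  assumes "\<And>j. finite (S j)"
  shows "finite {l::'a^'d. \<forall>j. l $ j \<in> S j}" and "card {l::'a^'d. \<forall>j. l $ j \<in> S j} = (\<Prod>j\<in>UNIV. card (S j))"
proof -
  have b: "bij_betw vec_nth {l::'a^'d. \<forall>j. l $ j \<in> S j} (PiE UNIV S)"
    by (rule bij_betw_byWitness[where f' = vec_lambda]) (auto simp: vec_lambda_eta)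
  then show "finite {l::'a^'d. \<forall>j. l $ j \<in> S j}"
    using bij_betw_finite[OF b] assms by (simp add: finite_PiE)
  show "card {l::'a^'d. \<forall>j. l $ j \<in> S j} = (\<Prod>j\<in>UNIV. card (S j))"
    using bij_betw_same_card[OF b] by (simp add: card_PiE)
qed

lemma neighbourhood_singleton:
  fixes k :: "int^'d"
  shows "finite {l. adjacent k l}" "card {l. adjacent k l} = 3 ^ CARD('d)"
proof -
  have eq: "{l. adjacent k l} = {l. \<forall>j. l $ j \<in> {k $ j - 1..k $ j + 1}}"
    by (auto simp: adjacent_def abs_le_iff algebra_simps)
  show "finite {l. adjacent k l}" "card {l. adjacent k l} = 3 ^ CARD('d)"
    unfolding eq using card_vec_choices[of "\<lambda>j. {k $ j - 1..k $ j + 1}"] by auto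
qed

lemma finite_neighbourhood:
  fixes K :: "(int^'d) set"
  assumes "finite K"
  shows "finite (neighbourhood K)" "card (neighbourhood K) \<le> 3 ^ CARD('d) * card K"
proof -
  have eq: "neighbourhood K = (\<Union>k\<in>K. {l. adjacent k l})" by (auto simp: neighbourhood_def)
  show "finite (neighbourhood K)" unfolding eq using assms neighbourhood_singleton by auto
  have "card (neighbourhood K) \<le> (\<Sum>k\<in>K. card {l. adjacent k l})"
    unfolding eq by (rule card_UN_le[OF assms])
  then show "card (neighbourhood K) \<le> 3 ^ CARD('d) * card K" by (simp add: neighbourhood_singleton mult.commute)
qed

lemma neighbourhoodI: "k \<in> K \<Longrightarrow> adjacent k l \<Longrightarrow> l \<in> neighbourhood K"
  by (auto simp: neighbourhood_def)

lemma card_Un_neighbourhood_le: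
  fixes K :: "(int^'d) set"
  assumes "finite K"
  shows "real (card (K \<union> neighbourhood K)) \<le> (1 + 3 ^ CARD('d)) * real (card K)"
proof -
  have "card (K \<union> neighbourhood K) \<le> card K + card (neighbourhood K)" by (rule card_Un_le)
  also have "\<dots> \<le> card K + 3 ^ CARD('d) * card K"
    using finite_neighbourhood(2)[OF assms] by simp
  finally have "real (card (K \<union> neighbourhood K)) \<le> real (card K + 3 ^ CARD('d) * card K)"
    by (simp only: of_nat_le_iff)
  then show ?thesis by (simp add: distrib_right)
qed

lemma card_neighbourhood_split:
  assumes "finite K"
  shows "card (neighbourhood K) = card K + card (neighbourhood K - K)"
  using card_Diff_subset[OF assms subset_neighbourhood]
    card_mono[OF finite_neighbourhood(1)[OF assms] subset_neighbourhood] by simp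

text \<open>
  The two counting hypotheses are Hall's conditions, in the two directions, for the relation
  of lying in adjacent cells.
\<close>

lemma bounded_displacement_bijection:
  fixes X Y :: "(real^'d) set"
  assumes L: "L > 0"
    and fin: "\<And>K. finite K \<Longrightarrow> finite (X \<inter> cells L K)" "\<And>K. finite K \<Longrightarrow> finite (Y \<inter> cells L K)"
    and XY: "\<And>K. finite K \<Longrightarrow> card (X \<inter> cells L K) \<le> card (Y \<inter> cells L (neighbourhood K))"
    and YX: "\<And>K. finite K \<Longrightarrow> card (Y \<inter> cells L K) \<le> card (X \<inter> cells L (neighbourhood K))"
  obtains \<sigma> where "bij_betw \<sigma> X Y" "\<forall>x\<in>X. norm (\<sigma> x - x) \<le> real CARD('d) * (2 * L)"
proof -
  have inj: "\<exists>f. inj_on f X \<and> (\<forall>x\<in>X. f x \<in> {y\<in>Y. adjacent (cell L x) (cell L y)})"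
    if fin: "\<And>K. finite K \<Longrightarrow> finite (X \<inter> cells L K)" "\<And>K. finite K \<Longrightarrow> finite (Y \<inter> cells L K)"
      and XY: "\<And>K. finite K \<Longrightarrow> card (X \<inter> cells L K) \<le> card (Y \<inter> cells L (neighbourhood K))" for X Y
  proof -
    have eq: "(\<Union>x\<in>A. {y\<in>Y. adjacent (cell L x) (cell L y)}) = Y \<inter> cells L (neighbourhood (cell L ` A))" for A
      by (auto simp: cells_def neighbourhood_def)
    show ?thesis
    proof (rule infinite_hall[of X "\<lambda>x. {y\<in>Y. adjacent (cell L x) (cell L y)}"])
      show "finite {y\<in>Y. adjacent (cell L x) (cell L y)}" for x
        using eq[of "{x}"] fin(2)[OF finite_neighbourhood(1), of "{cell L x}"] by simp
      fix A assume A: "finite A" "A \<subseteq> X"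
      have "card A \<le> card (X \<inter> cells L (cell L ` A))"
        using A fin by (intro card_mono) (auto simp: cells_def)
      also have "\<dots> \<le> card (\<Union>x\<in>A. {y\<in>Y. adjacent (cell L x) (cell L y)})"
        unfolding eq using A by (intro XY) auto
      finally show "card A \<le> card (\<Union>x\<in>A. {y\<in>Y. adjacent (cell L x) (cell L y)})" .
    qed blast
  qed
  obtain f where f: "inj_on f X" "\<And>x. x \<in> X \<Longrightarrow> f x \<in> Y \<and> adjacent (cell L x) (cell L (f x))"
    using inj[OF fin XY] by auto
  obtain g where g: "inj_on g Y" "\<And>y. y \<in> Y \<Longrightarrow> g y \<in> X \<and> adjacent (cell L y) (cell L (g y))"
    using inj[OF fin(2,1) YX] by auto
  obtain \<sigma> where \<sigma>: "bij_betw \<sigma> X Y" "\<forall>x\<in>X. \<sigma> x = f x \<or> g (\<sigma> x) = x"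
    by (rule banach_decomposition[of f X Y g]) (use f g in auto)
  have "norm (\<sigma> x - x) \<le> real CARD('d) * (2 * L)" if "x \<in> X" for x
  proof -
    have "\<sigma> x \<in> Y" using \<sigma>(1) that by (auto simp: bij_betw_def)
    then have adj: "adjacent (cell L x) (cell L (\<sigma> x))"
      using \<sigma>(2) that f(2)[OF that] g(2)[of "\<sigma> x"] adjacent_sym by metis
    have "\<bar>(\<sigma> x - x) $ j\<bar> \<le> 2 * L" for j
    proof -
      have "\<bar>\<lfloor>x $ j / L\<rfloor> - \<lfloor>\<sigma> x $ j / L\<rfloor>\<bar> \<le> 1"
        using adj by (simp add: adjacent_def cell_def)
      then have "\<bar>x $ j / L - \<sigma> x $ j / L\<bar> \<le> 2" by linarith
      then have "\<bar>(\<sigma> x $ j - x $ j) / L\<bar> \<le> 2" by (simp add: diff_divide_distrib abs_minus_commute)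
      then show ?thesis using L by (simp add: abs_divide divide_le_eq)
    qed
    then have "(\<Sum>j\<in>UNIV. \<bar>(\<sigma> x - x) $ j\<bar>) \<le> (\<Sum>j\<in>(UNIV::'d set). 2 * L)"
      by (intro sum_mono)
    then show ?thesis using norm_le_l1_cart[of "\<sigma> x - x"] by simp
  qed
  with \<sigma>(1) show ?thesis using that by blast
qed

definition cube :: "real \<Rightarrow> int^'d \<Rightarrow> (real^'d) set" where
  "cube L k = {x. cell L x = k}"

lemma cells_eq_UN_cube: "cells L K = (\<Union>k\<in>K. cube L k)"
  by (auto simp: cells_def cube_def)

lemma mem_cube:
  assumes "L > 0"
  shows "x \<in> cube L k \<longleftrightarrow> (\<forall>j. L * k $ j \<le> x $ j \<and> x $ j < L * (k $ j + 1))"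
  using assms by (simp add: cube_def cell_def vec_eq_iff floor_eq_iff le_divide_eq divide_less_eq mult.commute)

lemma content_box_cart:
  fixes a b :: "real^'d"
  assumes "\<And>j. a $ j \<le> b $ j"
  shows "measure lborel (cbox a b) = (\<Prod>j\<in>UNIV. b $ j - a $ j)"
    and "measure lborel (box a b) = (\<Prod>j\<in>UNIV. b $ j - a $ j)"
proof -
  have "a \<in> cbox a b" using assms by (simp add: mem_box_cart)
  then show 1: "measure lborel (cbox a b) = (\<Prod>j\<in>UNIV. b $ j - a $ j)"
    by (intro content_cbox_cart) auto
  then show "measure lborel (box a b) = (\<Prod>j\<in>UNIV. b $ j - a $ j)"
    by (simp only: measure_lborel_box_eq measure_lborel_cbox_eq)
qed

lemma cube_measure:
  fixes k :: "int^'d"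
  assumes L: "L > 0"
  shows "cube L k \<in> sets borel" "bounded (cube L k)" "measure lborel (cube L k) = L ^ CARD('d)"
proof -
  define a b :: "real^'d" where "a = (\<chi> j. L * k $ j)" and "b = (\<chi> j. L * (k $ j + 1))"
  have ab: "a $ j \<le> b $ j" for j using L by (simp add: a_def b_def)
  have sub: "box a b \<subseteq> cube L k" "cube L k \<subseteq> cbox a b"
    by (auto simp: mem_cube[OF L] mem_box_cart a_def b_def less_imp_le)
  have "cube L k = (\<Inter>j. {x. a $ j \<le> x $ j} \<inter> {x. x $ j < b $ j})"
    by (auto simp: mem_cube[OF L] a_def b_def)
  also have "\<dots> \<in> sets borel"
    by (intro sets.finite_INT sets.Int borel_closed borel_open closed_halfspace_component_ge_cart
        open_halfspace_component_lt_cart) auto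
  finally show m: "cube L k \<in> sets borel" .
  show bd: "bounded (cube L k)" using sub(2) bounded_cbox bounded_subset by blast
  have "measure lborel (box a b) \<le> measure lborel (cube L k)"
    by (rule measure_mono_fmeasurable[OF sub(1)])
       (use m bd emeasure_bounded_finite in \<open>auto simp: fmeasurable_def\<close>)
  moreover have "measure lborel (cube L k) \<le> measure lborel (cbox a b)"
    by (rule measure_mono_fmeasurable[OF sub(2)]) (use m in auto)
  moreover have "(\<Prod>j\<in>(UNIV::'d set). b $ j - a $ j) = L ^ CARD('d)"
    by (simp add: a_def b_def algebra_simps)
  ultimately show "measure lborel (cube L k) = L ^ CARD('d)"
    using content_box_cart[of a b] ab by simp
qed

lemma cells_measure:
  fixes K :: "(int^'d) set"
  assumes L: "L > 0" and K: "finite K"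
  shows "cells L K \<in> sets borel" "bounded (cells L K)" "measure lborel (cells L K) = L ^ CARD('d) * card K"
proof -
  show "cells L K \<in> sets borel"
    unfolding cells_eq_UN_cube using K cube_measure(1)[OF L] by (intro sets.finite_UN) auto
  show "bounded (cells L K)"
    unfolding cells_eq_UN_cube using K cube_measure(2)[OF L] by (intro bounded_UN) auto
  have "measure lborel (cells L K) = (\<Sum>k\<in>K. measure lborel (cube L k))"
    unfolding cells_eq_UN_cube
  proof (rule measure_finite_Union[OF K])
    show "disjoint_family_on (cube L) K" by (auto simp: disjoint_family_on_def cube_def)
    show "emeasure lborel (cube L k) \<noteq> \<infinity>" for k :: "int^'d"
      using emeasure_bounded_finite[OF cube_measure(2)[OF L, of k]] by simp
  qed (use cube_measure(1)[OF L] in auto)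
  then show "measure lborel (cells L K) = L ^ CARD('d) * card K"
    by (simp add: cube_measure(3)[OF L])
qed

definition cube_shell :: "real \<Rightarrow> int^'d \<Rightarrow> (real^'d) set" where
  "cube_shell L k =
     cbox (\<chi> j. L * k $ j - 1) (\<chi> j. L * (k $ j + 1) + 1) - box (\<chi> j. L * k $ j + 2) (\<chi> j. L * (k $ j + 1) - 2)"

text \<open>
  Some coordinate of \<open>x\<close> is within distance \<open>1\<close> of a face of the
  cube, since \<open>y\<close> lies beyond that face.
\<close>

lemma ball_subset_cube_shell:
  fixes x y :: "real^'d"
  assumes L: "L > 0" and x: "x \<in> cube L k" and y: "y \<notin> cube L k" and d: "dist x y \<le> 1"
  shows "ball x 1 \<subseteq> cube_shell L k"
proof
  fix z assume "z \<in> ball x 1"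
  then have "norm (x - z) < 1" by (simp add: dist_norm)
  then have xz: "\<bar>x $ j - z $ j\<bar> < 1" for j
    using component_le_norm_cart[of "x - z" j] by simp
  have xy: "\<bar>x $ j - y $ j\<bar> \<le> 1" for j
    using component_le_norm_cart[of "x - y" j] d by (simp add: dist_norm)
  have xk: "L * k $ j \<le> x $ j" "x $ j < L * (k $ j + 1)" for j
    using x by (auto simp: mem_cube[OF L])
  have "z \<in> cbox (\<chi> j. L * k $ j - 1) (\<chi> j. L * (k $ j + 1) + 1)"
    unfolding mem_box_cart
  proof
    show "(\<chi> j. L * k $ j - 1) $ j \<le> z $ j \<and> z $ j \<le> (\<chi> j. L * (k $ j + 1) + 1) $ j" for j
      using xz[of j] xk[of j] unfolding vec_lambda_beta by linarith
  qed
  moreover obtain j where j: "y $ j < L * k $ j \<or> L * (k $ j + 1) \<le> y $ j"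
    using y by (auto simp: mem_cube[OF L] not_le not_less)
  have "z $ j \<le> L * k $ j + 2 \<or> L * (k $ j + 1) - 2 \<le> z $ j"
    using j xz[of j] xy[of j] by linarith
  then have "z \<notin> box (\<chi> j. L * k $ j + 2) (\<chi> j. L * (k $ j + 1) - 2)"
    unfolding mem_box_cart vec_lambda_beta by (metis not_le)
  ultimately show "z \<in> cube_shell L k" by (simp add: cube_shell_def)
qed

lemma cube_shell_measure:
  fixes k :: "int^'d"
  assumes L: "L \<ge> 4"
  shows "cube_shell L k \<in> sets borel" "bounded (cube_shell L k)"
    "measure lborel (cube_shell L k) \<le> real CARD('d) * 6 * (L + 2) ^ (CARD('d) - 1)"
proof -
  show "cube_shell L k \<in> sets borel" by (simp add: cube_shell_def)
  show "bounded (cube_shell L k)"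
    unfolding cube_shell_def by (rule bounded_subset[OF bounded_cbox Diff_subset])
  let ?a = "\<chi> j. L * k $ j - 1" and ?b = "\<chi> j. L * (k $ j + 1) + 1"
    and ?c = "\<chi> j. L * k $ j + 2" and ?d = "\<chi> j. L * (k $ j + 1) - 2"
  have "measure lborel (cube_shell L k) = measure lborel (cbox ?a ?b) - measure lborel (box ?c ?d)"
    unfolding cube_shell_def
  proof (rule measure_Diff)
    show "emeasure lborel (cbox ?a ?b) \<noteq> \<infinity>"
      using emeasure_bounded_finite[OF bounded_cbox, of ?a ?b] by simp
    show "box ?c ?d \<subseteq> cbox ?a ?b"
    proof
      fix x assume "x \<in> box ?c ?d"
      then have "L * k $ j + 2 < x $ j \<and> x $ j < L * (k $ j + 1) - 2" for j
        by (simp add: mem_box_cart)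
      then have "L * k $ j - 1 \<le> x $ j \<and> x $ j \<le> L * (k $ j + 1) + 1" for j
        by (smt (verit))
      then show "x \<in> cbox ?a ?b" by (simp add: mem_box_cart)
    qed
  qed auto
  also have "measure lborel (cbox ?a ?b) = (L + 2) ^ CARD('d)"
    using L by (subst content_box_cart) (auto simp: algebra_simps)
  also have "measure lborel (box ?c ?d) = (L - 4) ^ CARD('d)"
    using L by (subst content_box_cart) (auto simp: algebra_simps)
  also have "(L + 2) ^ CARD('d) - (L - 4) ^ CARD('d) \<le> real CARD('d) * 6 * (L + 2) ^ (CARD('d) - 1)"
    using power_difference_le[of "L - 4" "L + 2" "CARD('d)"] L by simp
  finally show "measure lborel (cube_shell L k) \<le> real CARD('d) * 6 * (L + 2) ^ (CARD('d) - 1)" .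
qed

lemma adjacent_cell:
  fixes x y :: "real^'d"
  assumes "L \<ge> 1" "dist x y \<le> 1"
  shows "adjacent (cell L x) (cell L y)"
  unfolding adjacent_def cell_def
proof
  fix j
  have "\<bar>x $ j - y $ j\<bar> \<le> 1"
    using component_le_norm_cart[of "x - y" j] assms by (simp add: dist_norm)
  then have "\<bar>x $ j - y $ j\<bar> / L \<le> 1" using assms by (simp add: divide_le_eq)
  then have "\<bar>x $ j / L - y $ j / L\<bar> \<le> 1" using assms by (simp flip: diff_divide_distrib)
  then show "\<bar>(\<chi> j. \<lfloor>x $ j / L\<rfloor>) $ j - (\<chi> j. \<lfloor>y $ j / L\<rfloor>) $ j\<bar> \<le> 1"
    unfolding vec_lambda_beta by linarith
qed

text \<open>
  In every coordinate, the points \<open>s * n\<close> of a cell are those with \<open>m * k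
  \<le> n < m * k + m\<close>.
\<close>

lemma scaled_lattice_cells:
  fixes K :: "(int^'d) set"
  assumes s: "s > 0" and m: "m > 0" and K: "finite K"
  shows "finite ((\<lambda>z. s *\<^sub>R z) ` integer_lattice \<inter> cells (real m * s) K)"
    and "card ((\<lambda>z. s *\<^sub>R z) ` integer_lattice \<inter> cells (real m * s) K) = m ^ CARD('d) * card K"
proof -
  let ?Z = "(\<lambda>z. s *\<^sub>R z) ` integer_lattice :: (real^'d) set"
  let ?N = "\<lambda>k. {n::int^'d. \<forall>j. n $ j \<in> {int m * k $ j..<int m * k $ j + int m}}"
  let ?e = "\<lambda>n::int^'d. s *\<^sub>R (\<chi> j. real_of_int (n $ j)) :: real^'d"
  have L: "real m * s > 0" using s m by simp
  have e_cube: "?e n \<in> cube (real m * s) k \<longleftrightarrow> n \<in> ?N k" for n k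
  proof -
    have "real m * s * k $ j \<le> ?e n $ j \<and> ?e n $ j < real m * s * (k $ j + 1)
       \<longleftrightarrow> n $ j \<in> {int m * k $ j..<int m * k $ j + int m}" for j
    proof -
      have "real m * s * k $ j \<le> ?e n $ j \<longleftrightarrow> s * of_int (int m * k $ j) \<le> s * of_int (n $ j)"
        by (simp add: mult_ac)
      moreover have "?e n $ j < real m * s * (k $ j + 1) \<longleftrightarrow> s * of_int (n $ j) < s * of_int (int m * k $ j + int m)"
        by (simp add: algebra_simps)
      ultimately show ?thesis
        using s by (simp only: mult_le_cancel_left_pos mult_less_cancel_left_pos of_int_le_iff of_int_less_iff atLeastLessThan_iff)
    qed
    then show ?thesis unfolding mem_cube[OF L] mem_Collect_eq by blast
  qed
  have eZ: "?Z = range ?e"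
  proof
    show "range ?e \<subseteq> ?Z" by (auto simp: integer_lattice_def)
    show "?Z \<subseteq> range ?e"
    proof
      fix h assume "h \<in> ?Z"
      then obtain z where z: "h = s *\<^sub>R z" "\<And>j. z $ j \<in> \<int>" by (auto simp: integer_lattice_def)
      have "h = ?e (\<chi> j. \<lfloor>z $ j\<rfloor>)"
        using z(2) by (simp add: z(1) vec_eq_iff) 
      then show "h \<in> range ?e" by blast
    qed
  qed
  have inj: "inj ?e"
    using s by (auto simp: inj_def vec_eq_iff)
  have eq: "?Z \<inter> cube (real m * s) k = ?e ` ?N k" for k
    using e_cube[of _ k] by (auto simp: eZ)
  have fin: "finite (?N k)" and card: "card (?N k) = m ^ CARD('d)" for k
    using card_vec_choices[of "\<lambda>j. {int m * k $ j..<int m * k $ j + int m}"] by simp_all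
  have fin': "finite (?Z \<inter> cube (real m * s) k)" for k unfolding eq using fin by simp
  have card': "card (?Z \<inter> cube (real m * s) k) = m ^ CARD('d)" for k
    unfolding eq using card_image[OF inj_on_subset[OF inj subset_UNIV], of "?N k"] card by simp
  have UN: "?Z \<inter> cells (real m * s) K = (\<Union>k\<in>K. ?Z \<inter> cube (real m * s) k)"
    by (auto simp: cells_eq_UN_cube)
  show "finite (?Z \<inter> cells (real m * s) K)" unfolding UN using K fin' by blast
  have "card (?Z \<inter> cells (real m * s) K) = (\<Sum>k\<in>K. card (?Z \<inter> cube (real m * s) k))"
    unfolding UN using K fin' by (intro card_UN_disjoint) (auto simp: cube_def)
  then show "card (?Z \<inter> cells (real m * s) K) = m ^ CARD('d) * card K" by (simp add: card')
qed

context constant_convolution begin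

lemma finite_inter_cells:
  assumes "L > 0" "finite K" shows "finite (\<Lambda> \<inter> cells L K)"
  using finite_translate[OF cells_measure(2)[OF assms], of 0] by (simp add: Int_def)

text \<open>
  A neighbourhood of the boundary is covered by shells of volume \<open>O(L^(d-1))\<close>,
  one for each cell that is adjacent to a cell on the other side of the boundary.
\<close>

lemma cells_discrepancy:
  fixes L :: real
  assumes L: "L \<ge> 4" and K: "finite K" and B: "finite B"
    and bd: "\<And>k l. adjacent k l \<Longrightarrow> k \<in> K \<Longrightarrow> l \<notin> K \<Longrightarrow> k \<in> B \<and> l \<in> B"
  shows "\<bar>real (card (\<Lambda> \<inter> cells L K)) - point_density * (L ^ CARD('d) * card K)\<bar>
     \<le> discrepancy_constant * (card B * (real CARD('d) * 6 * (L + 2) ^ (CARD('d) - 1)))"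
proof -
  have L0: "L > 0" "L \<ge> 1" using L by auto
  let ?S = "\<Union>k\<in>B. cube_shell L k"
  have "\<bar>real (card (\<Lambda> \<inter> cells L K)) - point_density * measure lborel (cells L K)\<bar> \<le> discrepancy_constant * measure lborel ?S"
  proof (rule discrepancy)
    show "bounded (cells L K)" "cells L K \<in> sets borel" using cells_measure[OF L0(1) K] by auto
    show "?S \<in> sets borel" using B cube_shell_measure(1)[OF L] by (intro sets.finite_UN) auto
    show "bounded ?S" using B cube_shell_measure(2)[OF L] by (intro bounded_UN) auto
    fix x y :: "real^'d"
    assume d: "dist x y \<le> 1" and x: "x \<in> cells L K" and y: "y \<notin> cells L K"
    have ne: "cell L x \<noteq> cell L y" using x y by (auto simp: cells_def)
    have "cell L x \<in> B \<and> cell L y \<in> B"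
      using adjacent_cell[OF L0(2) d] x y by (intro bd) (auto simp: cells_def)
    moreover have "ball x 1 \<subseteq> cube_shell L (cell L x)"
      by (rule ball_subset_cube_shell[OF L0(1) _ _ d]) (use ne in \<open>auto simp: cube_def\<close>)
    moreover have "ball y 1 \<subseteq> cube_shell L (cell L y)"
      by (rule ball_subset_cube_shell[OF L0(1), of _ _ x]) (use ne d in \<open>auto simp: cube_def dist_commute\<close>)
    ultimately show "ball x 1 \<union> ball y 1 \<subseteq> ?S" by blast
  qed
  also have "measure lborel ?S \<le> (\<Sum>k\<in>B. measure lborel (cube_shell L k))"
    by (rule measure_UNION_le[OF B]) (use cube_shell_measure(1)[OF L] in auto)
  also have "\<dots> \<le> (\<Sum>k\<in>B. real CARD('d) * 6 * (L + 2) ^ (CARD('d) - 1))"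
    by (intro sum_mono cube_shell_measure(3)[OF L])
  finally show ?thesis
    using discrepancy_constant_nonneg cells_measure(3)[OF L0(1) K] by (simp add: mult_left_mono)
qed

text \<open>
  The side length at which the volume of a cube outweighs the boundary error of \<open>1 + 3
  ^ CARD('d)\<close> shells: a cube in the outer layer of \<open>neighbourhood K\<close>
  accounts for itself and for its \<open>3 ^ CARD('d)\<close> neighbours.
\<close>

definition wide :: "real \<Rightarrow> bool" where
  "wide L \<longleftrightarrow> L \<ge> 4 \<and>
     discrepancy_constant * ((1 + 3 ^ CARD('d)) * (real CARD('d) * 6 * (L + 2) ^ (CARD('d) - 1)))
       \<le> point_density * L ^ CARD('d)"

lemma wide_exists: "\<exists>E. \<forall>L\<ge>E. wide L"
proof -
  let ?C = "discrepancy_constant * ((1 + 3 ^ CARD('d)) * (real CARD('d) * 6 * 2 ^ (CARD('d) - 1)))"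
  have "wide L" if L: "L \<ge> max 4 (?C / point_density)" for L
  proof -
    have L4: "L \<ge> 4" and LC: "?C \<le> point_density * L"
      using L point_density_pos by (auto simp: divide_le_eq mult.commute)
    have "discrepancy_constant * ((1 + 3 ^ CARD('d)) * (real CARD('d) * 6 * (L + 2) ^ (CARD('d) - 1)))
       \<le> discrepancy_constant * ((1 + 3 ^ CARD('d)) * (real CARD('d) * 6 * (2 * L) ^ (CARD('d) - 1)))"
      using L4 discrepancy_constant_nonneg by (intro mult_left_mono power_mono) auto
    also have "\<dots> = ?C * L ^ (CARD('d) - 1)" by (simp add: power_mult_distrib mult_ac)
    also have "\<dots> \<le> point_density * L * L ^ (CARD('d) - 1)"
      using LC L4 by (intro mult_right_mono) auto
    also have "\<dots> = point_density * L ^ CARD('d)"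
      by (metis mult.assoc power_minus_mult zero_less_card_finite mult.commute)
    finally show ?thesis using L4 by (simp add: wide_def)
  qed
  then show ?thesis by blast
qed

lemma wide_boundary_le:
  fixes L :: real
  assumes "wide L" "real (card B) \<le> (1 + 3 ^ CARD('d)) * n"
  shows "discrepancy_constant * (card B * (real CARD('d) * 6 * (L + 2) ^ (CARD('d) - 1))) \<le> point_density * L ^ CARD('d) * n"
proof -
  have L: "L \<ge> 4" using assms by (simp add: wide_def)
  have "0 \<le> (1 + 3 ^ CARD('d)) * n" using assms(2) of_nat_0_le_iff order_trans by blast
  then have n: "n \<ge> 0" by (simp add: zero_le_mult_iff) (smt (verit) zero_less_power)
  have "discrepancy_constant * (card B * (real CARD('d) * 6 * (L + 2) ^ (CARD('d) - 1)))
     \<le> discrepancy_constant * (((1 + 3 ^ CARD('d)) * n) * (real CARD('d) * 6 * (L + 2) ^ (CARD('d) - 1)))"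
    using L discrepancy_constant_nonneg assms(2) by (intro mult_left_mono mult_right_mono) auto
  also have "\<dots> = (discrepancy_constant * ((1 + 3 ^ CARD('d)) * (real CARD('d) * 6 * (L + 2) ^ (CARD('d) - 1)))) * n"
    by (simp add: mult_ac)
  also have "\<dots> \<le> (point_density * L ^ CARD('d)) * n"
    using assms(1) n by (intro mult_right_mono) (auto simp: wide_def)
  finally show ?thesis .
qed

text \<open>
  The excess of points in the cells of \<open>K\<close> is a boundary term, which the volume
  of the added layer of cells absorbs.
\<close>

lemma card_points_le_neighbourhood:
  fixes L :: real
  assumes "wide L" and K: "finite K"
  shows "real (card (\<Lambda> \<inter> cells L K)) \<le> point_density * (L ^ CARD('d) * card (neighbourhood K))"
proof -
  let ?O = "neighbourhood K - K"
  let ?B = "?O \<union> neighbourhood ?O"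
  have L: "L \<ge> 4" using assms by (simp add: wide_def)
  have fin: "finite ?O" using finite_neighbourhood(1)[OF K] by simp
  have "\<bar>real (card (\<Lambda> \<inter> cells L K)) - point_density * (L ^ CARD('d) * card K)\<bar>
     \<le> discrepancy_constant * (card ?B * (real CARD('d) * 6 * (L + 2) ^ (CARD('d) - 1)))"
  proof (rule cells_discrepancy[OF L K])
    show "finite ?B" using fin finite_neighbourhood(1) by blast
    fix k l :: "int^'d" assume kl: "adjacent k l" "k \<in> K" "l \<notin> K"
    then have l: "l \<in> ?O" using neighbourhoodI[OF kl(2,1)] by blast
    then show "k \<in> ?B \<and> l \<in> ?B" using neighbourhoodI[OF l adjacent_sym[OF kl(1)]] by blast
  qed
  also have "\<dots> \<le> point_density * L ^ CARD('d) * card ?O"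
    by (rule wide_boundary_le[OF assms(1) card_Un_neighbourhood_le[OF fin]])
  finally have *: "\<bar>real (card (\<Lambda> \<inter> cells L K)) - point_density * (L ^ CARD('d) * card K)\<bar>
      \<le> point_density * L ^ CARD('d) * card ?O" .
  have "card (neighbourhood K) = card K + card ?O"
    by (rule card_neighbourhood_split[OF K])
  with * show ?thesis by (simp add: algebra_simps abs_le_iff)
qed

text \<open>
  The boundary of \<open>neighbourhood K\<close> is formed by cells of the added layer and
  their neighbours, so the deficit of points is absorbed by the volume of that layer.
\<close>

lemma card_points_neighbourhood_ge:
  fixes L :: real
  assumes "wide L" and K: "finite K"
  shows "point_density * (L ^ CARD('d) * card K) \<le> real (card (\<Lambda> \<inter> cells L (neighbourhood K)))"
proof -
  let ?K' = "neighbourhood K"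
  let ?O = "?K' - K"
  let ?B = "?O \<union> neighbourhood ?O"
  have L: "L \<ge> 4" using assms by (simp add: wide_def)
  have fin: "finite ?O" using finite_neighbourhood(1)[OF K] by simp
  have "\<bar>real (card (\<Lambda> \<inter> cells L ?K')) - point_density * (L ^ CARD('d) * card ?K')\<bar>
     \<le> discrepancy_constant * (card ?B * (real CARD('d) * 6 * (L + 2) ^ (CARD('d) - 1)))"
  proof (rule cells_discrepancy[OF L finite_neighbourhood(1)[OF K]])
    show "finite ?B" using fin finite_neighbourhood(1) by blast
    fix k l :: "int^'d" assume kl: "adjacent k l" "k \<in> ?K'" "l \<notin> ?K'"
    then have k: "k \<in> ?O" using neighbourhoodI[OF _ kl(1), of K] by blast
    then show "k \<in> ?B \<and> l \<in> ?B" using neighbourhoodI[OF k kl(1)] by blast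
  qed
  also have "\<dots> \<le> point_density * L ^ CARD('d) * card ?O"
    by (rule wide_boundary_le[OF assms(1) card_Un_neighbourhood_le[OF fin]])
  finally have *: "\<bar>real (card (\<Lambda> \<inter> cells L ?K')) - point_density * (L ^ CARD('d) * card ?K')\<bar>
      \<le> point_density * L ^ CARD('d) * card ?O" .
  have "card ?K' = card K + card ?O"
    by (rule card_neighbourhood_split[OF K])
  with * show ?thesis by (simp add: algebra_simps abs_le_iff)
qed

text \<open>
  The side length is a multiple \<open>m * s\<close> of the lattice spacing
  \<open>s\<close>, so that every cell contains exactly \<open>m ^ CARD('d)\<close> lattice
  points, which is the density times its volume.
\<close>

theorem lattice_bijection:
  obtains \<sigma> M where
    "bij_betw \<sigma> ((\<lambda>z. (point_density powr (- 1 / real CARD('d))) *\<^sub>R z) ` integer_lattice) \<Lambda>"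
    "\<forall>h\<in>(\<lambda>z. (point_density powr (- 1 / real CARD('d))) *\<^sub>R z) ` integer_lattice. norm (\<sigma> h - h) \<le> M"
proof -
  define s where "s = point_density powr (- 1 / real CARD('d))"
  let ?Z = "(\<lambda>z. s *\<^sub>R z) ` integer_lattice :: (real^'d) set"
  have s: "s > 0" using point_density_pos by (simp add: s_def)
  have sd: "point_density * s ^ CARD('d) = 1"
  proof -
    have "s ^ CARD('d) = s powr real CARD('d)" using s by (simp add: powr_realpow)
    also have "\<dots> = point_density powr (- 1)" by (simp add: s_def powr_powr)
    finally show ?thesis using point_density_pos by (simp add: powr_minus)
  qed
  obtain E where E: "\<And>L. L \<ge> E \<Longrightarrow> wide L" using wide_exists by blast
  define m where "m = nat \<lceil>\<bar>E\<bar> / s\<rceil> + 1"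
  have m: "m > 0" by (simp add: m_def)
  define L where "L = real m * s"
  have "\<bar>E\<bar> / s \<le> real m" unfolding m_def by linarith
  then have "E \<le> L" using s by (simp add: L_def divide_le_eq)
  then have W: "wide L" by (rule E)
  have L: "L > 0" using s m by (simp add: L_def)
  have DL: "point_density * L ^ CARD('d) = real (m ^ CARD('d))"
    using sd by (simp add: L_def power_mult_distrib mult_ac)
  note lat = scaled_lattice_cells[OF s m, folded L_def]
  have ZL: "card (?Z \<inter> cells L K) \<le> card (\<Lambda> \<inter> cells L (neighbourhood K))" if K: "finite K" for K
  proof -
    have "real (card (?Z \<inter> cells L K)) = point_density * (L ^ CARD('d) * card K)"
      using lat(2)[OF K] DL by (simp add: mult.assoc[symmetric])
    also have "\<dots> \<le> real (card (\<Lambda> \<inter> cells L (neighbourhood K)))"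
      by (rule card_points_neighbourhood_ge[OF W K])
    finally show ?thesis by simp
  qed
  have LZ: "card (\<Lambda> \<inter> cells L K) \<le> card (?Z \<inter> cells L (neighbourhood K))" if K: "finite K" for K
  proof -
    have "real (card (\<Lambda> \<inter> cells L K)) \<le> point_density * (L ^ CARD('d) * card (neighbourhood K))"
      by (rule card_points_le_neighbourhood[OF W K])
    also have "\<dots> = real (card (?Z \<inter> cells L (neighbourhood K)))"
      using lat(2)[OF finite_neighbourhood(1)[OF K]] DL by (simp add: mult.assoc[symmetric])
    finally show ?thesis by simp
  qed
  obtain \<sigma> where "bij_betw \<sigma> ?Z \<Lambda>" "\<forall>x\<in>?Z. norm (\<sigma> x - x) \<le> real CARD('d) * (2 * L)"
    by (rule bounded_displacement_bijection[OF L lat(1) finite_inter_cells[OF L] ZL LZ])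
  then show ?thesis using that unfolding s_def by blast
qed

end

section \<open>Density and uniform spreading\<close>

text \<open>
  Comparison with \<open>1 / (1 + t\<^sup>2)\<close>.
\<close>

lemma integrable_first_moment:
  fixes G :: "real \<Rightarrow> real"
  assumes G: "continuous_on UNIV G" "\<And>t. G t \<ge> 0" "\<And>t. (1 + \<bar>t\<bar>) ^ 3 * G t \<le> C"
  shows "integrable lborel (\<lambda>t. (1 + \<bar>t\<bar>) * G t)"
proof (rule Bochner_Integration.integrable_bound)
  show "integrable lborel (\<lambda>t. C * inverse (1 + t\<^sup>2))"
    using integrable_inverse_1_plus_square by (simp add: set_integrable_def)
  have [measurable]: "G \<in> borel_measurable borel"
    using G(1) by (rule borel_measurable_continuous_onI)
  show "(\<lambda>t. (1 + \<bar>t\<bar>) * G t) \<in> borel_measurable lborel" by measurable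
  show "AE t in lborel. norm ((1 + \<bar>t\<bar>) * G t) \<le> norm (C * inverse (1 + t\<^sup>2))"
  proof (rule AE_I2)
    fix t :: real
    have "(1 + t\<^sup>2) * ((1 + \<bar>t\<bar>) * G t) \<le> (1 + \<bar>t\<bar>)\<^sup>2 * ((1 + \<bar>t\<bar>) * G t)"
      using G(2)[of t] by (intro mult_right_mono) (auto simp: power2_eq_square algebra_simps)
    also have "\<dots> = (1 + \<bar>t\<bar>) ^ 3 * G t" by (simp add: power2_eq_square power3_eq_cube mult_ac)
    also have "\<dots> \<le> C" by (rule G(3))
    finally have "(1 + \<bar>t\<bar>) * G t \<le> C * inverse (1 + t\<^sup>2)"
      by (simp add: field_simps add_pos_nonneg)
    moreover have "0 \<le> (1 + \<bar>t\<bar>) * G t" using G(2)[of t] by simp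
    ultimately show "norm ((1 + \<bar>t\<bar>) * G t) \<le> norm (C * inverse (1 + t\<^sup>2))" by simp
  qed
qed

lemma tensor_first_moment:
  fixes G :: "real \<Rightarrow> real"
  assumes G: "continuous_on UNIV G" "\<And>t. G t \<ge> 0" "integrable lborel (\<lambda>t. (1 + \<bar>t\<bar>) * G t)"
  shows "integrable lborel (\<lambda>x. (1 + norm x) * tensor (\<lambda>_. G) (x :: real^'d))"
proof (rule Bochner_Integration.integrable_bound)
  show "integrable lborel (tensor (\<lambda>_ t. (1 + \<bar>t\<bar>) * G t) :: real^'d \<Rightarrow> real)"
    by (rule tensor_integrable_lborel(1)) (rule G(3))
  have [measurable]: "G \<in> borel_measurable borel"
    using G(1) by (rule borel_measurable_continuous_onI)
  show "(\<lambda>x. (1 + norm x) * tensor (\<lambda>_. G) (x :: real^'d)) \<in> borel_measurable lborel"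
    unfolding tensor_def by measurable
  show "AE x in lborel. norm ((1 + norm x) * tensor (\<lambda>_. G) (x :: real^'d)) \<le> norm (tensor (\<lambda>_ t. (1 + \<bar>t\<bar>) * G t) x)"
  proof (rule AE_I2)
    fix x :: "real^'d"
    have nn: "tensor (\<lambda>_. G) x \<ge> 0" "tensor (\<lambda>_ t. (1 + \<bar>t\<bar>) * G t) x \<ge> 0"
      using G(2) by (auto simp: tensor_def intro!: prod_nonneg mult_nonneg_nonneg)
    have "(1 + norm x) * tensor (\<lambda>_. G) x \<le> (\<Prod>j\<in>UNIV. 1 + \<bar>x $ j\<bar>) * tensor (\<lambda>_. G) x"
      by (intro mult_right_mono one_plus_norm_le_prod nn)
    also have "\<dots> = tensor (\<lambda>_ t. (1 + \<bar>t\<bar>) * G t) x"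
      by (simp add: tensor_def prod.distrib)
    finally show "norm ((1 + norm x) * tensor (\<lambda>_. G) x) \<le> norm (tensor (\<lambda>_ t. (1 + \<bar>t\<bar>) * G t) x)"
      using nn by (simp add: abs_mult)
  qed
qed

lemma quasicrystal_convolution_kernel:
  fixes \<Lambda> :: "(real^'d) set"
  assumes "\<Lambda> \<noteq> {}" and lf: "locally_finite_set \<Lambda>"
    and fq: "fourier_quasicrystal (\<lambda>x. if x \<in> \<Lambda> then 1 else 0)"
  shows "\<exists>g c \<kappa> \<rho>. constant_convolution \<Lambda> g c \<kappa> \<rho>"
proof -
  obtain G :: "real \<Rightarrow> real" and c where
    G': "continuous_on UNIV G" "\<forall>t. G t \<ge> 0" "G 0 > 0" "\<forall>k. \<exists>C. \<forall>t. (1 + \<bar>t\<bar>) ^ k * G t \<le> C"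
    and sum: "\<forall>x. ((\<lambda>p. tensor (\<lambda>_. G) (p - x)) has_sum c) \<Lambda>"
    by (rule quasicrystal_constant_convolution[OF lf fq])
  note G = G'(1) G'(2)[rule_format] G'(3)
  obtain C where C: "\<And>t. (1 + \<bar>t\<bar>) ^ 3 * G t \<le> C" using G'(4) by blast
  define g where "g = (tensor (\<lambda>_. G) :: real^'d \<Rightarrow> real)"
  have "continuous_on UNIV (\<lambda>x::real^'d. G (x $ j))" for j
    by (rule continuous_on_compose2[OF G(1)]) (auto intro!: continuous_intros)
  then have cont: "continuous_on UNIV g"
    unfolding g_def tensor_def by (intro continuous_intros)
  have g0: "g 0 > 0" using G(3) by (simp add: g_def tensor_def)
  have "isCont g 0" using cont by (simp add: continuous_on_eq_continuous_at)
  then obtain \<delta> where \<delta>: "\<delta> > 0" "\<And>x. dist x 0 < \<delta> \<Longrightarrow> dist (g x) (g 0) < g 0 / 2"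
    unfolding continuous_at_eps_delta using g0 by (meson half_gt_zero)
  have "constant_convolution \<Lambda> g c (g 0 / 2) (min \<delta> 1)"
  proof
    show "g \<in> borel_measurable borel" using cont by (rule borel_measurable_continuous_onI)
    show "g x \<ge> 0" for x using G(2) by (auto simp: g_def tensor_def intro!: prod_nonneg)
    show "integrable lborel (\<lambda>x. (1 + norm x) * g x)"
      unfolding g_def by (intro tensor_first_moment integrable_first_moment[where C = C] G C)
    show "g 0 / 2 \<le> g x" if "norm x < min \<delta> 1" for x
      using \<delta>(2)[of x] that by (simp add: dist_real_def abs_if split: if_splits)
    show "((\<lambda>p. g (p - x)) has_sum c) \<Lambda>" for x using sum by (simp add: g_def)
  qed (use assms \<delta> g0 in auto)
  then show ?thesis by blast
qed

theorem theorem6: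
  fixes \<Lambda> :: "(real ^ 'd) set"
  assumes "\<Lambda> \<noteq> {}"
    and "locally_finite_set \<Lambda>"
    and "fourier_quasicrystal (\<lambda>x. if x \<in> \<Lambda> then 1 else 0)"
  shows "\<exists>D::real. D > 0 \<and>
    (\<exists>C R\<^sub>0. \<forall>x. \<forall>R\<ge>R\<^sub>0.
       \<bar>real (card (\<Lambda> \<inter> ball x R)) - D * measure lborel (ball x R)\<bar>
         \<le> C * R ^ (CARD('d) - 1)) \<and>
    (\<exists>\<sigma>. bij_betw \<sigma>
            ((\<lambda>z. (D powr (- 1 / real CARD('d))) *\<^sub>R z) ` integer_lattice) \<Lambda> \<and>
         (\<exists>M. \<forall>h \<in> (\<lambda>z. (D powr (- 1 / real CARD('d))) *\<^sub>R z) ` integer_lattice.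
            norm (\<sigma> h - h) \<le> M))"
proof -
  obtain g c \<kappa> \<rho> where "constant_convolution \<Lambda> g c \<kappa> \<rho>"
    using quasicrystal_convolution_kernel[OF assms] by blast
  then interpret constant_convolution \<Lambda> g c \<kappa> \<rho> .
  show ?thesis
  proof (rule exI[of _ point_density], intro conjI)
    show "point_density > 0" by (rule point_density_pos)
    show "\<exists>C R\<^sub>0. \<forall>x. \<forall>R\<ge>R\<^sub>0.
       \<bar>real (card (\<Lambda> \<inter> ball x R)) - point_density * measure lborel (ball x R)\<bar> \<le> C * R ^ (CARD('d) - 1)"
      using ball_discrepancy by blast
    obtain \<sigma> M where
      "bij_betw \<sigma> ((\<lambda>z. (point_density powr (- 1 / real CARD('d))) *\<^sub>R z) ` integer_lattice) \<Lambda>"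
      "\<forall>h\<in>(\<lambda>z. (point_density powr (- 1 / real CARD('d))) *\<^sub>R z) ` integer_lattice. norm (\<sigma> h - h) \<le> M"
      by (rule lattice_bijection)
    then show "\<exists>\<sigma>. bij_betw \<sigma> ((\<lambda>z. (point_density powr (- 1 / real CARD('d))) *\<^sub>R z) ` integer_lattice) \<Lambda> \<and>
         (\<exists>M. \<forall>h \<in> (\<lambda>z. (point_density powr (- 1 / real CARD('d))) *\<^sub>R z) ` integer_lattice. norm (\<sigma> h - h) \<le> M)"
      by blast
  qed
qed

end
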